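(* Let $n\ge 1$ and let $S_n=R_n^\omega$ be the ring of $\omega$-invariants in $R_n=H^\bullet(\mathrm{Gr}(n,n);\mathbb{F}_2)$. Then $S_n$ is the commutative $\mathbb{F}_2$-algebra generated by $p_j$ for odd $j$ with $1\le j<2n$, together with symbols $\delta a$ for square-free monomials $a$ (of strictly positive degree) in the variables $w_i$ with $i$ even and $2\le i\le n$, modulo the following relations: (1) for every odd $k$ with $1\le k<2n$, $$p_k^2=\sum_{i=0}^{(k-1)/2}\bigl[\delta(w_{2i}w_{2(k-i)})+\delta(w_{2i})\,\delta(w_{2(k-i)})\bigr];$$ (2) for all square-free monomials $x,y,z$ in the variables $w_i$ with $i$ even and $2\le i\le n$, $$\delta(yz)\,\delta x+\delta(xz)\,\delta y+\delta(xy)\,\delta z=\delta x\,\delta y\,\delta z;$$ (3) for every odd $k$ with $n<k<2n$ and every square-free monomial $x$ (including $x=1$) in the variables $w_i$ with $i$ even and $2\le i\le n$, $$\delta(x\,w_k)=0 .$$ Here the generator $p_j$ corresponds to the power sum $p_j\in S_n$ and $\delta a$ corresponds to $da=a+\overline{a}\in S_n$, and $\delta$ of a general element of $R$ is interpreted as in the context.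
   Context: $R=\mathbb{F}_2[w_1,w_2,w_3,\dots]$ is the polynomial ring graded by $\deg w_i=i$, with $w_0=1$. The ring involution $\omega\colon R\to R$, $x\mapsto\overline{x}$, is defined recursively by $\sum_{i=0}^k w_i\overline{w}_{k-i}=0$ for $k\ge 1$ ($\overline{w}_0=1$). Put $dx=x+\overline{x}$. The power sums $p_k\in R$ are defined recursively by $k w_k=\sum_{j=0}^{k-1}p_{k-j}w_j$ ($k\ge 1$); they are $\omega$-invariant and satisfy $p_k^2=p_{2k}$. $\mathrm{Gr}(n,n)$ is the real Grassmannian of $n$-planes in $\mathbb{R}^{2n}$, and $R_n=H^\bullet(\mathrm{Gr}(n,n);\mathbb{F}_2)=\mathbb{F}_2[w_1,\dots,w_n]/(\overline{w}_{n+1},\dots,\overline{w}_{2n})$, where $\overline{w}_k$ is computed by the same formulae as in $R$ with $w_j=0$ for $j>n$. Equivalently $R_n$ is the quotient of $R$ by the ideal generated by all $w_j$ and $\overline{w}_j$ with $j>n$; this ideal is $\omega$-stable, so $\omega$ induces an involution on $R_n$, and elements of $R$ such as $p_j$ have images in $R_n$. "Square-free monomial" means a product of distinct variables. Interpretation of $\delta x$ for $x\in R$: it is known that $R$ has an $\mathbb{F}_2$-basis consisting of all $p\,a\,dw_{2i_1}\cdots dw_{2i_r}$, where $p$ is a square-free monomial in the variables $p_{2i-1}$ ($i\ge 1$), $a$ is a square-free monomial in the variables $w_{2i}$ ($i\ge 1$), and $1\le i_1\le\dots\le i_r$, $r\ge 0$. For such a basis element set $\delta x=p\,(\delta a)\,(\delta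 w_{2i_1})\cdots(\delta w_{2i_r})$, with $\delta 1=0$, and extend linearly to $R$. In all such expressions, the following are read as zero: $p_j$ for odd $j>2n$, and $\delta a$ for any square-free monomial $a$ in the variables $w_{2i}$ that contains some $w_j$ with $j$ even and $j>n$. For even $k=2^ij$ with $j$ odd, $p_k$ means $p_j^{2^i}$. *)

theory Defs
  imports "HOL-Library.Poly_Mapping" "HOL-Library.Z2" "HOL-Library.Multiset" "HOL-Algebra.QuotRing"
begin

type_synonym 'v mpoly2 = "('v \<Rightarrow>\<^sub>0 nat) \<Rightarrow>\<^sub>0 bit"

definition Var :: "'v \<Rightarrow> 'v mpoly2" where
  "Var v = Poly_Mapping.single (Poly_Mapping.single v 1) 1"

definition poly_ring :: "'v set \<Rightarrow> 'v mpoly2 ring" where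
  "poly_ring V =
     \<lparr>carrier = {f. \<forall>m\<in>Poly_Mapping.keys f. Poly_Mapping.keys m \<subseteq> V},
      monoid.mult = (*), one = 1, zero = 0, add = (+)\<rparr>"

text \<open>Substitution of polynomials for the variables; every monomial that occurs in a
  polynomial over the field with two elements has coefficient 1.\<close>

definition poly_subst :: "('v \<Rightarrow> 'u mpoly2) \<Rightarrow> 'v mpoly2 \<Rightarrow> 'u mpoly2" where
  "poly_subst g f = (\<Sum>m\<in>Poly_Mapping.keys f. \<Prod>v\<in>Poly_Mapping.keys m. g v ^ Poly_Mapping.lookup m v)"

lemma poly_ring_simps [simp]:
  "carrier (poly_ring V) = {f. \<forall>m\<in>Poly_Mapping.keys f. Poly_Mapping.keys m \<subseteq> V}"
  "x \<otimes>\<^bsub>poly_ring V\<^esub> y = x * y" "\<one>\<^bsub>poly_ring V\<^esub> = 1"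
  "x \<oplus>\<^bsub>poly_ring V\<^esub> y = x + y" "\<zero>\<^bsub>poly_ring V\<^esub> = 0"
  by (simp_all add: poly_ring_def)

lemma cring_poly_ring: "cring (poly_ring V)"
proof (rule cringI)
  show "abelian_group (poly_ring V)"
  proof (rule abelian_groupI)
    fix x y assume "x \<in> carrier (poly_ring V)" "y \<in> carrier (poly_ring V)"
    then show "x \<oplus>\<^bsub>poly_ring V\<^esub> y \<in> carrier (poly_ring V)"
      using Poly_Mapping.keys_add[of x y] by fastforce
  next
    fix x assume "x \<in> carrier (poly_ring V)"
    then show "\<exists>y\<in>carrier (poly_ring V). y \<oplus>\<^bsub>poly_ring V\<^esub> x = \<zero>\<^bsub>poly_ring V\<^esub>"
      by (intro bexI[of _ "- x"]) simp_all
  qed (simp_all add: add.assoc add.commute)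
  show "Group.comm_monoid (poly_ring V)"
  proof (rule Group.comm_monoidI)
    fix x y :: "'a mpoly2"
    assume x: "x \<in> carrier (poly_ring V)" and y: "y \<in> carrier (poly_ring V)"
    have "Poly_Mapping.keys (a + b) \<subseteq> V" if "a \<in> Poly_Mapping.keys x" "b \<in> Poly_Mapping.keys y" for a b
      using that x y Poly_Mapping.keys_add[of a b] by fastforce
    then show "x \<otimes>\<^bsub>poly_ring V\<^esub> y \<in> carrier (poly_ring V)"
      using keys_mult[of x y] by fastforce
  qed (simp_all add: mult.assoc mult.commute)
qed (simp add: distrib_right)

abbreviation w_ring :: "nat mpoly2 ring" where
  "w_ring \<equiv> poly_ring {1..}"

definition W :: "nat \<Rightarrow> nat mpoly2" where
  "W k = (if k = 0 then 1 else Var k)"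

fun W_bar :: "nat \<Rightarrow> nat mpoly2" where
  "W_bar 0 = 1"
| "W_bar (Suc k) = - (\<Sum>i\<le>k. W (Suc i) * W_bar (k - i))"

lemma W_bar_recursion:
  assumes "k \<ge> 1"
  shows "(\<Sum>i=0..k. W i * W_bar (k - i)) = 0"
proof -
  obtain l where l: "k = Suc l" using assms by (cases k) auto
  have "(\<Sum>i=0..k. W i * W_bar (k - i)) = W_bar k + (\<Sum>i\<le>l. W (Suc i) * W_bar (l - i))"
    unfolding l atLeast0AtMost by (subst sum.atMost_Suc_shift) (simp add: W_def)
  then show ?thesis by (simp add: l)
qed

definition omega :: "nat mpoly2 \<Rightarrow> nat mpoly2" where
  "omega = poly_subst W_bar"

definition dd :: "nat mpoly2 \<Rightarrow> nat mpoly2" where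
  "dd x = x + omega x"

text \<open>The value at 0 is irrelevant.\<close>

fun psum :: "nat \<Rightarrow> nat mpoly2" where
  "psum 0 = 0"
| "psum (Suc k) = of_nat (Suc k) * W (Suc k) - (\<Sum>j<k. psum (k - j) * W (Suc j))"

lemma psum_recursion:
  assumes "k \<ge> 1"
  shows "of_nat k * W k = (\<Sum>j=0..k-1. psum (k - j) * W j)"
proof -
  obtain l where l: "k = Suc l" using assms by (cases k) auto
  have "(\<Sum>j=0..k-1. psum (k - j) * W j) = (\<Sum>j<Suc l. psum (Suc l - j) * W j)"
    by (rule sum.cong) (auto simp: l)
  also have "\<dots> = psum k + (\<Sum>j<l. psum (l - j) * W (Suc j))"
    by (subst sum.lessThan_Suc_shift) (simp add: W_def l)
  finally show ?thesis by (simp add: l)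
qed

text \<open>The mod 2 cohomology ring of the Grassmannian of n-planes in real 2n-space is given by its
  presentation $\mathbb{F}_2[w_1,\dots,w_n]/(\overline{w}_{n+1},\dots,\overline{w}_{2n})$, written
  as a quotient of \<open>w_ring\<close> by an ideal that is visibly stable under \<open>omega\<close>.\<close>

definition Gr_ideal :: "nat \<Rightarrow> nat mpoly2 set" where
  "Gr_ideal n = Idl\<^bsub>w_ring\<^esub> (W ` {n<..} \<union> W_bar ` {n<..})"

definition R_Gr :: "nat \<Rightarrow> nat mpoly2 set ring" where
  "R_Gr n = w_ring Quot Gr_ideal n"

text \<open>As \<open>Gr_ideal n\<close> is stable under \<open>omega\<close>, the induced involution of the quotient sends
  a coset C to its image \<open>omega ` C\<close>.\<close>

definition S_Gr :: "nat \<Rightarrow> nat mpoly2 set ring" where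
  "S_Gr n = (R_Gr n)\<lparr>carrier := {C \<in> carrier (R_Gr n). omega ` C = C}\<rparr>"

definition class_Gr :: "nat \<Rightarrow> nat mpoly2 \<Rightarrow> nat mpoly2 set" where
  "class_Gr n x = Gr_ideal n +>\<^bsub>w_ring\<^esub> x"

text \<open>A square-free monomial is encoded by the set of indices of its variables.\<close>

definition sqf_mon :: "nat set \<Rightarrow> nat mpoly2" where
  "sqf_mon A = (\<Prod>i\<in>A. W i)"

definition evens :: "nat \<Rightarrow> nat set" where
  "evens n = {i. even i \<and> 2 \<le> i \<and> i \<le> n}"

text \<open>\<open>P_sym j\<close> is the generator $p_j$, and \<open>D_sym A\<close> the generator $\delta a$ for the square-free
  monomial $a$ with index set \<open>A\<close>.\<close>

datatype gen = P_sym nat | D_sym "nat set"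

definition gens :: "nat \<Rightarrow> gen set" where
  "gens n = P_sym ` {j. odd j \<and> j < 2 * n} \<union> D_sym ` {A. A \<subseteq> evens n \<and> A \<noteq> {}}"

abbreviation free_alg :: "nat \<Rightarrow> gen mpoly2 ring" where
  "free_alg n \<equiv> poly_ring (gens n)"

text \<open>Generators outside of the range determined by n are read as zero, and $\delta 1 = 0$.\<close>

definition p_gen :: "nat \<Rightarrow> nat \<Rightarrow> gen mpoly2" where
  "p_gen n j = (if j < 2 * n then Var (P_sym j) else 0)"

definition delta_gen :: "nat \<Rightarrow> nat set \<Rightarrow> gen mpoly2" where
  "delta_gen n A = (if A \<subseteq> evens n \<and> A \<noteq> {} then Var (D_sym A) else 0)"

text \<open>The basis of \<open>w_ring\<close> consists of the elements $p\,a\,dw_{2i_1}\cdots dw_{2i_r}$. The index of such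
  an element is a triple: the set of indices of the power sums in $p$, the set of indices of
  the variables in $a$, and the multiset of the numbers $2i_1, \dots, 2i_r$.\<close>

type_synonym basis_index = "nat set \<times> nat set \<times> nat multiset"

definition basis_indices :: "basis_index set" where
  "basis_indices = {(B, A, M).
     finite B \<and> (\<forall>j\<in>B. odd j) \<and>
     finite A \<and> (\<forall>i\<in>A. even i \<and> i > 0) \<and>
     (\<forall>i\<in>#M. even i \<and> i > 0)}"

definition basis_elt :: "basis_index \<Rightarrow> nat mpoly2" where
  "basis_elt = (\<lambda>(B, A, M). (\<Prod>j\<in>B. psum j) * sqf_mon A * (\<Prod>i\<in>#M. dd (W i)))"

definition delta_basis :: "nat \<Rightarrow> basis_index \<Rightarrow> gen mpoly2" where
  "delta_basis n = (\<lambda>(B, A, M).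
     (\<Prod>j\<in>B. p_gen n j) * delta_gen n A * (\<Prod>i\<in>#M. delta_gen n {i}))"

text \<open>Over the field with two elements, the expansion of an element in a basis amounts to the
  unique finite set of basis elements whose sum it is. That these elements do form a basis can be
  seen from their lowest terms with respect to the number of factors: those of $p_{2i-1}$,
  $w_{2i}$ and $dw_{2i}$ are $w_{2i-1}$, $w_{2i}$ and $w_i^2$.\<close>

definition basis_support :: "nat mpoly2 \<Rightarrow> basis_index set" where
  "basis_support x =
     (THE T. finite T \<and> T \<subseteq> basis_indices \<and> (\<Sum>s\<in>T. basis_elt s) = x)"

definition delta :: "nat \<Rightarrow> nat mpoly2 \<Rightarrow> gen mpoly2" where
  "delta n x = (\<Sum>s\<in>basis_support x. delta_basis n s)"

definition sqf_mons :: "nat \<Rightarrow> nat mpoly2 set" where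
  "sqf_mons n = sqf_mon ` Pow (evens n)"

definition rels1 :: "nat \<Rightarrow> gen mpoly2 set" where
  "rels1 n = {Var (P_sym k) ^ 2 -
       (\<Sum>i=0..(k - 1) div 2. delta n (W (2 * i) * W (2 * (k - i)))
          + delta n (W (2 * i)) * delta n (W (2 * (k - i)))) | k. odd k \<and> k < 2 * n}"

definition rels2 :: "nat \<Rightarrow> gen mpoly2 set" where
  "rels2 n = {delta n (y * z) * delta n x + delta n (x * z) * delta n y + delta n (x * y) * delta n z
       - delta n x * delta n y * delta n z
     | x y z. x \<in> sqf_mons n \<and> y \<in> sqf_mons n \<and> z \<in> sqf_mons n}"

definition rels3 :: "nat \<Rightarrow> gen mpoly2 set" where
  "rels3 n = {delta n (x * W k) | x k. x \<in> sqf_mons n \<and> odd k \<and> n < k \<and> k < 2 * n}"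

definition rel_ideal :: "nat \<Rightarrow> gen mpoly2 set" where
  "rel_ideal n = Idl\<^bsub>free_alg n\<^esub> (rels1 n \<union> rels2 n \<union> rels3 n)"

definition presented_alg :: "nat \<Rightarrow> gen mpoly2 set ring" where
  "presented_alg n = free_alg n Quot rel_ideal n"

definition class_pres :: "nat \<Rightarrow> gen mpoly2 \<Rightarrow> gen mpoly2 set" where
  "class_pres n f = rel_ideal n +>\<^bsub>free_alg n\<^esub> f"

end

theory Submission
  imports Defs "HOL-Computational_Algebra.Formal_Power_Series"
begin

text \<open>
  Call the elements $dr$ traces. By the basis, $R$ is, as a module over the group of order 2, the sum
  of the trivial module spanned by the square-free monomials in the odd power sums and of a free
  module, so these monomials represent the invariants of $R$ modulo traces.

  The same holds for $R_n$ and the monomials in $p_1, p_3, \<dots>, p_{2n-1}$, by induction on $n$: the ideals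
  $(w_n)$ and $(\overline{w}_n)$ of $R_n$ are exchanged by the involution, they intersect in
  $p_{2n-1} R_n = w_n \overline{w}_{n-1} R_n$, which is a copy of $R_{n-1}$, and the quotient by their sum
  is $R_{n-1}$ again. The exactness needed here is that multiplication by $w_k$ embeds the cohomology
  ring of the Grassmannian of type $(k, l-1)$ into that of type $(k, l)$. It holds because the only
  relations between $\overline{w}_l, \<dots>, \overline{w}_{l+k-1}$ over $\mathbb{F}_2[w_1, \<dots>, w_k]$ are the
  Koszul relations.

  Modulo the relations of the presentation, $\delta$ satisfies $\delta(p_j x) = p_j\,\delta x$ and
  $\delta(x\,dy) = \delta x\,\delta y$, and it vanishes on the ideal $I_n$ that defines $R_n$. So every element
  of the presented algebra is a sum of square-free monomials in the $p_j$ and of some $\delta x$. If it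
  maps to zero in $R_n$, no monomials are left, as they are independent modulo traces, and $x$ is
  invariant modulo $I_n$. Then $x$ is a sum of monomials, a trace $dr$ and an element of $I_n$, and each
  of these is annihilated by $\delta$: for the trace because $\delta(dr) = \delta(1)\,\delta r = 0$.
\<close>

\<comment> \<open>The claims about delta depend on each other, because delta is read off a basis
  that is not closed under products: multiplication creates p_j^2 and w_m^2. Relation (1) disposes
  of p_j^2, relation (2) is the product rule on square-free monomials, and relation (3) covers odd
  w_k below 2n. No relation is imposed for even m > n, so w_m^2 must be rewritten through p_m^2,
  which is a sum of products w_i wbar_(2m-i) over the even indices and also over the odd ones; the
  terms are then settled by larger even indices, smaller odd indices or smaller weight.

  These formulas come from generating functions. Let W, V and P be the series of the w_i, wbar_i and
  p_i. In characteristic 2 the series X W' is the odd part of W, and it equals P W by the recursion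
  for the p_i. As W V = 1 and signs do not matter, the odd part of V is P V with the same P. So the
  even parts are W (1 + P) and V (1 + P), and products of even and odd parts of W and V yield all
  identities for p_k and p_m^2.\<close>
alias keys = Poly_Mapping.keys
alias lookup = Poly_Mapping.lookup

section \<open>Polynomials over the field with two elements\<close>

text \<open>One class for \<open>bit\<close>, polynomials, R and power series over R, so that all of
  them share a calculus without signs: \<open>x + x = 0\<close> and \<open>x - y = x + y\<close> as
  simplification rules.\<close>

class comm_ring_char2 = comm_ring_1 +
  assumes one_plus_one: "1 + 1 = 0"
begin

lemma add_self [simp]: "x + x = 0"
  using arg_cong[OF one_plus_one, of "\<lambda>y. x * y"] by (simp only: distrib_left mult_1_right mult_zero_right)

lemma two_eq_0 [simp]: "2 = 0"
  using one_plus_one by (simp only: one_add_one)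

lemma add_self_left [simp]: "x + (x + y) = y"
  by (simp add: add.assoc[symmetric])

lemma minus_char2 [simp]: "- x = x"
  by (rule minus_unique) simp

lemma diff_char2 [simp]: "x - y = x + y"
  by (simp only: diff_conv_add_uminus minus_char2)

lemma add_eq_0_char2: "x + y = 0 \<longleftrightarrow> x = y"
  using eq_neg_iff_add_eq_0[of x y] by auto

lemma of_nat_char2: "of_nat n = (if even n then 0 else 1)"
  by (induction n) (auto simp: one_plus_one)

end

instance bit :: comm_ring_char2
  by standard simp

instance poly_mapping :: (comm_monoid_add, comm_ring_char2) comm_ring_char2
proof
  show "1 + 1 = (0 :: 'a \<Rightarrow>\<^sub>0 'b)"
    by (rule poly_mapping_eqI) (simp only: lookup_add add_self lookup_zero)
qed

definition monom_subst :: "('v \<Rightarrow> 'a::comm_monoid_mult) \<Rightarrow> ('v \<Rightarrow>\<^sub>0 nat) \<Rightarrow> 'a" where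
  "monom_subst g m = (\<Prod>v\<in>keys m. g v ^ lookup m v)"

lemma monom_subst_superset:
  assumes "finite V" "keys m \<subseteq> V"
  shows "monom_subst g m = (\<Prod>v\<in>V. g v ^ lookup m v)"
  unfolding monom_subst_def using assms
  by (intro prod.mono_neutral_left) (auto simp: in_keys_iff)

lemma monom_subst_0 [simp]: "monom_subst g 0 = 1"
  by (simp add: monom_subst_def)

lemma monom_subst_add: "monom_subst g (m + m') = monom_subst g m * monom_subst g m'"
proof -
  let ?V = "keys m \<union> keys m'"
  have "monom_subst g (m + m') = (\<Prod>v\<in>?V. g v ^ lookup (m + m') v)"
    using Poly_Mapping.keys_add[of m m'] by (intro monom_subst_superset) auto
  also have "\<dots> = (\<Prod>v\<in>?V. g v ^ lookup m v) * (\<Prod>v\<in>?V. g v ^ lookup m' v)"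
    by (simp add: lookup_add power_add prod.distrib)
  finally show ?thesis
    by (simp add: monom_subst_superset[of ?V])
qed

lemma monom_subst_single [simp]: "monom_subst g (Poly_Mapping.single v k) = g v ^ k"
  by (simp add: monom_subst_superset[of "{v}"])

lemma mpoly2_sum_keys: "f = (\<Sum>m\<in>keys f. Poly_Mapping.single m (1 :: bit))"
proof (rule poly_mapping_eqI)
  fix k
  have "lookup (\<Sum>m\<in>keys f. Poly_Mapping.single m (1 :: bit)) k = (\<Sum>m\<in>keys f. if m = k then 1 else 0)"
    by (simp add: lookup_sum lookup_single when_def)
  then show "lookup f k = lookup (\<Sum>m\<in>keys f. Poly_Mapping.single m (1 :: bit)) k"
    by (simp add: in_keys_iff)
qed

lemma mpoly2_induct [case_names zero add]:
  assumes "P 0" and "\<And>m f. P f \<Longrightarrow> P (Poly_Mapping.single m (1 :: bit) + f)"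
  shows "P f"
proof -
  have "P (\<Sum>m\<in>A. Poly_Mapping.single m 1)" if "finite A" for A
    using that by (induction A) (use assms in auto)
  then show ?thesis
    by (subst mpoly2_sum_keys) simp
qed

text \<open>Terms may cancel in a sum, so supports do not add up. Summing over a common finite
  superset, with the coefficient as a switch, makes additivity a termwise check.\<close>

lemma poly_subst_superset:
  assumes "finite S" "keys f \<subseteq> S"
  shows "poly_subst g f = (\<Sum>m\<in>S. if lookup f m = 0 then 0 else monom_subst g m)"
proof -
  have "(\<Sum>m\<in>S. if lookup f m = 0 then 0 else monom_subst g m)
      = (\<Sum>m\<in>keys f. if lookup f m = 0 then 0 else monom_subst g m)"
    using assms by (intro sum.mono_neutral_right) (auto simp: in_keys_iff)
  also have "\<dots> = (\<Sum>m\<in>keys f. monom_subst g m)"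
    by (intro sum.cong) (auto simp: in_keys_iff)
  finally show ?thesis
    by (simp add: poly_subst_def monom_subst_def)
qed

lemma poly_subst_0 [simp]: "poly_subst g 0 = 0"
  by (simp add: poly_subst_def)

lemma poly_subst_single: "poly_subst g (Poly_Mapping.single m 1) = monom_subst g m"
  by (simp add: poly_subst_superset[of "{m}"])

lemma poly_subst_1 [simp]: "poly_subst g 1 = 1"
  using poly_subst_single[of g 0] by simp

lemma poly_subst_Var [simp]: "poly_subst g (Var v) = g v"
  by (simp add: Var_def poly_subst_single)

lemma poly_subst_add [simp]: "poly_subst g (a + b) = poly_subst g a + poly_subst g b"
proof -
  let ?S = "keys a \<union> keys b"
  have *: "(if x + y = 0 then 0 else z) = (if x = 0 then 0 else z) + (if y = 0 then 0 else z)"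
    for x y :: bit and z :: "'a mpoly2"
    by (cases x; cases y) auto
  have "poly_subst g (a + b) = (\<Sum>m\<in>?S. if lookup (a + b) m = 0 then 0 else monom_subst g m)"
    using Poly_Mapping.keys_add[of a b] by (intro poly_subst_superset) auto
  also have "\<dots> = (\<Sum>m\<in>?S. if lookup a m = 0 then 0 else monom_subst g m)
                + (\<Sum>m\<in>?S. if lookup b m = 0 then 0 else monom_subst g m)"
    unfolding lookup_add * by (rule sum.distrib)
  finally show ?thesis
    by (simp add: poly_subst_superset[of ?S])
qed

lemma poly_subst_mult [simp]: "poly_subst g (a * b) = poly_subst g a * poly_subst g b"
proof (induction a rule: mpoly2_induct)
  case (add m a)
  have "poly_subst g (Poly_Mapping.single m 1 * b) = monom_subst g m * poly_subst g b"
    by (induction b rule: mpoly2_induct)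
      (simp_all add: distrib_left mult_single poly_subst_single monom_subst_add)
  with add show ?case
    by (simp add: distrib_right poly_subst_single)
qed simp

lemma poly_subst_sum [simp]: "poly_subst g (\<Sum>i\<in>A. f i) = (\<Sum>i\<in>A. poly_subst g (f i))"
  by (induction A rule: infinite_finite_induct) auto

lemma poly_subst_prod [simp]: "poly_subst g (\<Prod>i\<in>A. f i) = (\<Prod>i\<in>A. poly_subst g (f i))"
  by (induction A rule: infinite_finite_induct) auto

lemma single_eq_monom_subst: "Poly_Mapping.single m (1 :: bit) = monom_subst Var m"
proof -
  have "Poly_Mapping.single (\<Sum>v\<in>A. Poly_Mapping.single v (k v)) (1 :: bit) = (\<Prod>v\<in>A. Var v ^ k v)" 
    if "finite A" for A and k :: "'a \<Rightarrow> nat"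
    using that
  proof induction
    case (insert v A)
    have "Poly_Mapping.single (Poly_Mapping.single v j) (1 :: bit) = Var v ^ j" for j
    proof (induction j)
      case (Suc j)
      have "Poly_Mapping.single v (Suc j) = Poly_Mapping.single v 1 + Poly_Mapping.single v j"
        by (simp add: single_add[symmetric])
      then show ?case
        using Suc mult_single[of "Poly_Mapping.single v 1" "1 :: bit" "Poly_Mapping.single v j" 1]
        by (simp add: Var_def)
    qed simp
    with insert show ?case
      using mult_single[of "Poly_Mapping.single v (k v)" "1 :: bit"
          "\<Sum>v\<in>A. Poly_Mapping.single v (k v)" 1] by simp
  qed simp
  moreover have "m = (\<Sum>v\<in>keys m. Poly_Mapping.single v (lookup m v))"
    by (rule poly_mapping_eqI) (auto simp: lookup_sum lookup_single when_def in_keys_iff)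
  ultimately show ?thesis
    unfolding monom_subst_def by (metis finite_keys)
qed

lemma poly_carrier_closed [simp, intro]:
  "0 \<in> carrier (poly_ring V)" "1 \<in> carrier (poly_ring V)"
  "x \<in> carrier (poly_ring V) \<Longrightarrow> y \<in> carrier (poly_ring V) \<Longrightarrow> x + y \<in> carrier (poly_ring V)"
  "x \<in> carrier (poly_ring V) \<Longrightarrow> y \<in> carrier (poly_ring V) \<Longrightarrow> x * y \<in> carrier (poly_ring V)"
  "v \<in> V \<Longrightarrow> Var v \<in> carrier (poly_ring V)"
proof -
  interpret cring "poly_ring V" by (rule cring_poly_ring)
  show "x \<in> carrier (poly_ring V) \<Longrightarrow> y \<in> carrier (poly_ring V) \<Longrightarrow> x + y \<in> carrier (poly_ring V)"
    "x \<in> carrier (poly_ring V) \<Longrightarrow> y \<in> carrier (poly_ring V) \<Longrightarrow> x * y \<in> carrier (poly_ring V)"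
    using a_closed[of x y] m_closed[of x y] by (simp_all only: poly_ring_simps)
qed (auto simp: Var_def)

declare poly_ring_simps(1) [simp del]

lemma poly_carrier_sum [simp, intro]:
  "(\<And>i. i \<in> A \<Longrightarrow> f i \<in> carrier (poly_ring V)) \<Longrightarrow> (\<Sum>i\<in>A. f i) \<in> carrier (poly_ring V)"
  by (induction A rule: infinite_finite_induct) auto

lemma poly_carrier_prod [simp, intro]:
  "(\<And>i. i \<in> A \<Longrightarrow> f i \<in> carrier (poly_ring V)) \<Longrightarrow> (\<Prod>i\<in>A. f i) \<in> carrier (poly_ring V)"
  by (induction A rule: infinite_finite_induct) auto

lemma poly_carrier_power [simp, intro]:
  "x \<in> carrier (poly_ring V) \<Longrightarrow> x ^ k \<in> carrier (poly_ring V)"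
  by (induction k) auto

lemma poly_subst_closed:
  assumes "\<And>v. g v \<in> carrier (poly_ring V)"
  shows "poly_subst g f \<in> carrier (poly_ring V)"
  unfolding poly_subst_def using assms by (intro poly_carrier_sum poly_carrier_prod poly_carrier_power)

lemma poly_subst_cong:
  assumes "f \<in> carrier (poly_ring V)" "\<And>v. v \<in> V \<Longrightarrow> g v = h v"
  shows "poly_subst g f = poly_subst h f"
  unfolding poly_subst_def using assms
  by (intro sum.cong prod.cong) (auto simp: poly_ring_simps(1) subset_iff)

lemma poly_subst_Var_id: "poly_subst Var f = f"
  using mpoly2_sum_keys[of f] by (simp add: poly_subst_def single_eq_monom_subst monom_subst_def)

lemma poly_ring_induct [consumes 1, case_names zero one add mult]:
  assumes f: "f \<in> carrier (poly_ring V)"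
    and zero: "P 0" and one: "P 1"
    and add: "\<And>f g. f \<in> carrier (poly_ring V) \<Longrightarrow> g \<in> carrier (poly_ring V) \<Longrightarrow> P f \<Longrightarrow> P g \<Longrightarrow> P (f + g)"
    and mult: "\<And>v f. v \<in> V \<Longrightarrow> f \<in> carrier (poly_ring V) \<Longrightarrow> P f \<Longrightarrow> P (Var v * f)"
  shows "P f"
proof -
  have pow: "g \<in> carrier (poly_ring V) \<and> P g \<Longrightarrow> v \<in> V \<Longrightarrow> Var v ^ k * g \<in> carrier (poly_ring V) \<and> P (Var v ^ k * g)" for k v g
    by (induction k) (auto simp: mult.assoc intro!: mult)
  have mon: "(\<Prod>v\<in>A. Var v ^ k v) \<in> carrier (poly_ring V) \<and> P (\<Prod>v\<in>A. Var v ^ k v)" 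
    if "finite A" "A \<subseteq> V" for A and k :: "'a \<Rightarrow> nat"
    using that
  proof induction
    case (insert v A)
    then show ?case using pow by simp
  qed (simp add: one)
  have "(\<Sum>m\<in>A. monom_subst Var m) \<in> carrier (poly_ring V) \<and> P (\<Sum>m\<in>A. monom_subst Var m)"
    if "finite A" "A \<subseteq> keys f" for A
    using that
  proof induction
    case (insert m A)
    moreover have "keys m \<subseteq> V"
      using f insert by (auto simp: poly_ring_simps(1))
    ultimately show ?case 
      using mon[of "keys m" "lookup m"] by (auto simp: monom_subst_def intro!: add)
  qed (simp add: zero)
  from this[of "keys f"] show ?thesis
    using mpoly2_sum_keys[of f] by (simp add: single_eq_monom_subst)
qed

section \<open>The ring R\<close>

text \<open>R as a type rather than a carrier set: it becomes an instance of the ring classes, so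
  that sums, spans and power series over it are available. The carrier leaves out the monomials in
  \<open>Var 0\<close>.\<close>

typedef wpoly = "carrier (poly_ring {1 :: nat..})"
  by blast

setup_lifting type_definition_wpoly

instantiation wpoly :: comm_ring_char2
begin

lift_definition zero_wpoly :: wpoly is 0 by simp
lift_definition one_wpoly :: wpoly is 1 by simp
lift_definition plus_wpoly :: "wpoly \<Rightarrow> wpoly \<Rightarrow> wpoly" is "(+)" by (rule poly_carrier_closed)
lift_definition times_wpoly :: "wpoly \<Rightarrow> wpoly \<Rightarrow> wpoly" is "(*)" by (rule poly_carrier_closed)
lift_definition uminus_wpoly :: "wpoly \<Rightarrow> wpoly" is "\<lambda>x. x" .
lift_definition minus_wpoly :: "wpoly \<Rightarrow> wpoly \<Rightarrow> wpoly" is "(+)" by (rule poly_carrier_closed)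

instance
  by standard (transfer; simp add: algebra_simps one_plus_one)+

end

lemma Rep_wpoly_simps [simp]:
  "Rep_wpoly 0 = 0" "Rep_wpoly 1 = 1"
  "Rep_wpoly (x + y) = Rep_wpoly x + Rep_wpoly y"
  "Rep_wpoly (x * y) = Rep_wpoly x * Rep_wpoly y"
  by (simp_all add: zero_wpoly.rep_eq one_wpoly.rep_eq plus_wpoly.rep_eq times_wpoly.rep_eq)

lemma Rep_wpoly_sum [simp]: "Rep_wpoly (\<Sum>i\<in>A. f i) = (\<Sum>i\<in>A. Rep_wpoly (f i))"
  by (induction A rule: infinite_finite_induct) auto

lemma Rep_wpoly_prod [simp]: "Rep_wpoly (\<Prod>i\<in>A. f i) = (\<Prod>i\<in>A. Rep_wpoly (f i))"
  by (induction A rule: infinite_finite_induct) auto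

lemma Rep_wpoly_power [simp]: "Rep_wpoly (x ^ k) = Rep_wpoly x ^ k"
  by (induction k) auto

lemma W_closed: "W k \<in> carrier (poly_ring {1..})"
  by (simp add: W_def)

lemma W_bar_closed: "W_bar k \<in> carrier (poly_ring {1..})"
proof (induction k rule: less_induct)
  case (less k)
  then show ?case
    by (cases k)
      (auto simp del: One_nat_def simp: W_closed intro!: poly_carrier_sum poly_carrier_closed(4))
qed

lemma psum_closed: "psum k \<in> carrier (poly_ring {1..})"
proof (induction k rule: less_induct)
  case (less k)
  then show ?case
    by (cases k) 
      (auto simp: of_nat_char2 W_closed simp del: of_nat_Suc One_nat_def
        intro!: poly_carrier_sum poly_carrier_closed(3,4))
qed

lift_definition w :: "nat \<Rightarrow> wpoly" is W by (rule W_closed)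
lift_definition wbar :: "nat \<Rightarrow> wpoly" is W_bar by (rule W_bar_closed)
lift_definition pw :: "nat \<Rightarrow> wpoly" is psum by (rule psum_closed)
lift_definition bar :: "wpoly \<Rightarrow> wpoly" is omega
  unfolding omega_def by (intro poly_subst_closed W_bar_closed)

definition tr :: "wpoly \<Rightarrow> wpoly" where "tr x = x + bar x"

lemma Rep_tr: "Rep_wpoly (tr x) = dd (Rep_wpoly x)"
  by (simp add: tr_def dd_def bar.rep_eq)

lemma w_0 [simp]: "w 0 = 1"
  by transfer (simp add: W_def)

lemma wbar_0 [simp]: "wbar 0 = 1"
  by transfer simp

lemma bar_0 [simp]: "bar 0 = 0"
  by transfer (simp add: omega_def)

lemma bar_1 [simp]: "bar 1 = 1"
  by transfer (simp add: omega_def)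

lemma bar_add [simp]: "bar (x + y) = bar x + bar y"
  by transfer (simp add: omega_def)

lemma bar_mult [simp]: "bar (x * y) = bar x * bar y"
  by transfer (simp add: omega_def)

lemma bar_sum [simp]: "bar (\<Sum>i\<in>A. f i) = (\<Sum>i\<in>A. bar (f i))"
  by (induction A rule: infinite_finite_induct) auto

lemma bar_prod [simp]: "bar (\<Prod>i\<in>A. f i) = (\<Prod>i\<in>A. bar (f i))"
  by (induction A rule: infinite_finite_induct) auto

lemma bar_w [simp]: "bar (w k) = wbar k"
  by transfer (simp add: omega_def W_def)

lemma w_wbar_sum: "k \<ge> 1 \<Longrightarrow> (\<Sum>i=0..k. w i * wbar (k - i)) = 0"
  using W_bar_recursion[of k] by (simp add: w.rep_eq wbar.rep_eq flip: Rep_wpoly_inject)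

text \<open>Applying \<open>bar\<close> to the recursion shows that the \<open>bar (wbar k)\<close>
  and the \<open>w k\<close> solve the same triangular system with the same initial value.\<close>

lemma bar_wbar [simp]: "bar (wbar k) = w k"
proof (induction k rule: less_induct)
  case (less k)
  show ?case
  proof (cases "k = 0")
    case False
    have "(\<Sum>i=0..k. wbar i * bar (wbar (k - i))) = 0"
      using arg_cong[OF w_wbar_sum[of k], of bar] False by simp
    moreover have "(\<Sum>i=0..k. wbar i * w (k - i)) = (\<Sum>i=0..k. w i * wbar (k - i))"
      by (rule sum.reindex_bij_witness[of _ "\<lambda>i. k - i" "\<lambda>i. k - i"]) (auto simp: mult.commute)
    then have "(\<Sum>i=0..k. wbar i * w (k - i)) = 0"
      using w_wbar_sum[of k] False by simp
    ultimately have "(\<Sum>i=0..k. wbar i * bar (wbar (k - i))) = (\<Sum>i=0..k. wbar i * w (k - i))"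
      by simp
    moreover have "(\<Sum>i=Suc 0..k. wbar i * bar (wbar (k - i))) = (\<Sum>i=Suc 0..k. wbar i * w (k - i))"
      using less by (intro sum.cong) auto
    ultimately show ?thesis
      by (simp add: sum.atLeast_Suc_atMost)
  qed simp
qed

lemma wpoly_induct [case_names zero one add mult]:
  assumes "P 0" "P 1" "\<And>x y. P x \<Longrightarrow> P y \<Longrightarrow> P (x + y)" "\<And>k x. k \<ge> 1 \<Longrightarrow> P x \<Longrightarrow> P (w k * x)"
  shows "P x"
proof -
  have "P (Abs_wpoly f)" if "f \<in> carrier (poly_ring {1..})" for f
    using that
  proof (induction rule: poly_ring_induct)
    case (add f g)
    then have "Abs_wpoly (f + g) = Abs_wpoly f + Abs_wpoly g"
      by (simp add: plus_wpoly.abs_eq eq_onp_def)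
    with add assms show ?case by simp
  next
    case (mult v f)
    have "w v = Abs_wpoly (Var v)"
      using mult by (metis Rep_wpoly_inverse W_def w.rep_eq atLeast_iff not_one_le_zero)
    then have "Abs_wpoly (Var v * f) = w v * Abs_wpoly f"
      using mult by (simp add: times_wpoly.abs_eq eq_onp_def)
    with mult assms show ?case by simp
  qed (use assms in \<open>simp_all flip: zero_wpoly_def one_wpoly_def\<close>)
  then show ?thesis
    by (metis Rep_wpoly Rep_wpoly_inverse)
qed

lemma bar_bar [simp]: "bar (bar x) = x"
  by (induction x rule: wpoly_induct) auto

lemma tr_add: "tr (x + y) = tr x + tr y"
  by (simp add: tr_def ac_simps)

lemma tr_0 [simp]: "tr 0 = 0"
  by (simp add: tr_def)

lemma tr_1 [simp]: "tr 1 = 0"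
  by (simp add: tr_def)

lemma bar_tr [simp]: "bar (tr x) = tr x"
  by (simp add: tr_def add.commute)

lemma tr_tr [simp]: "tr (tr x) = 0"
  by (simp add: tr_def add.commute)

lemma tr_mult_invariant: "bar x = x \<Longrightarrow> tr (x * y) = x * tr y"
  by (simp add: tr_def distrib_left)

text \<open>A twisted derivation. In relation (2) the mixed terms cancel in pairs, and three copies
  of the product of all traces leave the right-hand side.\<close>

lemma tr_mult: "tr (x * y) = x * tr y + y * tr x + tr x * tr y"
  by (simp add: tr_def algebra_simps)

lemma bar_eq_tr: "bar x = x + tr x"
  by (simp add: tr_def)

section \<open>Koszul relations\<close>

text \<open>Ideals are submodules of the ring over itself, so the generated ideal is a span, and the
  rules for the span of an \<open>insert\<close> apply.\<close>

interpretation ring_module: Modules.module "(*) :: 'a::comm_ring_1 \<Rightarrow> 'a \<Rightarrow> 'a"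
  by standard (simp_all add: algebra_simps)

text \<open>This simplification rule is the reverse of associativity.\<close>
declare ring_module.scale_scale [simp del]

abbreviation idl :: "'a::comm_ring_1 set \<Rightarrow> 'a set" where
  "idl \<equiv> ring_module.span"

lemmas idl_base = ring_module.span_base
  and idl_0 [simp, intro] = ring_module.span_zero
  and idl_add = ring_module.span_add
  and idl_mono = ring_module.span_mono
  and idl_sum = ring_module.span_sum

lemma idl_mult: "x \<in> idl G \<Longrightarrow> a * x \<in> idl G" "x \<in> idl G \<Longrightarrow> x * a \<in> idl G"
  using ring_module.span_scale[of x G a] by (simp_all add: mult.commute)

lemma idl_add_cancel:
  fixes x y :: "'a::comm_ring_char2"
  assumes "x + y \<in> idl G"
  shows "x \<in> idl G \<longleftrightarrow> y \<in> idl G"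
  using idl_add[OF assms, of x] idl_add[OF assms, of y] by (auto simp: ac_simps)

lemma idl_trans:
  fixes x y :: "'a::comm_ring_char2"
  assumes "x + y \<in> idl G" "y + z \<in> idl G"
  shows "x + z \<in> idl G"
  using idl_add[OF assms] by (simp add: ac_simps)

lemma idl_subsetI: "G \<subseteq> idl H \<Longrightarrow> idl G \<subseteq> idl H"
  by (rule ring_module.span_minimal) auto

lemma idl_insert_char2:
  fixes x :: "'a::comm_ring_char2"
  shows "x \<in> idl (insert a G) \<longleftrightarrow> (\<exists>k. x + k * a \<in> idl G)"
  by (simp add: ring_module.span_insert)

definition symm_zero_diag :: "'i set \<Rightarrow> ('i \<Rightarrow> 'i \<Rightarrow> 'a::zero) \<Rightarrow> bool" where
  "symm_zero_diag S c \<longleftrightarrow> (\<forall>i\<in>S. \<forall>j\<in>S. c i j = c j i) \<and> (\<forall>i\<in>S. c i i = 0)"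

text \<open>In characteristic 2 the alternating matrices are the symmetric ones with zero diagonal, so this
  is the vanishing of the first Koszul homology. Unlike regularity it does not depend on the order
  of the sequence, which makes it possible to exchange elements without using the grading.\<close>

definition koszul :: "'a::comm_ring_char2 set \<Rightarrow> 'i set \<Rightarrow> ('i \<Rightarrow> 'a) \<Rightarrow> bool" where
  "koszul G S f \<longleftrightarrow> (\<forall>b. (\<Sum>j\<in>S. f j * b j) \<in> idl G \<longrightarrow>
     (\<exists>c. symm_zero_diag S c \<and> (\<forall>j\<in>S. b j + (\<Sum>i\<in>S. c j i * f i) \<in> idl G)))"

text \<open>The same property with one more element \<open>g\<close>, which need not be indexed:
  \<open>a\<close> is the row of the alternating matrix that belongs to \<open>g\<close>, and
  \<open>c\<close> is the remaining block.\<close>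

definition koszul_cons :: "'a::comm_ring_char2 set \<Rightarrow> 'a \<Rightarrow> 'i set \<Rightarrow> ('i \<Rightarrow> 'a) \<Rightarrow> bool" where
  "koszul_cons G g S f \<longleftrightarrow> (\<forall>y b. g * y + (\<Sum>j\<in>S. f j * b j) \<in> idl G \<longrightarrow>
     (\<exists>a c. symm_zero_diag S c \<and> y + (\<Sum>j\<in>S. a j * f j) \<in> idl G \<and>
        (\<forall>j\<in>S. b j + a j * g + (\<Sum>i\<in>S. c j i * f i) \<in> idl G)))"

text \<open>The quadratic form of an alternating matrix is zero: off the diagonal the terms for (j,
  i) and (i, j) are equal and cancel.\<close>

lemma sum_symm_zero_diag:
  fixes c :: "'i \<Rightarrow> 'i \<Rightarrow> 'a::comm_ring_char2"
  assumes "finite S" "symm_zero_diag S c"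
  shows "(\<Sum>j\<in>S. \<Sum>i\<in>S. f j * (c j i * f i)) = 0"
  using assms
proof (induction S)
  case (insert t S)
  have sz: "symm_zero_diag S c" and ct: "c t t = 0" and cs: "\<And>j. j \<in> S \<Longrightarrow> c j t = c t j"
    using insert.prems unfolding symm_zero_diag_def by blast+
  have IH: "(\<Sum>j\<in>S. \<Sum>i\<in>S. f j * (c j i * f i)) = 0"
    by (rule insert.IH[OF sz])
  have *: "(\<Sum>j\<in>S. f j * (c j t * f t)) = (\<Sum>i\<in>S. f t * (c t i * f i))"
    by (intro sum.cong refl) (simp only: cs ac_simps)
  have "(\<Sum>j\<in>insert t S. \<Sum>i\<in>insert t S. f j * (c j i * f i))
    = (\<Sum>j\<in>S. f j * (c j t * f t)) + (\<Sum>i\<in>S. f t * (c t i * f i)) + (\<Sum>j\<in>S. \<Sum>i\<in>S. f j * (c j i * f i))"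
    using insert.hyps by (simp only: sum.insert ct sum.distrib mult_zero_left mult_zero_right add_0_left add.assoc simp_thms)
  then show ?case
    by (simp only: IH * add_self add_0_left)
qed simp

lemma koszul_insert_iff:
  assumes "finite S" "t \<notin> S"
  shows "koszul G (insert t S) f \<longleftrightarrow> koszul_cons G (f t) S f"
proof
  assume k: "koszul G (insert t S) f"
  show "koszul_cons G (f t) S f"
    unfolding koszul_cons_def
  proof (intro allI impI)
    fix y b assume *: "f t * y + (\<Sum>j\<in>S. f j * b j) \<in> idl G"
    define b' where "b' = b(t := y)"
    have "(\<Sum>j\<in>S. f j * b' j) = (\<Sum>j\<in>S. f j * b j)"
      using assms by (intro sum.cong) (auto simp: b'_def)
    then have "(\<Sum>j\<in>insert t S. f j * b' j) \<in> idl G"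
      using * assms by (simp add: b'_def)
    then obtain c where c: "symm_zero_diag (insert t S) c"
      "\<forall>j\<in>insert t S. b' j + (\<Sum>i\<in>insert t S. c j i * f i) \<in> idl G"
      using k unfolding koszul_def by blast
    have "c t t = 0"
      using c(1) by (simp add: symm_zero_diag_def)
    then have "y + (\<Sum>i\<in>S. c t i * f i) \<in> idl G"
      using c(2) assms by (simp add: b'_def)
    moreover have "b j + c t j * f t + (\<Sum>i\<in>S. c j i * f i) \<in> idl G" if "j \<in> S" for j
    proof -
      have "c t j = c j t"
        using c(1) that unfolding symm_zero_diag_def by blast
      moreover have "b' j = b j"
        using that assms by (auto simp: b'_def)
      moreover have "b' j + (\<Sum>i\<in>insert t S. c j i * f i) \<in> idl G"
        using c(2) that by blast
      ultimately show ?thesis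
        using assms by (simp add: add.assoc)
    qed
    moreover have "symm_zero_diag S c"
      using c(1) unfolding symm_zero_diag_def by blast
    ultimately show "\<exists>a c. symm_zero_diag S c \<and> y + (\<Sum>j\<in>S. a j * f j) \<in> idl G \<and>
        (\<forall>j\<in>S. b j + a j * f t + (\<Sum>i\<in>S. c j i * f i) \<in> idl G)"
      by (intro exI[of _ "c t"] exI[of _ c] conjI ballI)
  qed
next
  assume k: "koszul_cons G (f t) S f"
  show "koszul G (insert t S) f"
    unfolding koszul_def
  proof (intro allI impI)
    fix b assume "(\<Sum>j\<in>insert t S. f j * b j) \<in> idl G"
    then have "f t * b t + (\<Sum>j\<in>S. f j * b j) \<in> idl G"
      using assms by simp
    then obtain a c where ac: "symm_zero_diag S c" "b t + (\<Sum>j\<in>S. a j * f j) \<in> idl G"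
      "\<forall>j\<in>S. b j + a j * f t + (\<Sum>i\<in>S. c j i * f i) \<in> idl G"
      using k unfolding koszul_cons_def by blast
    \<comment> \<open>The block \<open>c\<close> bordered by \<open>a\<close> as row and
      column.\<close>
    define c' where "c' j i = (if j = t then if i = t then 0 else a i else if i = t then a j else c j i)" for j i
    have "symm_zero_diag (insert t S) c'"
      unfolding symm_zero_diag_def
    proof (intro conjI ballI)
      fix i j assume ij: "i \<in> insert t S" "j \<in> insert t S"
      then have "i \<noteq> t \<Longrightarrow> j \<noteq> t \<Longrightarrow> c i j = c j i"
        using ac(1) unfolding symm_zero_diag_def by blast
      then show "c' i j = c' j i"
        by (cases "i = t"; cases "j = t") (simp_all add: c'_def)
    next
      fix i assume "i \<in> insert t S"
      then have "i \<noteq> t \<Longrightarrow> c i i = 0"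
        using ac(1) unfolding symm_zero_diag_def by blast
      then show "c' i i = 0"
        by (cases "i = t") (simp_all add: c'_def)
    qed
    moreover have "b t + (\<Sum>i\<in>insert t S. c' t i * f i) \<in> idl G"
    proof -
      have "(\<Sum>i\<in>S. c' t i * f i) = (\<Sum>j\<in>S. a j * f j)"
        using assms by (intro sum.cong) (auto simp: c'_def)
      then show ?thesis
        using ac(2) assms by (simp add: c'_def)
    qed
    moreover have "b j + (\<Sum>i\<in>insert t S. c' j i * f i) \<in> idl G" if j: "j \<in> S" for j
    proof -
      have "(\<Sum>i\<in>S. c' j i * f i) = (\<Sum>i\<in>S. c j i * f i)"
        using assms j by (intro sum.cong) (auto simp: c'_def)
      moreover have "c' j t = a j"
        using assms j by (auto simp: c'_def)
      ultimately show ?thesis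
        using ac(3) assms j by (simp add: add.assoc)
    qed
    ultimately show "\<exists>c. symm_zero_diag (insert t S) c \<and>
        (\<forall>j\<in>insert t S. b j + (\<Sum>i\<in>insert t S. c j i * f i) \<in> idl G)"
      by (intro exI[of _ c'] conjI ballI; (elim insertE)?) simp_all
  qed
qed

text \<open>Modulo \<open>g\<close> the vector \<open>b\<close> is an alternating combination;
  lifting this costs multiples \<open>a j * g\<close>. Pairing with \<open>f\<close> kills the
  alternating part and leaves a multiple of \<open>g\<close> in the ideal, where \<open>g\<close>
  can be cancelled.\<close>

lemma koszul_cons_nonzerodivisor:
  assumes "finite S" and k: "koszul (insert g G) S f"
    and nzd: "\<And>x. g * x \<in> idl G \<Longrightarrow> x \<in> idl G"
  shows "koszul_cons G g S f"
  unfolding koszul_cons_def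
proof (intro allI impI)
  fix y b assume *: "g * y + (\<Sum>j\<in>S. f j * b j) \<in> idl G"
  then have "(\<Sum>j\<in>S. f j * b j) \<in> idl (insert g G)"
    unfolding idl_insert_char2 by (auto simp: ac_simps)
  then obtain c where c: "symm_zero_diag S c" "\<forall>j\<in>S. b j + (\<Sum>i\<in>S. c j i * f i) \<in> idl (insert g G)"
    using k unfolding koszul_def by blast
  then have "\<forall>j\<in>S. \<exists>a. b j + (\<Sum>i\<in>S. c j i * f i) + a * g \<in> idl G"
    unfolding idl_insert_char2 by blast
  then obtain a where a: "\<forall>j\<in>S. b j + (\<Sum>i\<in>S. c j i * f i) + a j * g \<in> idl G"
    by metis
  have "(\<Sum>j\<in>S. f j * (b j + (\<Sum>i\<in>S. c j i * f i) + a j * g)) \<in> idl G"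
    using a by (intro idl_sum idl_mult) auto
  also have "(\<Sum>j\<in>S. f j * (b j + (\<Sum>i\<in>S. c j i * f i) + a j * g))
      = (\<Sum>j\<in>S. f j * b j) + g * (\<Sum>j\<in>S. a j * f j)"
  proof -
    have "(\<Sum>j\<in>S. f j * (\<Sum>i\<in>S. c j i * f i)) = 0"
      unfolding sum_distrib_left by (rule sum_symm_zero_diag[OF assms(1) c(1)])
    moreover have "(\<Sum>j\<in>S. f j * (a j * g)) = g * (\<Sum>j\<in>S. a j * f j)"
      unfolding sum_distrib_left by (intro sum.cong refl) (simp only: ac_simps)
    ultimately show ?thesis
      by (simp only: distrib_left sum.distrib add_0_right)
  qed
  finally have "(\<Sum>j\<in>S. f j * b j) + g * (\<Sum>j\<in>S. a j * f j) \<in> idl G" .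
  from idl_add[OF * this] have "g * (y + (\<Sum>j\<in>S. a j * f j)) \<in> idl G"
    by (simp add: distrib_left add.assoc)
  then have "y + (\<Sum>j\<in>S. a j * f j) \<in> idl G"
    by (rule nzd)
  with a c(1) show "\<exists>a c. symm_zero_diag S c \<and> y + (\<Sum>j\<in>S. a j * f j) \<in> idl G \<and>
        (\<forall>j\<in>S. b j + a j * g + (\<Sum>i\<in>S. c j i * f i) \<in> idl G)"
    by (intro exI[of _ a] exI[of _ c] conjI ballI) (simp_all add: ac_simps)
qed

lemma koszul_consE:
  assumes "koszul_cons G g S f" "g * y + (\<Sum>j\<in>S. f j * b j) \<in> idl G"
  obtains a c where "symm_zero_diag S c" "y + (\<Sum>j\<in>S. a j * f j) \<in> idl G"
    "\<And>j. j \<in> S \<Longrightarrow> b j + a j * g + (\<Sum>i\<in>S. c j i * f i) \<in> idl G"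
  using assms(1)[unfolded koszul_cons_def, rule_format, OF assms(2)] 
  by (elim exE conjE) (rule that, assumption+, erule bspec)

text \<open>The property for \<open>g\<close>, applied to \<open>h * y\<close>, yields a row
  \<open>a\<close> for which \<open>h * y\<close> plus the sum of the \<open>f j * a j\<close> is
  again a relation, so that the property for \<open>h\<close> applies. The blocks combine to
  \<open>g\<close> times the second plus the first.\<close>

lemma koszul_cons_mult:
  assumes g: "koszul_cons G g S f" and h: "koszul_cons G h S f"
  shows "koszul_cons G (g * h) S f"
  unfolding koszul_cons_def
proof (intro allI impI)
  fix y b assume "g * h * y + (\<Sum>j\<in>S. f j * b j) \<in> idl G"
  then have "g * (h * y) + (\<Sum>j\<in>S. f j * b j) \<in> idl G"
    by (simp only: mult.assoc)
  then obtain a c where ac: "symm_zero_diag S c" "h * y + (\<Sum>j\<in>S. a j * f j) \<in> idl G"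
      "\<And>j. j \<in> S \<Longrightarrow> b j + a j * g + (\<Sum>i\<in>S. c j i * f i) \<in> idl G"
    by (rule koszul_consE[OF g]) blast
  have "h * y + (\<Sum>j\<in>S. f j * a j) \<in> idl G"
    using ac(2) by (simp only: mult.commute[of "f _"])
  then obtain a' c' where ac': "symm_zero_diag S c'" "y + (\<Sum>j\<in>S. a' j * f j) \<in> idl G"
      "\<And>j. j \<in> S \<Longrightarrow> a j + a' j * h + (\<Sum>i\<in>S. c' j i * f i) \<in> idl G"
    by (rule koszul_consE[OF h]) blast
  let ?c = "\<lambda>j i. g * c' j i + c j i"
  have "b j + a' j * (g * h) + (\<Sum>i\<in>S. ?c j i * f i) \<in> idl G" if "j \<in> S" for j
  proof -
    have "(b j + a j * g + (\<Sum>i\<in>S. c j i * f i)) + g * (a j + a' j * h + (\<Sum>i\<in>S. c' j i * f i)) \<in> idl G"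
      by (rule idl_add[OF ac(3)[OF that] idl_mult(1)[OF ac'(3)[OF that]]])
    moreover have "(\<Sum>i\<in>S. ?c j i * f i) = g * (\<Sum>i\<in>S. c' j i * f i) + (\<Sum>i\<in>S. c j i * f i)"
      by (simp add: distrib_right sum.distrib sum_distrib_left mult.assoc)
    ultimately show ?thesis
      by (simp add: distrib_left ac_simps)
  qed
  moreover have "symm_zero_diag S ?c"
    using ac(1) ac'(1) unfolding symm_zero_diag_def by simp
  ultimately show "\<exists>a c. symm_zero_diag S c \<and> y + (\<Sum>j\<in>S. a j * f j) \<in> idl G \<and>
        (\<forall>j\<in>S. b j + a j * (g * h) + (\<Sum>i\<in>S. c j i * f i) \<in> idl G)"
    using ac'(2) by (intro exI[of _ a'] exI[of _ ?c] conjI ballI)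
qed

text \<open>Only the class of \<open>g\<close> modulo the \<open>f j\<close> matters: adding a
  combination of the other elements is an elementary operation on the sequence.\<close>

lemma koszul_cons_change:
  assumes g: "koszul_cons G g S f" and g': "g' + g + (\<Sum>j\<in>S. f j * e j) \<in> idl G"
  shows "koszul_cons G g' S f"
  unfolding koszul_cons_def
proof (intro allI impI)
  fix y b assume "g' * y + (\<Sum>j\<in>S. f j * b j) \<in> idl G"
  then have "(g' * y + (\<Sum>j\<in>S. f j * b j)) + y * (g' + g + (\<Sum>j\<in>S. f j * e j)) \<in> idl G"
    by (rule idl_add[OF _ idl_mult(1)[OF g']])
  also have "(g' * y + (\<Sum>j\<in>S. f j * b j)) + y * (g' + g + (\<Sum>j\<in>S. f j * e j))
      = g * y + (\<Sum>j\<in>S. f j * (b j + y * e j))"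
    by (simp add: distrib_left sum.distrib sum_distrib_left ac_simps)
  finally obtain a c where ac: "symm_zero_diag S c" "y + (\<Sum>j\<in>S. a j * f j) \<in> idl G"
      "\<And>j. j \<in> S \<Longrightarrow> b j + y * e j + a j * g + (\<Sum>i\<in>S. c j i * f i) \<in> idl G"
    by (rule koszul_consE[OF g]) blast
  \<comment> \<open>The correction \<open>e j * a i + a j * e i\<close> is alternating: it is
    symmetric, and its diagonal entry is twice \<open>a j * e j\<close>.\<close>
  let ?c = "\<lambda>j i. c j i + e j * a i + a j * e i"
  have "b j + a j * g' + (\<Sum>i\<in>S. ?c j i * f i) \<in> idl G" if "j \<in> S" for j
  proof -
    have "(b j + y * e j + a j * g + (\<Sum>i\<in>S. c j i * f i)) + e j * (y + (\<Sum>i\<in>S. a i * f i))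
        + a j * (g' + g + (\<Sum>i\<in>S. f i * e i)) \<in> idl G"
      by (rule idl_add[OF idl_add[OF ac(3)[OF that] idl_mult(1)[OF ac(2)]] idl_mult(1)[OF g']])
    moreover have "(\<Sum>i\<in>S. ?c j i * f i)
        = (\<Sum>i\<in>S. c j i * f i) + e j * (\<Sum>i\<in>S. a i * f i) + a j * (\<Sum>i\<in>S. f i * e i)"
      by (simp only: sum_distrib_left sum.distrib[symmetric])
        (intro sum.cong refl, simp add: algebra_simps)
    ultimately show ?thesis
      by (simp add: distrib_left ac_simps)
  qed
  moreover have "symm_zero_diag S ?c"
    using ac(1) unfolding symm_zero_diag_def by (simp add: ac_simps) 
  ultimately show "\<exists>a c. symm_zero_diag S c \<and> y + (\<Sum>j\<in>S. a j * f j) \<in> idl G \<and>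
        (\<forall>j\<in>S. b j + a j * g' + (\<Sum>i\<in>S. c j i * f i) \<in> idl G)"
    using ac(2) by (intro exI[of _ a] exI[of _ ?c] conjI ballI)
qed

lemma koszul_cons_1: "koszul_cons G 1 S f"
  unfolding koszul_cons_def
proof (intro allI impI)
  fix y b assume "1 * y + (\<Sum>j\<in>S. f j * b j) \<in> idl G"
  then show "\<exists>a c. symm_zero_diag S c \<and> y + (\<Sum>j\<in>S. a j * f j) \<in> idl G \<and>
      (\<forall>j\<in>S. b j + a j * 1 + (\<Sum>i\<in>S. c j i * f i) \<in> idl G)"
    by (intro exI[of _ b] exI[of _ "\<lambda>_ _. 0"]) (auto simp: symm_zero_diag_def ac_simps)
qed

section \<open>The ideals of the Grassmannians\<close>

text \<open>The kernel of the map from R to the cohomology ring of type (k, l). The indices vary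
  separately because division by \<open>w k\<close> lowers only l and division by
  \<open>wbar l\<close> lowers only k.\<close>

definition Gr_idl :: "nat \<Rightarrow> nat \<Rightarrow> wpoly set" where
  "Gr_idl k l = idl (w ` {k<..} \<union> wbar ` {l<..})"

text \<open>The quotient by the \<open>w i\<close> with i > k realised as a retraction of R, which
  turns membership in that ideal into an equation in a domain.\<close>

lift_definition kill_above :: "nat \<Rightarrow> wpoly \<Rightarrow> wpoly" is "\<lambda>k. poly_subst (\<lambda>v. if v \<le> k then W v else 0)"
  by (intro poly_subst_closed) (auto intro: W_closed simp del: One_nat_def)

lemma kill_above_simps [simp]:
  "kill_above k 0 = 0" "kill_above k 1 = 1"
  "kill_above k (x + y) = kill_above k x + kill_above k y"
  "kill_above k (x * y) = kill_above k x * kill_above k y"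
  by (transfer; simp)+

lemma kill_above_w: "kill_above k (w i) = (if i \<le> k then w i else 0)"
  by transfer (auto simp: W_def)

lemma kill_above_cong: "x + kill_above k x \<in> idl (w ` {k<..})"
proof (induction x rule: wpoly_induct)
  case (add x y)
  from idl_add[OF add] show ?case by (simp add: ac_simps)
next
  case (mult i x)
  show ?case
  proof (cases "i \<le> k")
    case True
    then show ?thesis
      using idl_mult(1)[OF mult(2), of "w i"] by (simp add: kill_above_w distrib_left)
  qed (simp add: kill_above_w idl_mult(2) idl_base)
qed auto

lemma kill_above_eq_0_iff: "kill_above k x = 0 \<longleftrightarrow> x \<in> idl (w ` {k<..})"
proof
  assume "x \<in> idl (w ` {k<..})"
  then show "kill_above k x = 0"
    by (induction rule: ring_module.span_induct_alt) (auto simp: kill_above_w)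
qed (use kill_above_cong[of x k] in simp)

lemma w_mult_eq_0:
  assumes "w k * x = 0"
  shows "x = 0"
proof -
  have "W k * Rep_wpoly x = 0"
    using arg_cong[OF assms, of Rep_wpoly] by (simp add: w.rep_eq)
  moreover have "W k \<noteq> 0"
    by (auto simp: W_def Var_def dest!: arg_cong[where f = keys])
  ultimately show ?thesis
    by (simp flip: Rep_wpoly_inject)
qed

lemma w_nonzerodivisor:
  assumes "w k * x \<in> idl (w ` {k<..})"
  shows "x \<in> idl (w ` {k<..})"
proof -
  have "w k * kill_above k x = 0"
    using assms by (simp add: kill_above_w flip: kill_above_eq_0_iff)
  then show ?thesis
    using w_mult_eq_0 kill_above_eq_0_iff by blast
qed

text \<open>The recursion in degree l + k: the terms with index j below l contain
  \<open>w (l + k - j)\<close>, whose index is above k.\<close>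

lemma wbar_recurrence:
  assumes "k \<ge> 1"
  shows "wbar (l + k) + w k * wbar l + (\<Sum>j\<in>{l<..<l+k}. wbar j * w (l + k - j)) \<in> idl (w ` {k<..})"
proof -
  have "(\<Sum>i=0..l+k. wbar i * w (l + k - i)) = (\<Sum>i=0..l+k. w i * wbar (l + k - i))"
    by (rule sum.reindex_bij_witness[of _ "\<lambda>i. l + k - i" "\<lambda>i. l + k - i"]) (auto simp: mult.commute)
  also have "\<dots> = 0"
    using assms by (intro w_wbar_sum) auto
  finally have "0 = (\<Sum>i=0..l+k. wbar i * w (l + k - i))" ..
  also have "{0..l+k} = insert (l + k) (insert l ({l<..<l+k} \<union> {0..<l}))"
    using assms by auto
  also have "(\<Sum>i\<in>\<dots>. wbar i * w (l + k - i)) = wbar (l + k) + w k * wbar l +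
      (\<Sum>j\<in>{l<..<l+k}. wbar j * w (l + k - j)) + (\<Sum>j\<in>{0..<l}. wbar j * w (l + k - j))"
    using assms by (subst sum.insert sum.union_disjoint; auto simp: ac_simps)+
  finally have "wbar (l + k) + w k * wbar l + (\<Sum>j\<in>{l<..<l+k}. wbar j * w (l + k - j))
      = (\<Sum>j\<in>{0..<l}. wbar j * w (l + k - j))"
    by (metis add_eq_0_char2)
  also have "\<dots> \<in> idl (w ` {k<..})"
    by (intro idl_sum idl_mult idl_base) auto
  finally show ?thesis .
qed

lemma greaterThan_Suc_insert: "{k<..} = insert (Suc k) {Suc k<..}"
  by auto

text \<open>Modulo the elements in between, \<open>wbar (l + k)\<close> is \<open>w k * wbar l\<close>: this moves the window by
  one, starting from \<open>wbar 0 = 1\<close>.\<close>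

lemma koszul_wbar: "koszul (w ` {k<..}) {l..<l+k} wbar"
proof (induction k arbitrary: l)
  case 0
  then show ?case by (simp add: koszul_def symm_zero_diag_def)
next
  case (Suc k)
  note IH = this
  show ?case
  proof (induction l)
    case 0
    have "{0..<0 + Suc k} = insert 0 {1..<Suc k}" by auto
    then show ?case
      by (simp add: koszul_insert_iff koszul_cons_1)
  next
    case (Suc l)
    define S where "S = {l<..<l + Suc k}"
    have S: "{l..<l + Suc k} = insert l S" "{Suc l..<Suc l + k} = S"
      "{Suc l..<Suc l + Suc k} = insert (l + Suc k) S" "finite S" "l \<notin> S" "l + Suc k \<notin> S"
      by (auto simp: S_def)
    have "w ` {k<..} = insert (w (Suc k)) (w ` {Suc k<..})"
      by (metis greaterThan_Suc_insert image_insert)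
    \<comment> \<open>The induction on k gives the window \<open>S\<close> modulo
      \<open>w (Suc k)\<close>, and the induction on l gives the factor
      \<open>wbar l\<close>.\<close>
    then have "koszul_cons (w ` {Suc k<..}) (w (Suc k)) S wbar"
      using S IH[of "Suc l"] by (intro koszul_cons_nonzerodivisor) (auto intro: w_nonzerodivisor)
    moreover have "koszul_cons (w ` {Suc k<..}) (wbar l) S wbar"
      using Suc S by (simp add: koszul_insert_iff)
    ultimately have "koszul_cons (w ` {Suc k<..}) (w (Suc k) * wbar l) S wbar"
      by (rule koszul_cons_mult)
    then have "koszul_cons (w ` {Suc k<..}) (wbar (l + Suc k)) S wbar"
      by (rule koszul_cons_change[where e = "\<lambda>j. w (l + Suc k - j)"])
        (use wbar_recurrence[of "Suc k" l] in \<open>simp add: S_def\<close>)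
    then show ?case
      using S by (simp add: koszul_insert_iff)
  qed
qed

lemma koszul_cons_w: "k \<ge> 1 \<Longrightarrow> koszul_cons (w ` {k<..}) (w k) {l<..<l+k} wbar"
proof -
  assume "k \<ge> 1"
  then obtain m where m: "k = Suc m" by (cases k) auto
  have "w ` {m<..} = insert (w (Suc m)) (w ` {Suc m<..})"
    by (metis greaterThan_Suc_insert image_insert)
  moreover have "{Suc l..<Suc l + m} = {l<..<l + Suc m}" by auto
  ultimately show ?thesis
    using koszul_wbar[of m "Suc l"] unfolding m
    by (intro koszul_cons_nonzerodivisor) (auto intro: w_nonzerodivisor)
qed

lemma koszul_cons_wbar: "k \<ge> 1 \<Longrightarrow> koszul_cons (w ` {k<..}) (wbar l) {l<..<l+k} wbar"
proof -
  assume "k \<ge> 1"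
  then have "{l..<l + k} = insert l {l<..<l+k}" by auto
  then show ?thesis
    using koszul_wbar[of k l] by (simp add: koszul_insert_iff)
qed

lemma Gr_idl_mono: "k' \<le> k \<Longrightarrow> l' \<le> l \<Longrightarrow> Gr_idl k l \<subseteq> Gr_idl k' l'"
  unfolding Gr_idl_def by (intro idl_mono) auto

lemma w_in_Gr_idl: "i > k \<Longrightarrow> w i \<in> Gr_idl k l"
  unfolding Gr_idl_def by (intro idl_base) auto

lemma wbar_in_Gr_idl: "i > l \<Longrightarrow> wbar i \<in> Gr_idl k l"
  unfolding Gr_idl_def by (intro idl_base) auto

text \<open>By the recurrence \<open>wbar (l + k)\<close> can be replaced by
  \<open>w k * wbar l\<close>, and all later generators are redundant. This exhibits the generator
  that can be divided both by \<open>w k\<close> and by \<open>wbar l\<close>.\<close>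

lemma Gr_idl_normal_form:
  assumes "k \<ge> 1" "x \<in> Gr_idl k l"
  shows "\<exists>y b. x + w k * wbar l * y + (\<Sum>j\<in>{l<..<l+k}. wbar j * b j) \<in> idl (w ` {k<..})"
proof -
  define H where "H = insert (w k * wbar l) (wbar ` {l<..<l+k} \<union> w ` {k<..})"
  have wH: "idl (w ` {k<..}) \<subseteq> idl H"
    by (intro idl_mono) (auto simp: H_def)
  have wbarH: "wbar j \<in> idl H" if "j > l" for j
    using that
  proof (induction j rule: less_induct)
    case (less j)
    show ?case
    proof (cases "j < l + k")
      case True
      with less show ?thesis by (auto simp: H_def intro!: idl_base)
    next
      case False
      define m where "m = j - k"
      have m: "j = m + k" "m \<ge> l" using False by (auto simp: m_def)
      have "w k * wbar m \<in> idl H"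
      proof (cases "m = l")
        case False
        with m less assms show ?thesis by (intro idl_mult) auto
      qed (auto simp: H_def intro!: idl_base)
      moreover have "(\<Sum>i\<in>{m<..<m+k}. wbar i * w (m + k - i)) \<in> idl H"
        using m less by (intro idl_sum idl_mult) auto
      ultimately have "w k * wbar m + (\<Sum>i\<in>{m<..<m+k}. wbar i * w (m + k - i)) \<in> idl H"
        by (rule idl_add)
      moreover have "wbar j + (w k * wbar m + (\<Sum>i\<in>{m<..<m+k}. wbar i * w (m + k - i))) \<in> idl H"
        using wbar_recurrence[OF assms(1), of m] wH m by (auto simp: add.assoc)
      ultimately show ?thesis
        using idl_add_cancel by blast
    qed
  qed
  have "x \<in> idl H"
    using assms(2) wbarH wH unfolding Gr_idl_def
    by (elim subsetD[OF idl_subsetI, rotated]) (auto intro: idl_base)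
  then obtain y where "x + y * (w k * wbar l) \<in> idl (wbar ` {l<..<l+k} \<union> w ` {k<..})"
    unfolding H_def idl_insert_char2 by blast
  moreover have "\<exists>b. z + (\<Sum>j\<in>S. wbar j * b j) \<in> idl (w ` {k<..})"
    if "finite S" "z \<in> idl (wbar ` S \<union> w ` {k<..})" for S z
    using that
  proof (induction S arbitrary: z)
    case (insert t S)
    then obtain a where "z + a * wbar t \<in> idl (wbar ` S \<union> w ` {k<..})"
      by (auto simp: idl_insert_char2)
    with insert obtain b where b: "z + a * wbar t + (\<Sum>j\<in>S. wbar j * b j) \<in> idl (w ` {k<..})"
      by blast
    have "(\<Sum>j\<in>S. wbar j * (b(t := a)) j) = (\<Sum>j\<in>S. wbar j * b j)"
      using insert by (intro sum.cong) auto
    with b insert show ?case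
      by (intro exI[of _ "b(t := a)"]) (simp add: ac_simps)
  qed auto
  ultimately obtain b where "x + y * (w k * wbar l) + (\<Sum>j\<in>{l<..<l+k}. wbar j * b j) \<in> idl (w ` {k<..})"
    by blast
  then show ?thesis
    by (intro exI[of _ y] exI[of _ b]) (simp add: ac_simps)
qed

text \<open>By the normal form, \<open>w k * (x + wbar l * y)\<close> is a combination of the
  \<open>wbar j\<close> in the window. The Koszul property puts \<open>x + wbar l * y\<close> into
  the ideal of that window, and \<open>wbar l\<close> itself becomes a generator once l is
  lowered.\<close>

lemma Gr_idl_colon_w:
  assumes "k \<ge> 1" "l \<ge> 1" "w k * x \<in> Gr_idl k l"
  shows "x \<in> Gr_idl k (l - 1)"
proof -
  obtain y b where "w k * x + w k * wbar l * y + (\<Sum>j\<in>{l<..<l+k}. wbar j * b j) \<in> idl (w ` {k<..})"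
    using Gr_idl_normal_form[OF assms(1,3)] by blast
  then have "w k * (x + wbar l * y) + (\<Sum>j\<in>{l<..<l+k}. wbar j * b j) \<in> idl (w ` {k<..})"
    by (simp add: algebra_simps)
  then obtain a where "(x + wbar l * y) + (\<Sum>j\<in>{l<..<l+k}. a j * wbar j) \<in> idl (w ` {k<..})"
    by (rule koszul_consE[OF koszul_cons_w[OF assms(1)]]) blast
  also have "idl (w ` {k<..}) \<subseteq> Gr_idl k (l - 1)"
    unfolding Gr_idl_def by (intro idl_mono) auto
  finally have "x + (wbar l * y + (\<Sum>j\<in>{l<..<l+k}. a j * wbar j)) \<in> Gr_idl k (l - 1)"
    by (simp add: add.assoc)
  moreover have "wbar l * y + (\<Sum>j\<in>{l<..<l+k}. a j * wbar j) \<in> Gr_idl k (l - 1)"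
    using assms unfolding Gr_idl_def by (intro idl_add idl_sum idl_mult idl_base) auto
  ultimately show ?thesis
    unfolding Gr_idl_def using idl_add_cancel by blast
qed

text \<open>The same relation with \<open>wbar l\<close> as the factor to be cancelled; now
  \<open>w k\<close> becomes a generator when k is lowered.\<close>

lemma Gr_idl_colon_wbar:
  assumes "k \<ge> 1" "wbar l * x \<in> Gr_idl k l"
  shows "x \<in> Gr_idl (k - 1) l"
proof -
  obtain y b where "wbar l * x + w k * wbar l * y + (\<Sum>j\<in>{l<..<l+k}. wbar j * b j) \<in> idl (w ` {k<..})"
    using Gr_idl_normal_form[OF assms] by blast
  then have "wbar l * (x + w k * y) + (\<Sum>j\<in>{l<..<l+k}. wbar j * b j) \<in> idl (w ` {k<..})"
    by (simp add: algebra_simps)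
  then obtain a where "(x + w k * y) + (\<Sum>j\<in>{l<..<l+k}. a j * wbar j) \<in> idl (w ` {k<..})"
    by (rule koszul_consE[OF koszul_cons_wbar[OF assms(1)]]) blast
  also have "idl (w ` {k<..}) \<subseteq> Gr_idl (k - 1) l"
    unfolding Gr_idl_def by (intro idl_mono) auto
  finally have "x + (w k * y + (\<Sum>j\<in>{l<..<l+k}. a j * wbar j)) \<in> Gr_idl (k - 1) l"
    by (simp add: add.assoc)
  moreover have "w k * y + (\<Sum>j\<in>{l<..<l+k}. a j * wbar j) \<in> Gr_idl (k - 1) l"
    using assms unfolding Gr_idl_def by (intro idl_add idl_sum idl_mult idl_base) auto
  ultimately show ?thesis
    unfolding Gr_idl_def using idl_add_cancel by blast
qed

section \<open>Power sums\<close>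

text \<open>The terms for i and k - i cancel in pairs, so that at most a middle term
  survives.\<close>

lemma sum_convolution_char2:
  fixes f :: "nat \<Rightarrow> 'a::comm_ring_char2"
  shows "(\<Sum>i=0..k. f i * f (k - i)) = (if even k then (f (k div 2))\<^sup>2 else 0)"
proof -
  let ?g = "\<lambda>i. f i * f (k - i)"
  have U: "{0..k} = {i. 2 * i < k} \<union> ({i. i \<le> k \<and> 2 * i > k} \<union> {i. 2 * i = k})"
    by auto
  have fin: "finite {i. 2 * i < k}" "finite {i. i \<le> k \<and> 2 * i > k}" "finite {i. 2 * i = k}"
    by (rule finite_subset[of _ "{0..k}"]; auto)+
  have "sum ?g {0..k} = sum ?g {i. 2 * i < k} + (sum ?g {i. i \<le> k \<and> 2 * i > k} + sum ?g {i. 2 * i = k})"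
    unfolding U using fin by (subst sum.union_disjoint; auto)+
  also have "sum ?g {i. i \<le> k \<and> 2 * i > k} = sum ?g {i. 2 * i < k}"
    by (rule sum.reindex_bij_witness[of _ "\<lambda>i. k - i" "\<lambda>i. k - i"]) (auto simp: mult.commute)
  also have "sum ?g {i. 2 * i = k} = (if even k then (f (k div 2))\<^sup>2 else 0)"
  proof (cases "even k")
    case True
    then obtain m where "k = 2 * m" by blast
    then have "{i. 2 * i = k} = {m}" by auto
    then show ?thesis using \<open>k = 2 * m\<close> by (simp add: power2_eq_square)
  next
    case False
    then have "{i. 2 * i = k} = {}" by auto
    then show ?thesis using False by simp
  qed
  finally show ?thesis by simp
qed

instance fps :: (comm_ring_char2) comm_ring_char2
  by standard (intro fps_ext, simp only: fps_add_nth add_self fps_zero_nth)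

lemma pw_recursion: "k \<ge> 1 \<Longrightarrow> of_nat k * w k = (\<Sum>j=0..k-1. pw (k - j) * w j)"
proof -
  assume k: "k \<ge> 1"
  have "Rep_wpoly (of_nat k * w k) = of_nat k * W k"
    by (auto simp: of_nat_char2 w.rep_eq)
  then show ?thesis
    using psum_recursion[OF k] by (simp add: pw.rep_eq w.rep_eq flip: Rep_wpoly_inject)
qed

lemma pw_0 [simp]: "pw 0 = 0"
  by transfer simp

context
  includes fps_syntax
begin

lemma fps_X_deriv_nth: "(fps_X * fps_deriv F) $ k = of_nat k * F $ k"
  for F :: "'a::comm_ring_1 fps"
  by (cases k) (simp_all del: of_nat_Suc)

text \<open>\<open>OW\<close> and \<open>OB\<close> are X d/dX of the two series and hence, in
  characteristic 2, their odd parts. So \<open>WF + OW\<close> and \<open>WB + OB\<close> are the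
  even parts.\<close>

private definition "WF = Abs_fps w"
private definition "WB = Abs_fps wbar"
private definition "PF = Abs_fps pw"
private definition "OW = Abs_fps (\<lambda>k. of_nat k * w k)"
private definition "OB = Abs_fps (\<lambda>k. of_nat k * wbar k)"

private lemma WF_WB: "WF * WB = 1"
proof (rule fps_ext)
  fix k show "(WF * WB) $ k = 1 $ k"
    by (cases "k = 0") (simp_all add: WF_def WB_def fps_mult_nth w_wbar_sum)
qed

private lemma OW_eq: "OW = PF * WF"
proof (rule fps_ext)
  fix k
  show "OW $ k = (PF * WF) $ k"
  proof (cases k)
    case (Suc m)
    have "(PF * WF) $ k = (\<Sum>i=0..k. pw i * w (k - i))"
      by (simp add: PF_def WF_def fps_mult_nth)
    also have "\<dots> = (\<Sum>i=1..k. pw i * w (k - i))"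
      by (simp add: sum.atLeast_Suc_atMost)
    also have "\<dots> = (\<Sum>j=0..k-1. pw (k - j) * w j)"
      by (rule sum.reindex_bij_witness[of _ "\<lambda>i. k - i" "\<lambda>i. k - i"]) (auto simp: Suc)
    finally show ?thesis
      using pw_recursion[of k] by (simp add: OW_def Suc)
  qed (simp add: OW_def PF_def)
qed

text \<open>Logarithmic derivative of \<open>WF * WB = 1\<close>: without signs both factors have
  the same one, \<open>PF\<close>.\<close>

private lemma OB_eq: "OB = PF * WB"
proof -
  have "fps_X * fps_deriv WF = OW" "fps_X * fps_deriv WB = OB"
    by (intro fps_ext; simp add: fps_X_deriv_nth OW_def OB_def WF_def WB_def)+
  moreover have "fps_X * fps_deriv (WF * WB) = 0"
    by (simp add: WF_WB)
  ultimately have "OW * WB + WF * OB = 0"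
    by (simp add: fps_deriv_mult distrib_left) (metis add.commute mult.assoc mult.left_commute mult.commute)
  then have "PF * (WF * WB) * WB + (WF * WB) * OB = 0"
    by (simp add: OW_eq) (metis (no_types) distrib_left mult.assoc mult.left_commute mult_zero_right)
  then have "PF * WB + OB = 0"
    by (simp add: WF_WB)
  then show ?thesis
    by (simp only: add_eq_0_char2)
qed

text \<open>Applying \<open>bar\<close> to \<open>OW = PF * WF\<close> expresses \<open>OB\<close>
  by the conjugate power sums, while \<open>OB_eq\<close> expresses it by the original ones, and
  \<open>WB\<close> is a unit.\<close>

lemma bar_pw [simp]: "bar (pw k) = pw k"
proof -
  define PB where "PB = Abs_fps (\<lambda>k. bar (pw k))"
  have "OB = PB * WB"
  proof (rule fps_ext)
    fix k
    have "OB $ k = bar (OW $ k)"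
      by (simp add: OB_def OW_def of_nat_char2)
    also have "\<dots> = (PB * WB) $ k"
      unfolding OW_eq by (simp add: fps_mult_nth PF_def WF_def PB_def WB_def)
    finally show "OB $ k = (PB * WB) $ k" .
  qed
  then have "PB * (WF * WB) = PF * (WF * WB)"
    by (metis OB_eq mult.left_commute)
  then have "PB = PF"
    by (simp add: WF_WB)
  then have "PB $ k = PF $ k"
    by simp
  then show ?thesis
    by (simp add: PB_def PF_def)
qed

text \<open>Even part times even part is the square of \<open>1 + PF\<close>, and squaring a series
  only squares its coefficients.\<close>

lemma sum_even_w_wbar:
  assumes "m \<ge> 1"
  shows "(\<Sum>i=0..m. w (2 * i) * wbar (2 * (m - i))) = (pw m)\<^sup>2"
proof -
  have "(WF + OW) * (WB + OB) = (WF * WB) * (1 + PF) * (1 + PF)"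
    by (simp add: OW_eq OB_eq algebra_simps)
  then have "((WF + OW) * (WB + OB)) $ (2 * m) = ((1 + PF) * (1 + PF)) $ (2 * m)"
    by (simp add: WF_WB)
  also have "\<dots> = (PF * PF) $ (2 * m)"
    using assms by (simp add: distrib_left distrib_right)
  also have "\<dots> = (pw m)\<^sup>2"
    using sum_convolution_char2[of pw "2 * m"] by (simp add: fps_mult_nth PF_def)
  also have "((WF + OW) * (WB + OB)) $ (2 * m)
      = (\<Sum>i=0..2*m. if even i then w i * wbar (2 * m - i) else 0)"
    unfolding fps_mult_nth
    by (intro sum.cong) (auto simp: WF_def OW_def WB_def OB_def of_nat_char2)
  also have "\<dots> = (\<Sum>i\<in>{i\<in>{0..2*m}. even i}. w i * wbar (2 * m - i))"
    by (simp only: sum.inter_filter finite_atLeastAtMost)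
  also have "\<dots> = (\<Sum>i=0..m. w (2 * i) * wbar (2 * (m - i)))"
    by (rule sum.reindex_bij_witness[of _ "\<lambda>i. 2 * i" "\<lambda>i. i div 2"]) (auto simp: algebra_simps)
  finally show ?thesis .
qed

text \<open>The even part of \<open>WB\<close> times the odd part of \<open>WF\<close> is
  \<open>PF + PF * PF\<close>, and a square has no coefficients in odd degree.\<close>

lemma pw_odd:
  assumes "odd k"
  shows "pw k = (\<Sum>i\<in>{i\<in>{0..k}. even i}. wbar i * w (k - i))"
proof -
  have "(WB + OB) * OW = (WF * WB) * (PF + PF * PF)"
    by (simp add: OW_eq OB_eq algebra_simps)
  then have "((WB + OB) * OW) $ k = (PF + PF * PF) $ k"
    by (simp add: WF_WB)
  also have "\<dots> = pw k"
    using sum_convolution_char2[of pw k] assms by (simp add: fps_mult_nth PF_def)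
  also have "((WB + OB) * OW) $ k = (\<Sum>i=0..k. if even i then wbar i * w (k - i) else 0)"
    unfolding fps_mult_nth using assms
    by (intro sum.cong) (auto simp: WF_def OW_def WB_def OB_def of_nat_char2)
  also have "\<dots> = (\<Sum>i\<in>{i\<in>{0..k}. even i}. wbar i * w (k - i))"
    by (simp only: sum.inter_filter finite_atLeastAtMost)
  finally show ?thesis ..
qed

end

text \<open>All indices together give zero, so the odd ones give the same value as the even
  ones.\<close>

lemma pw_power2:
  assumes "m \<ge> 1"
  shows "(pw m)\<^sup>2 = (\<Sum>i\<in>{i\<in>{0..2*m}. odd i}. w i * wbar (2 * m - i))"
proof -
  have "(\<Sum>i=0..m. w (2 * i) * wbar (2 * (m - i))) = (\<Sum>i\<in>{i\<in>{0..2*m}. even i}. w i * wbar (2 * m - i))"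
    by (rule sum.reindex_bij_witness[of _ "\<lambda>i. i div 2" "\<lambda>i. 2 * i"]) (auto simp: algebra_simps)
  moreover have "(\<Sum>i=0..2*m. w i * wbar (2 * m - i)) =
      (\<Sum>i\<in>{i\<in>{0..2*m}. even i}. w i * wbar (2 * m - i)) +
      (\<Sum>i\<in>{i\<in>{0..2*m}. odd i}. w i * wbar (2 * m - i))"
    by (subst sum.union_disjoint[symmetric]) (auto intro!: sum.cong)
  ultimately have "(pw m)\<^sup>2 + (\<Sum>i\<in>{i\<in>{0..2*m}. odd i}. w i * wbar (2 * m - i)) = 0"
    using assms by (simp add: sum_even_w_wbar w_wbar_sum)
  then show ?thesis
    by (simp add: add_eq_0_char2)
qed

section \<open>Invariants of the cohomology ring modulo traces\<close>

definition odds :: "nat \<Rightarrow> nat set" where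
  "odds n = {j. odd j \<and> j < 2 * n}"

definition pmon :: "nat set \<Rightarrow> wpoly" where
  "pmon B = (\<Prod>j\<in>B. pw j)"

abbreviation In :: "nat \<Rightarrow> wpoly set" where
  "In n \<equiv> Gr_idl n n"

lemma finite_odds [simp]: "finite (odds n)"
  by (simp add: odds_def)

lemma odds_Suc: "odds (Suc n) = insert (2 * n + 1) (odds n)"
  by (auto simp: odds_def elim!: oddE)

lemma bar_pmon [simp]: "bar (pmon B) = pmon B"
  by (simp add: pmon_def)

lemma tr_sum_pmon [simp]: "tr (\<Sum>B\<in>\<B>. pmon B) = 0"
  by (simp add: tr_def)

lemma Gr_idl_add: "x \<in> Gr_idl k l \<Longrightarrow> y \<in> Gr_idl k l \<Longrightarrow> x + y \<in> Gr_idl k l"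
  unfolding Gr_idl_def by (rule idl_add)

lemma Gr_idl_0 [simp]: "0 \<in> Gr_idl k l"
  unfolding Gr_idl_def by (rule idl_0)

lemma Gr_idl_mult:
  "x \<in> Gr_idl k l \<Longrightarrow> y * x \<in> Gr_idl k l"
  "x \<in> Gr_idl k l \<Longrightarrow> x * y \<in> Gr_idl k l"
  unfolding Gr_idl_def by (rule idl_mult, assumption)+

lemma Gr_idl_sum: "(\<And>i. i \<in> A \<Longrightarrow> f i \<in> Gr_idl k l) \<Longrightarrow> (\<Sum>i\<in>A. f i) \<in> Gr_idl k l"
  unfolding Gr_idl_def by (rule idl_sum)

lemma Gr_idl_cancel: "x + y \<in> Gr_idl k l \<Longrightarrow> x \<in> Gr_idl k l \<longleftrightarrow> y \<in> Gr_idl k l"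
  unfolding Gr_idl_def by (rule idl_add_cancel)

lemma bar_in_In: "x \<in> In n \<Longrightarrow> bar x \<in> In n"
  unfolding Gr_idl_def
proof (induction rule: ring_module.span_induct_alt)
  case (step c x y)
  have "bar x \<in> w ` {n<..} \<union> wbar ` {n<..}"
    using step(1) by auto
  with step show ?case
    by (simp add: idl_add idl_mult(1) idl_base)
qed simp

lemma tr_in_In: "x \<in> In n \<Longrightarrow> tr x \<in> In n"
  unfolding tr_def by (intro Gr_idl_add bar_in_In)

text \<open>In each term of \<open>pw_odd\<close> one of the two indices exceeds n. This is why p_j
  is read as zero beyond 2n.\<close>

lemma pw_in_In:
  assumes "odd j" "j > 2 * n"
  shows "pw j \<in> In n"
  unfolding pw_odd[OF assms(1)]
proof (rule Gr_idl_sum)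
  fix i assume "i \<in> {i \<in> {0..j}. even i}"
  then have "i > n \<or> j - i > n" using assms by auto
  then show "wbar i * w (j - i) \<in> In n"
    by (auto intro: Gr_idl_mult w_in_Gr_idl wbar_in_Gr_idl)
qed

lemma w_wbar_in_In: "n \<ge> 1 \<Longrightarrow> w n * wbar n \<in> In n"
proof -
  assume n: "n \<ge> 1"
  have "(\<Sum>i=0..2*n. w i * wbar (2 * n - i)) = w n * wbar n + (\<Sum>i\<in>{0..2*n} - {n}. w i * wbar (2 * n - i))"
    by (subst sum.remove[of _ n]) auto
  moreover have "(\<Sum>i\<in>{0..2*n} - {n}. w i * wbar (2 * n - i)) \<in> In n"
  proof (rule Gr_idl_sum)
    fix i assume "i \<in> {0..2*n} - {n}"
    then have "i > n \<or> 2 * n - i > n" by auto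
    then show "w i * wbar (2 * n - i) \<in> In n"
      by (auto intro: Gr_idl_mult w_in_Gr_idl wbar_in_Gr_idl)
  qed
  ultimately show ?thesis
    using w_wbar_sum[of "2 * n"] n by (simp add: add_eq_0_char2)
qed

text \<open>Only the indices n and n + 1 survive in \<open>pw_odd\<close>, and exactly one of them
  is even. For odd n this gives the conjugate formula, which \<open>bar\<close> brings back.\<close>

lemma pw_top_cong: "pw (2 * n + 1) + w (Suc n) * wbar n \<in> In (Suc n)"
proof -
  let ?S = "{i \<in> {0..2 * n + 1}. even i}" and ?f = "\<lambda>i. wbar i * w (2 * n + 1 - i)"
  define i0 where "i0 = (if even n then n else Suc n)"
  have "sum ?f (?S - {i0}) \<in> In (Suc n)"
  proof (rule Gr_idl_sum)
    fix i assume "i \<in> ?S - {i0}"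
    then have "i > Suc n \<or> 2 * n + 1 - i > Suc n"
      by (auto simp: i0_def split: if_splits) presburger+
    then show "?f i \<in> In (Suc n)"
      by (auto intro: Gr_idl_mult w_in_Gr_idl wbar_in_Gr_idl)
  qed
  moreover have "pw (2 * n + 1) = ?f i0 + sum ?f (?S - {i0})"
    by (subst pw_odd, simp, subst sum.remove[of _ i0]) (auto simp: i0_def)
  ultimately have *: "pw (2 * n + 1) + ?f i0 \<in> In (Suc n)"
    by (simp add: ac_simps)
  show ?thesis
  proof (cases "even n")
    case True
    then show ?thesis using * by (simp add: i0_def ac_simps)
  next
    case False
    then show ?thesis using bar_in_In[OF *] by (simp add: i0_def ac_simps)
  qed
qed

lemma pw_top_cong': "pw (2 * n + 1) + wbar (Suc n) * w n \<in> In (Suc n)"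
  using bar_in_In[OF pw_top_cong[of n]] by simp

lemma Gr_idl_Suc_iff_w: "x \<in> Gr_idl k l \<longleftrightarrow> (\<exists>a. x + w (Suc k) * a \<in> Gr_idl (Suc k) l)"
proof -
  have "w ` {k<..} \<union> wbar ` {l<..} = insert (w (Suc k)) (w ` {Suc k<..} \<union> wbar ` {l<..})"
    by (metis Un_insert_left greaterThan_Suc_insert image_insert)
  then show ?thesis
    unfolding Gr_idl_def by (simp add: idl_insert_char2 mult.commute)
qed

lemma Gr_idl_Suc_iff_wbar: "x \<in> Gr_idl k l \<longleftrightarrow> (\<exists>b. x + wbar (Suc l) * b \<in> Gr_idl k (Suc l))"
proof -
  have "w ` {k<..} \<union> wbar ` {l<..} = insert (wbar (Suc l)) (w ` {k<..} \<union> wbar ` {Suc l<..})"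
    by (metis Un_insert_right greaterThan_Suc_insert image_insert)
  then show ?thesis
    unfolding Gr_idl_def by (simp add: idl_insert_char2 mult.commute)
qed

lemma In_Suc_iff: "x \<in> In n \<longleftrightarrow> (\<exists>a b. x + (w (Suc n) * a + wbar (Suc n) * b) \<in> In (Suc n))"
  by (subst Gr_idl_Suc_iff_w, subst Gr_idl_Suc_iff_wbar) (simp add: add.assoc)

text \<open>Modulo \<open>wbar (Suc n)\<close> the colon lemma puts \<open>c\<close> into the ideal
  of type (n + 1, n - 1), so \<open>c\<close> is a combination of \<open>wbar n\<close> and
  \<open>wbar (Suc n)\<close>. Multiplication by \<open>w (Suc n)\<close> turns the first into the
  top power sum and kills the second. For n = 0 there is no such type, but
  \<open>wbar 0 = 1\<close>.\<close>

lemma In_intersection: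
  assumes "w (Suc n) * c + wbar (Suc n) * c' \<in> In (Suc n)"
  shows "\<exists>u. w (Suc n) * c + pw (2 * n + 1) * u \<in> In (Suc n)"
proof (cases n)
  case 0
  have "c * (pw (2 * n + 1) + w (Suc n) * wbar n) \<in> In (Suc n)"
    by (intro Gr_idl_mult(1) pw_top_cong)
  then show ?thesis
    by (intro exI[of _ c]) (simp add: 0 distrib_left ac_simps)
next
  case (Suc m)
  have "w (Suc n) * c + wbar (Suc n) * c' \<in> Gr_idl (Suc n) n"
    using assms Gr_idl_mono[of "Suc n" "Suc n" n "Suc n"] by auto
  then have "w (Suc n) * c \<in> Gr_idl (Suc n) n"
    using Gr_idl_cancel Gr_idl_mult(2)[OF wbar_in_Gr_idl[of n "Suc n"]] by blast
  then have "c \<in> Gr_idl (Suc n) m"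
    using Gr_idl_colon_w[of "Suc n" n c] Suc by simp
  then obtain u v where uv: "c + wbar n * u + wbar (Suc n) * v \<in> In (Suc n)"
    unfolding Gr_idl_Suc_iff_wbar[of _ "Suc n" m] Gr_idl_Suc_iff_wbar[of _ "Suc n" n] Suc[symmetric]
    by blast
  have "w (Suc n) * (c + wbar n * u + wbar (Suc n) * v) + v * (w (Suc n) * wbar (Suc n))
      + u * (pw (2 * n + 1) + w (Suc n) * wbar n) \<in> In (Suc n)"
    by (rule Gr_idl_add[OF Gr_idl_add[OF Gr_idl_mult(1)[OF uv] Gr_idl_mult(1)[OF w_wbar_in_In]]
          Gr_idl_mult(1)[OF pw_top_cong]]) simp
  then show ?thesis
    by (intro exI[of _ u]) (simp add: distrib_left ac_simps)
qed

text \<open>The top power sum is \<open>w (Suc n) * wbar n\<close>, and dividing by the two factors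
  in turn lowers both indices.\<close>

lemma pw_top_colon:
  assumes "pw (2 * n + 1) * y \<in> In (Suc n)"
  shows "y \<in> In n"
proof -
  have "pw (2 * n + 1) * y + w (Suc n) * (wbar n * y) \<in> In (Suc n)"
    using Gr_idl_mult(2)[OF pw_top_cong[of n], of y] by (simp add: distrib_right mult.assoc)
  then have "w (Suc n) * (wbar n * y) \<in> In (Suc n)"
    using assms Gr_idl_cancel by blast
  then have "wbar n * y \<in> Gr_idl (Suc n) n"
    using Gr_idl_colon_w[of "Suc n" "Suc n"] by simp
  then show ?thesis
    using Gr_idl_colon_wbar[of "Suc n" n] by simp
qed

text \<open>The top power sum has an expression divisible by \<open>w (Suc n)\<close> and one
  divisible by \<open>wbar (Suc n)\<close>. As the product of these two vanishes, it kills both, so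
  multiplication by it is well defined on the ring for n.\<close>

lemma pw_top_mult:
  assumes "y \<in> In n"
  shows "pw (2 * n + 1) * y \<in> In (Suc n)"
proof -
  let ?p = "pw (2 * n + 1)"
  obtain a b where ab: "y + (w (Suc n) * a + wbar (Suc n) * b) \<in> In (Suc n)"
    using assms unfolding In_Suc_iff[of y] by blast
  have "(w (Suc n) * a) * (?p + wbar (Suc n) * w n) + (a * w n) * (w (Suc n) * wbar (Suc n)) \<in> In (Suc n)"
    by (intro Gr_idl_add Gr_idl_mult(1) pw_top_cong' w_wbar_in_In) simp
  then have 1: "?p * (w (Suc n) * a) \<in> In (Suc n)"
    by (simp add: distrib_left distrib_right ac_simps)
  have "(wbar (Suc n) * b) * (?p + w (Suc n) * wbar n) + (b * wbar n) * (w (Suc n) * wbar (Suc n)) \<in> In (Suc n)"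
    by (intro Gr_idl_add Gr_idl_mult(1) pw_top_cong w_wbar_in_In) simp
  then have 2: "?p * (wbar (Suc n) * b) \<in> In (Suc n)"
    by (simp add: distrib_left distrib_right ac_simps)
  from Gr_idl_add[OF Gr_idl_mult(1)[OF ab, of ?p] Gr_idl_add[OF 1 2]] show ?thesis
    by (simp add: distrib_left ac_simps)
qed

lemma In_0_cases: "x \<in> In 0 \<or> x + 1 \<in> In 0"
proof (induction x rule: wpoly_induct)
  case (add x y)
  then have "x + y \<in> In 0 \<or> x + (y + 1) \<in> In 0 \<or> (x + 1) + y \<in> In 0 \<or> (x + 1) + (y + 1) \<in> In 0"
    using Gr_idl_add by blast
  then show ?case by (auto simp: ac_simps)
next
  case (mult k x)
  then show ?case by (intro disjI1 Gr_idl_mult(2) w_in_Gr_idl) auto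
qed auto

lemma tr_in_In_0: "tr x \<in> In 0"
  using In_0_cases[of x] tr_in_In[of x 0] tr_in_In[of "x + 1" 0] by (auto simp: tr_add)

text \<open>Every \<open>wbar j\<close> with j > 0 lies in the ideal of the variables, and setting
  all variables to zero does not kill 1.\<close>

lemma one_notin_In_0: "1 \<notin> In 0"
proof
  have wb: "wbar j \<in> idl (w ` {0<..})" if "j > 0" for j
    using that
  proof (induction j rule: less_induct)
    case (less j)
    have "(\<Sum>i=0..j. w i * wbar (j - i)) = wbar j + (\<Sum>i=1..j. w i * wbar (j - i))"
      by (simp add: sum.atLeast_Suc_atMost)
    then have "wbar j = (\<Sum>i=1..j. w i * wbar (j - i))"
      using w_wbar_sum[of j] less by (simp add: add_eq_0_char2)
    also have "\<dots> \<in> idl (w ` {0<..})"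
      by (intro idl_sum idl_mult(2) idl_base) auto
    finally show ?case .
  qed
  assume "1 \<in> In 0"
  then have "1 \<in> idl (w ` {0<..})"
    unfolding Gr_idl_def using wb by (elim subsetD[OF idl_subsetI, rotated]) (auto intro: idl_base)
  then show False
    unfolding kill_above_eq_0_iff[symmetric] by (simp flip: Rep_wpoly_inject)
qed

lemma pmon_insert: "finite B \<Longrightarrow> j \<notin> B \<Longrightarrow> pmon (insert j B) = pw j * pmon B"
  by (simp add: pmon_def)

lemma sum_pmon_insert:
  assumes "\<B> \<subseteq> Pow (odds n)"
  shows "(\<Sum>B\<in>insert (2 * n + 1) ` \<B>. pmon B) = pw (2 * n + 1) * (\<Sum>B\<in>\<B>. pmon B)"
proof -
  have top: "2 * n + 1 \<notin> B" "finite B" if "B \<in> \<B>" for B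
  proof -
    have "B \<subseteq> odds n"
      using assms that by auto
    then show "2 * n + 1 \<notin> B" "finite B"
      using finite_subset[OF _ finite_odds] by (auto simp: odds_def)
  qed
  then have "inj_on (insert (2 * n + 1)) \<B>"
    by (meson inj_onI insert_ident)
  then show ?thesis
    unfolding sum_distrib_left using top by (simp add: sum.reindex pmon_insert cong: sum.cong)
qed

text \<open>The two ideals generated by \<open>w (Suc n)\<close> and \<open>wbar (Suc n)\<close> in the cohomology ring for
  \<open>Suc n\<close> are exchanged by \<open>bar\<close>. Up to traces only their intersection contributes, which is a copy
  of the ring for \<open>n\<close> multiplied by \<open>pw (2 * n + 1)\<close>.\<close>

lemma invariants_mod_traces:
  assumes "tr x \<in> In n"
  shows "\<exists>\<B> \<subseteq> Pow (odds n). \<exists>r. x + ((\<Sum>B\<in>\<B>. pmon B) + tr r) \<in> In n"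
  using assms
proof (induction n arbitrary: x)
  case 0
  from In_0_cases[of x] show ?case
  proof
    assume "x \<in> In 0"
    then show ?thesis by (intro exI[of _ "{}"] conjI exI[of _ 0]) auto
  next
    assume "x + 1 \<in> In 0"
    then show ?thesis by (intro exI[of _ "{{}}"] conjI exI[of _ 0]) (auto simp: pmon_def)
  qed
next
  case (Suc n)
  let ?p = "pw (2 * n + 1)" and ?w = "w (Suc n)" and ?wb = "wbar (Suc n)"
  have "tr x \<in> In n"
    using Suc.prems Gr_idl_mono[of n "Suc n" n "Suc n"] by auto
  then obtain \<B> r where \<B>: "\<B> \<subseteq> Pow (odds n)" and "x + ((\<Sum>B\<in>\<B>. pmon B) + tr r) \<in> In n"
    using Suc.IH by blast
  then obtain a b where ab: "x + ((\<Sum>B\<in>\<B>. pmon B) + tr r) + (?w * a + ?wb * b) \<in> In (Suc n)"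
    unfolding In_Suc_iff[of "x + ((\<Sum>B\<in>\<B>. pmon B) + tr r)"] by blast
  \<comment> \<open>The trace of \<open>?w * a + ?wb * b\<close> depends only on this
    combination.\<close>
  define c where "c = a + bar b"
  have "tr (x + ((\<Sum>B\<in>\<B>. pmon B) + tr r) + (?w * a + ?wb * b)) + tr x \<in> In (Suc n)"
    by (rule Gr_idl_add[OF tr_in_In[OF ab] Suc.prems])
  also have "tr (x + ((\<Sum>B\<in>\<B>. pmon B) + tr r) + (?w * a + ?wb * b)) + tr x = tr (?w * a + ?wb * b)"
    by (simp add: tr_add add.commute)
  also have "\<dots> = ?w * c + ?wb * bar c"
    by (simp add: tr_def c_def distrib_left ac_simps)
  finally have wc: "?w * c + ?wb * bar c \<in> In (Suc n)" .
  then obtain u where u: "?w * c + ?p * u \<in> In (Suc n)"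
    using In_intersection by blast
  \<comment> \<open>The trace of the relation for \<open>u\<close> leaves \<open>?p * tr u\<close>,
    so \<open>u\<close> is invariant in the ring for n and the induction hypothesis applies a second
    time.\<close>
  have "tr (?w * c + ?p * u) + (?w * c + ?wb * bar c) \<in> In (Suc n)"
    by (rule Gr_idl_add[OF tr_in_In[OF u] wc])
  then have "?p * tr u \<in> In (Suc n)"
    by (simp add: tr_def distrib_left distrib_right ac_simps)
  then have "tr u \<in> In n"
    by (rule pw_top_colon)
  then obtain \<C> s where \<C>: "\<C> \<subseteq> Pow (odds n)" and s: "u + ((\<Sum>B\<in>\<C>. pmon B) + tr s) \<in> In n"
    using Suc.IH by blast
  have ps: "?p * (u + ((\<Sum>B\<in>\<C>. pmon B) + tr s)) \<in> In (Suc n)"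
    using s by (rule pw_top_mult)
  let ?D = "\<B> \<union> insert (2 * n + 1) ` \<C>"
  have D: "(\<Sum>B\<in>?D. pmon B) = (\<Sum>B\<in>\<B>. pmon B) + ?p * (\<Sum>B\<in>\<C>. pmon B)"
  proof -
    have "\<B> \<inter> insert (2 * n + 1) ` \<C> = {}"
      using \<B> by (auto simp: odds_def)
    moreover have "finite \<B>" "finite \<C>"
      using \<B> \<C> finite_subset by (meson finite_Pow_iff finite_odds)+
    ultimately show ?thesis
      using sum_pmon_insert[OF \<C>] by (simp add: sum.union_disjoint)
  qed
  have sub: "?D \<subseteq> Pow (odds (Suc n))"
    using \<B> \<C> by (auto simp: odds_Suc)
  have mem: "(x + ((\<Sum>B\<in>\<B>. pmon B) + tr r) + (?w * a + ?wb * b)) + (?w * c + ?wb * bar c)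
      + (?w * c + ?p * u) + ?p * (u + ((\<Sum>B\<in>\<C>. pmon B) + tr s)) \<in> In (Suc n)"
    by (rule Gr_idl_add[OF Gr_idl_add[OF Gr_idl_add[OF ab wc] u] ps])
  \<comment> \<open>Here \<open>?w * a + ?wb * b + ?wb * bar c\<close> is
    \<open>tr (?w * a)\<close>, and \<open>?p * tr s\<close> is \<open>tr (?p * s)\<close>.\<close>
  have eq: "(x + ((\<Sum>B\<in>\<B>. pmon B) + tr r) + (?w * a + ?wb * b)) + (?w * c + ?wb * bar c)
      + (?w * c + ?p * u) + ?p * (u + ((\<Sum>B\<in>\<C>. pmon B) + tr s))
    = x + (((\<Sum>B\<in>\<B>. pmon B) + ?p * (\<Sum>B\<in>\<C>. pmon B)) + tr (r + ?w * a + ?p * s))"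
    by (simp add: c_def tr_def distrib_left distrib_right ac_simps)
  have "x + ((\<Sum>B\<in>?D. pmon B) + tr (r + ?w * a + ?p * s)) \<in> In (Suc n)"
    using mem by (simp only: eq D)
  with sub show ?case by blast
qed

text \<open>The top power sum vanishes for n, so the induction hypothesis removes the monomials
  without it. What is left is a trace \<open>?p * S1\<close> in the intersection of the two ideals
  up to traces; dividing by \<open>?p\<close> makes \<open>S1\<close> a trace in the ring for
  n.\<close>

lemma pmon_independent_mod_traces:
  assumes "\<B> \<subseteq> Pow (odds n)" "(\<Sum>B\<in>\<B>. pmon B) + tr r \<in> In n"
  shows "\<B> = {}"
  using assms
proof (induction n arbitrary: \<B> r)
  case 0
  then have "(\<Sum>B\<in>\<B>. pmon B) \<in> In 0"
    using Gr_idl_cancel tr_in_In_0 by blast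
  moreover have "\<B> = {} \<or> \<B> = {{}}"
    using 0 by (auto simp: odds_def)
  ultimately show ?case
    using one_notin_In_0 by (auto simp: pmon_def)
next
  case (Suc n)
  let ?p = "pw (2 * n + 1)" and ?w = "w (Suc n)" and ?wb = "wbar (Suc n)"
  define \<C> where "\<C> = \<B> \<inter> Pow (odds n)"
  define \<D> where "\<D> = {B \<in> Pow (odds n). insert (2 * n + 1) B \<in> \<B>}"
  have \<C>: "\<C> \<subseteq> Pow (odds n)" and \<D>: "\<D> \<subseteq> Pow (odds n)"
    by (auto simp: \<C>_def \<D>_def)
  have \<B>: "\<B> = \<C> \<union> insert (2 * n + 1) ` \<D>"
  proof
    show "\<B> \<subseteq> \<C> \<union> insert (2 * n + 1) ` \<D>"
    proof
      fix B assume B: "B \<in> \<B>"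
      show "B \<in> \<C> \<union> insert (2 * n + 1) ` \<D>"
      proof (cases "2 * n + 1 \<in> B")
        case True
        then have "insert (2 * n + 1) (B - {2 * n + 1}) = B" by auto
        moreover have "B - {2 * n + 1} \<in> \<D>"
          using B True Suc.prems(1) by (auto simp: \<D>_def odds_Suc insert_absorb)
        ultimately show ?thesis by blast
      next
        case False
        then show ?thesis
          using B Suc.prems(1) by (auto simp: \<C>_def odds_Suc)
      qed
    qed
  qed (auto simp: \<C>_def \<D>_def)
  define S0 S1 where "S0 = (\<Sum>B\<in>\<C>. pmon B)" and "S1 = (\<Sum>B\<in>\<D>. pmon B)"
  have S: "(\<Sum>B\<in>\<B>. pmon B) = S0 + ?p * S1"
  proof -
    have "\<C> \<inter> insert (2 * n + 1) ` \<D> = {}"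
      using \<C> by (auto simp: odds_def)
    moreover have "finite \<C>" "finite \<D>"
      using \<C> \<D> finite_subset by (meson finite_Pow_iff finite_odds)+
    ultimately show ?thesis
      using sum_pmon_insert[OF \<D>] by (simp add: \<B> sum.union_disjoint S0_def S1_def)
  qed
  have mono: "In (Suc n) \<subseteq> In n"
    by (rule Gr_idl_mono) auto
  have p: "?p \<in> In n"
    by (rule pw_in_In) auto
  have "S0 + tr r + ?p * S1 \<in> In n"
    using Suc.prems(2) mono by (auto simp: S ac_simps)
  then have 0: "S0 + tr r \<in> In n"
    using Gr_idl_cancel Gr_idl_mult(2)[OF p] by blast
  then have C: "\<C> = {}"
    using Suc.IH[OF \<C>] by (simp add: S0_def)
  then have "tr r \<in> In n"
    using 0 by (simp add: S0_def)
  \<comment> \<open>As \<open>tr r\<close> vanishes for n, adding invariant monomials and a trace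
    moves \<open>r\<close> into the sum of the two ideals without changing
    \<open>tr r\<close>.\<close>
  then obtain \<B>' s where "r + ((\<Sum>B\<in>\<B>'. pmon B) + tr s) \<in> In n"
    using invariants_mod_traces by blast
  then obtain a b where ab: "r + ((\<Sum>B\<in>\<B>'. pmon B) + tr s) + (?w * a + ?wb * b) \<in> In (Suc n)"
    unfolding In_Suc_iff[of "r + ((\<Sum>B\<in>\<B>'. pmon B) + tr s)"] by blast
  define c where "c = a + bar b"
  have "tr (r + ((\<Sum>B\<in>\<B>'. pmon B) + tr s) + (?w * a + ?wb * b)) \<in> In (Suc n)"
    by (rule tr_in_In[OF ab])
  also have "tr (r + ((\<Sum>B\<in>\<B>'. pmon B) + tr s) + (?w * a + ?wb * b)) = tr r + (?w * c + ?wb * bar c)"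
    by (simp add: tr_add) (simp add: tr_def c_def distrib_left ac_simps)
  finally have rc: "tr r + (?w * c + ?wb * bar c) \<in> In (Suc n)" .
  have pr: "?p * S1 + tr r \<in> In (Suc n)"
    using Suc.prems(2) by (simp add: S C S0_def)
  \<comment> \<open>Replacing \<open>?p\<close> by \<open>?w * wbar n\<close> brings the relation
    into the form that \<open>In_intersection\<close> requires.\<close>
  have "(?p * S1 + tr r) + (tr r + (?w * c + ?wb * bar c)) + (?p + ?w * wbar n) * S1 \<in> In (Suc n)"
    by (rule Gr_idl_add[OF Gr_idl_add[OF pr rc] Gr_idl_mult(2)[OF pw_top_cong]])
  then have "?w * (c + wbar n * S1) + ?wb * bar c \<in> In (Suc n)"
    by (simp add: distrib_left distrib_right ac_simps)
  then obtain v where v: "?w * (c + wbar n * S1) + ?p * v \<in> In (Suc n)"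
    using In_intersection by blast
  define u where "u = S1 + v"
  have "(?w * (c + wbar n * S1) + ?p * v) + (?p + ?w * wbar n) * S1 \<in> In (Suc n)"
    by (rule Gr_idl_add[OF v Gr_idl_mult(2)[OF pw_top_cong]])
  then have u: "?w * c + ?p * u \<in> In (Suc n)"
    by (simp add: u_def distrib_left distrib_right ac_simps)
  have "tr (?w * c + ?p * u) + (?p * S1 + tr r) + (tr r + (?w * c + ?wb * bar c)) \<in> In (Suc n)"
    by (rule Gr_idl_add[OF Gr_idl_add[OF tr_in_In[OF u] pr] rc])
  then have "?p * (S1 + tr u) \<in> In (Suc n)"
    by (simp add: tr_def distrib_left distrib_right ac_simps)
  then have "S1 + tr u \<in> In n"
    by (rule pw_top_colon)
  then have "\<D> = {}"
    using Suc.IH[OF \<D>] by (simp add: S1_def)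
  with C \<B> show ?case by simp
qed

section \<open>The basis of R\<close>

definition wt :: "(nat \<Rightarrow>\<^sub>0 nat) \<Rightarrow> nat" where
  "wt m = (\<Sum>v\<in>keys m. v * lookup m v)"

definition len :: "(nat \<Rightarrow>\<^sub>0 nat) \<Rightarrow> nat" where
  "len m = (\<Sum>v\<in>keys m. lookup m v)"

lemma wt_superset: "finite V \<Longrightarrow> keys m \<subseteq> V \<Longrightarrow> wt m = (\<Sum>v\<in>V. v * lookup m v)"
  unfolding wt_def by (intro sum.mono_neutral_left) (auto simp: in_keys_iff)

lemma len_superset: "finite V \<Longrightarrow> keys m \<subseteq> V \<Longrightarrow> len m = (\<Sum>v\<in>V. lookup m v)"
  unfolding len_def by (intro sum.mono_neutral_left) (auto simp: in_keys_iff)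

lemma wt_add [simp]: "wt (m + m') = wt m + wt m'"
proof -
  let ?V = "keys m \<union> keys m'"
  have "wt (m + m') = (\<Sum>v\<in>?V. v * lookup (m + m') v)"
    using Poly_Mapping.keys_add[of m m'] by (intro wt_superset) auto
  then show ?thesis
    by (simp add: lookup_add distrib_left sum.distrib wt_superset[of ?V])
qed

lemma len_add [simp]: "len (m + m') = len m + len m'"
proof -
  let ?V = "keys m \<union> keys m'"
  have "len (m + m') = (\<Sum>v\<in>?V. lookup (m + m') v)"
    using Poly_Mapping.keys_add[of m m'] by (intro len_superset) auto
  then show ?thesis
    by (simp add: lookup_add sum.distrib len_superset[of ?V])
qed

lemma wt_0 [simp]: "wt 0 = 0" and len_0 [simp]: "len 0 = 0"
  by (simp_all add: wt_def len_def)

lemma wt_single [simp]: "wt (Poly_Mapping.single v k) = v * k"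
  by (simp add: wt_superset[of "{v}"])

lemma len_single [simp]: "len (Poly_Mapping.single v k) = k"
  by (simp add: len_superset[of "{v}"])

lemma len_le_wt: "keys m \<subseteq> {1..} \<Longrightarrow> len m \<le> wt m"
  unfolding wt_def len_def by (intro sum_mono) auto

definition gr :: "nat \<Rightarrow> nat \<Rightarrow> nat mpoly2 set" where
  "gr d l = {f. \<forall>m\<in>keys f. keys m \<subseteq> {1..} \<and> wt m = d \<and> l \<le> len m}"

lemma gr_0 [simp]: "0 \<in> gr d l"
  by (simp add: gr_def)

lemma gr_1 [simp]: "1 \<in> gr 0 0"
  by (simp add: gr_def)

lemma gr_add: "f \<in> gr d l \<Longrightarrow> g \<in> gr d l \<Longrightarrow> f + g \<in> gr d l"
  using Poly_Mapping.keys_add[of f g] unfolding gr_def by blast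

lemma gr_sum: "(\<And>i. i \<in> A \<Longrightarrow> f i \<in> gr d l) \<Longrightarrow> sum f A \<in> gr d l"
  by (induction A rule: infinite_finite_induct) (auto intro: gr_add)

lemma gr_mult:
  assumes "f \<in> gr d l" "g \<in> gr d' l'"
  shows "f * g \<in> gr (d + d') (l + l')"
  unfolding gr_def
proof (intro CollectI ballI)
  fix m assume "m \<in> keys (f * g)"
  then obtain a b where ab: "m = a + b" "a \<in> keys f" "b \<in> keys g"
    using keys_mult[of f g] by blast
  then have "keys a \<subseteq> {1..} \<and> wt a = d \<and> l \<le> len a" "keys b \<subseteq> {1..} \<and> wt b = d' \<and> l' \<le> len b"
    using assms by (auto simp: gr_def simp del: One_nat_def)
  then show "keys m \<subseteq> {1..} \<and> wt m = d + d' \<and> l + l' \<le> len m"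
    using Poly_Mapping.keys_add[of a b] ab(1) by auto
qed

lemma gr_mono: "l' \<le> l \<Longrightarrow> gr d l \<subseteq> gr d l'"
  by (auto simp: gr_def)

lemma gr_W: "k \<ge> 1 \<Longrightarrow> W k \<in> gr k 1"
  by (auto simp: gr_def W_def Var_def)

lemma W_bar_Suc: "W_bar (Suc k) = W (Suc k) + (\<Sum>i<k. W (Suc i) * W_bar (k - i))"
  by (simp add: lessThan_Suc_atMost[symmetric])

declare W_bar.simps(2) [simp del]

lemma gr_W_bar: "k \<ge> 1 \<Longrightarrow> W_bar k \<in> gr k 1"
proof (induction k rule: less_induct)
  case (less k)
  then obtain l where l: "k = Suc l" by (cases k) auto
  have "W (Suc i) * W_bar (l - i) \<in> gr k 1" if "i < l" for i
    using gr_mult[OF gr_W[of "Suc i"] less.IH[of "l - i"]] that gr_mono[of 1 2 k] l 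
    by (auto simp: numeral_2_eq_2)
  then show ?case
    unfolding l W_bar_Suc using gr_W[of k] l by (intro gr_add gr_sum) auto
qed

lemma W_bar_lead2: "k \<ge> 1 \<Longrightarrow> W_bar k + W k \<in> gr k 2"
proof -
  assume "k \<ge> 1"
  then obtain l where l: "k = Suc l" by (cases k) auto
  have "W (Suc i) * W_bar (l - i) \<in> gr k 2" if "i < l" for i
    using gr_mult[OF gr_W[of "Suc i"] gr_W_bar[of "l - i"]] that l by (auto simp: numeral_2_eq_2)
  then show ?thesis
    unfolding l W_bar_Suc using l by (auto simp: ac_simps intro: gr_sum)
qed

text \<open>Up to longer products this is the convolution of the \<open>W j\<close> with themselves
  without its two end terms, and in characteristic 2 only the middle term survives.\<close>

lemma dd_W_lead: "i \<ge> 1 \<Longrightarrow> dd (W (2 * i)) + W i ^ 2 \<in> gr (2 * i) 3"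
proof -
  assume i: "i \<ge> 1"
  then obtain l where l: "2 * i = Suc l" by (cases "2 * i") auto
  have "(\<Sum>j<l. W (Suc j) * W (l - j)) = W i ^ 2"
  proof -
    \<comment> \<open>The value 0 instead of 1 at the index 0 removes the two end terms.\<close>
    let ?f = "\<lambda>j. if j = 0 then 0 else W j"
    have "(\<Sum>j<l. W (Suc j) * W (l - j)) = (\<Sum>j=1..l. ?f j * ?f (Suc l - j))"
      by (rule sum.reindex_bij_witness[of _ "\<lambda>j. j - 1" Suc]) auto
    also have "\<dots> = (\<Sum>j=0..Suc l. ?f j * ?f (Suc l - j))"
      by (intro sum.mono_neutral_left) auto
    also have "\<dots> = ?f i ^ 2"
      using sum_convolution_char2[of ?f "Suc l"] by (simp flip: l)
    finally show ?thesis using i by simp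
  qed
  then have "dd (W (2 * i)) + W i ^ 2 = (\<Sum>j<l. W (Suc j) * (W_bar (l - j) + W (l - j)))"
  proof -
    have "dd (W (2 * i)) = (\<Sum>j<l. W (Suc j) * W_bar (l - j))"
      by (simp add: dd_def omega_def l W_def[of "Suc l"]) (simp add: W_bar_Suc W_def)
    moreover assume "(\<Sum>j<l. W (Suc j) * W (l - j)) = W i ^ 2"
    ultimately show ?thesis
      by (simp only: distrib_left sum.distrib)
  qed
  also have "W (Suc j) * (W_bar (l - j) + W (l - j)) \<in> gr (2 * i) 3" if "j < l" for j
    using gr_mult[OF gr_W[of "Suc j"] W_bar_lead2[of "l - j"]] that l
    by (auto simp: numeral_eq_Suc)
  then have "(\<Sum>j<l. W (Suc j) * (W_bar (l - j) + W (l - j))) \<in> gr (2 * i) 3"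
    by (intro gr_sum) auto
  finally show ?thesis .
qed

lemma gr_psum: "k \<ge> 1 \<Longrightarrow> psum k \<in> gr k 1"
proof (induction k rule: less_induct)
  case (less k)
  then obtain l where l: "k = Suc l" by (cases k) auto
  have "psum (l - i) * W (Suc i) \<in> gr k 1" if "i < l" for i
    using gr_mult[OF less.IH[of "l - i"] gr_W[of "Suc i"]] that gr_mono[of 1 2 k] l
    by (auto simp: numeral_2_eq_2)
  then show ?case
    using gr_W[of k] l by (auto simp: of_nat_char2 simp del: of_nat_Suc intro!: gr_add gr_sum)
qed

lemma psum_lead: "odd k \<Longrightarrow> psum k + W k \<in> gr k 2"
proof -
  assume k: "odd k"
  then obtain l where l: "k = Suc l" by (cases k) auto
  have "psum (l - i) * W (Suc i) \<in> gr k 2" if "i < l" for i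
    using gr_mult[OF gr_psum[of "l - i"] gr_W[of "Suc i"]] that l by (auto simp: numeral_2_eq_2)
  then show ?thesis
    using k l by (auto simp: of_nat_char2 ac_simps simp del: of_nat_Suc intro: gr_sum)
qed

definition lowest :: "nat \<Rightarrow> nat \<Rightarrow> nat mpoly2 \<Rightarrow> nat mpoly2 \<Rightarrow> bool" where
  "lowest d l f f0 \<longleftrightarrow> f0 \<in> gr d l \<and> f + f0 \<in> gr d (Suc l)"

lemma lowest_1: "lowest 0 0 1 1"
  by (simp add: lowest_def)

lemma lowest_mult:
  assumes "lowest d l f f0" "lowest d' l' g g0"
  shows "lowest (d + d') (l + l') (f * g) (f0 * g0)"
proof -
  have "g \<in> gr d' l'"
    using gr_add[of "g + g0" d' l' g0] assms(2) gr_mono[of l' "Suc l'" d']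
    by (auto simp: lowest_def ac_simps)
  then have "(f + f0) * g \<in> gr (d + d') (Suc (l + l'))" "f0 * (g + g0) \<in> gr (d + d') (Suc (l + l'))"
    using assms gr_mult[of "f + f0" d "Suc l" g d' l'] gr_mult[of f0 d l "g + g0" d' "Suc l'"]
    by (auto simp: lowest_def)
  then have "(f + f0) * g + f0 * (g + g0) \<in> gr (d + d') (Suc (l + l'))"
    by (rule gr_add)
  then show ?thesis
    using assms gr_mult[of f0 d l g0 d' l'] by (simp add: lowest_def algebra_simps)
qed

lemma lowest_prod:
  assumes "\<And>i. i \<in> A \<Longrightarrow> lowest (d i) (l i) (f i) (g i)"
  shows "lowest (\<Sum>i\<in>A. d i) (\<Sum>i\<in>A. l i) (\<Prod>i\<in>A. f i) (\<Prod>i\<in>A. g i)"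
  using assms by (induction A rule: infinite_finite_induct) (auto intro: lowest_1 lowest_mult)

lemma lowest_prod_mset:
  assumes "\<And>i. i \<in># M \<Longrightarrow> lowest (d i) (l i) (f i) (g i)"
  shows "lowest (\<Sum>i\<in>#M. d i) (\<Sum>i\<in>#M. l i) (\<Prod>i\<in>#M. f i) (\<Prod>i\<in>#M. g i)"
  using assms by (induction M) (auto intro: lowest_1 lowest_mult)

definition lead_mon :: "basis_index \<Rightarrow> nat \<Rightarrow>\<^sub>0 nat" where
  "lead_mon = (\<lambda>(B, A, M). (\<Sum>j\<in>B. Poly_Mapping.single j 1) + (\<Sum>i\<in>A. Poly_Mapping.single i 1)
     + (\<Sum>i\<in>#M. Poly_Mapping.single (i div 2) 2))"

lemma single_add_1: "Poly_Mapping.single (m + m') (1 :: bit) = Poly_Mapping.single m 1 * Poly_Mapping.single m' 1"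
  by (simp add: mult_single)

lemma single_sum_1:
  "Poly_Mapping.single (\<Sum>i\<in>A. m i) (1 :: bit) = (\<Prod>i\<in>A. Poly_Mapping.single (m i) 1)"
  by (induction A rule: infinite_finite_induct) (simp_all add: single_add_1)

lemma single_sum_mset_1:
  "Poly_Mapping.single (\<Sum>i\<in>#M. m i) (1 :: bit) = (\<Prod>i\<in>#M. Poly_Mapping.single (m i) 1)"
  by (induction M) (simp_all add: single_add_1)

lemma single_lead_mon:
  assumes "(B, A, M) \<in> basis_indices"
  shows "Poly_Mapping.single (lead_mon (B, A, M)) 1
    = (\<Prod>j\<in>B. W j) * (\<Prod>i\<in>A. W i) * (\<Prod>i\<in>#M. W (i div 2) ^ 2)"
proof -
  have W: "Poly_Mapping.single (Poly_Mapping.single j 1) 1 = W j" if "j > 0" for j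
    using that by (simp add: W_def Var_def)
  have W2: "Poly_Mapping.single (Poly_Mapping.single j 2) 1 = W j ^ 2" if "j > 0" for j
    using that by (simp add: W_def single_eq_monom_subst)
  have pos: "j > 0" if "j \<in> B" for j
    using assms that by (auto simp: basis_indices_def intro: odd_pos)
  have posM: "i div 2 > 0" if "i \<in># M" for i
  proof -
    have "even i" "i > 0"
      using assms that by (auto simp: basis_indices_def)
    then show ?thesis by (elim evenE) auto
  qed
  have "(\<Prod>i\<in>#M. Poly_Mapping.single (Poly_Mapping.single (i div 2) 2) 1) = (\<Prod>i\<in>#M. W (i div 2) ^ 2)"
    by (intro arg_cong[of _ _ prod_mset] image_mset_cong W2 posM)
  moreover have "(\<Prod>j\<in>B. Poly_Mapping.single (Poly_Mapping.single j 1) 1) = (\<Prod>j\<in>B. W j)"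
    "(\<Prod>j\<in>A. Poly_Mapping.single (Poly_Mapping.single j 1) 1) = (\<Prod>j\<in>A. W j)"
    using assms pos by (intro prod.cong refl W; auto simp: basis_indices_def)+
  ultimately show ?thesis
    unfolding lead_mon_def prod.case single_add_1 single_sum_1 single_sum_mset_1 by simp
qed

lemma lookup_lead_mon:
  assumes "(B, A, M) \<in> basis_indices"
  shows "lookup (lead_mon (B, A, M)) v = of_bool (v \<in> B) + of_bool (v \<in> A) + 2 * count M (2 * v)"
proof -
  have "lookup (\<Sum>i\<in>#M. Poly_Mapping.single (i div 2) 2) v = 2 * count M (2 * v)"
    if "\<forall>i\<in>#M. even i" for M
    using that by (induction M) (auto simp: lookup_add lookup_single when_def)
  moreover have "lookup (\<Sum>j\<in>X. Poly_Mapping.single j 1) v = (of_bool (v \<in> X) :: nat)" if "finite X" for X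
    using that by (simp add: lookup_sum lookup_single when_def)
  ultimately show ?thesis
    using assms by (auto simp: lead_mon_def lookup_add basis_indices_def)
qed

text \<open>The exponents determine the triple: the parity of an exponent decides membership in B or
  A, according to the parity of the index, and its half is a multiplicity in M.\<close>

lemma lead_mon_inj:
  assumes s: "s \<in> basis_indices" and t: "t \<in> basis_indices" and eq: "lead_mon s = lead_mon t"
  shows "s = t"
proof -
  obtain B A M B' A' M' where st: "s = (B, A, M)" "t = (B', A', M')"
    by (metis prod_cases3)
  have par: "\<And>v. v \<in> B \<Longrightarrow> odd v" "\<And>v. v \<in> A \<Longrightarrow> even v" "\<And>v. v \<in># M \<Longrightarrow> even v"
    "\<And>v. v \<in> B' \<Longrightarrow> odd v" "\<And>v. v \<in> A' \<Longrightarrow> even v" "\<And>v. v \<in># M' \<Longrightarrow> even v"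
    using s t unfolding st basis_indices_def by blast+
  have L: "of_bool (v \<in> B) + of_bool (v \<in> A) + 2 * count M (2 * v)
      = (of_bool (v \<in> B') + of_bool (v \<in> A') + 2 * count M' (2 * v) :: nat)" for v
    using arg_cong[OF eq, of "\<lambda>m. lookup m v"] s t unfolding st by (simp add: lookup_lead_mon)
  have BA: "v \<in> B \<or> v \<in> A \<longleftrightarrow> v \<in> B' \<or> v \<in> A'" for v
    using arg_cong[OF L[of v], of odd] par(1,2,4,5)[of v] by (auto simp: of_bool_def split: if_splits)
  have "v \<in> B \<longleftrightarrow> v \<in> B'" for v
    using BA[of v] par(1,2,4,5)[of v] by blast
  moreover have "v \<in> A \<longleftrightarrow> v \<in> A'" for v
    using BA[of v] par(1,2,4,5)[of v] by blast
  ultimately have BA': "B = B'" "A = A'" by auto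
  have "count M u = count M' u" for u
  proof (cases "even u")
    case True
    then show ?thesis using L[of "u div 2"] BA' by simp
  next
    case False
    then have "u \<notin># M" "u \<notin># M'" using par(3,6) by blast+
    then show ?thesis by (simp add: not_in_iff)
  qed
  then show ?thesis using BA' st by (auto intro: multiset_eqI)
qed

lemma lead_mon_surj:
  assumes "keys m \<subseteq> {1..}"
  shows "\<exists>s\<in>basis_indices. lead_mon s = m"
proof -
  define B where "B = {j\<in>keys m. odd j \<and> odd (lookup m j)}"
  define A where "A = {j\<in>keys m. even j \<and> odd (lookup m j)}"
  define M where "M = (\<Sum>v\<in>keys m. replicate_mset (lookup m v div 2) (2 * v))"
  have "i \<in># M \<Longrightarrow> even i \<and> i > 0" for i
    using assms by (auto simp: M_def set_mset_sum)
  moreover have "j > 0" if "j \<in> A" for j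
    using that assms by (auto simp: A_def)
  ultimately have s: "(B, A, M) \<in> basis_indices"
    by (auto simp: basis_indices_def B_def A_def)
  have "count M (2 * v) = lookup m v div 2" for v
  proof -
    have "count M (2 * v) = (\<Sum>u\<in>keys m. if u = v then lookup m u div 2 else 0)"
      unfolding M_def count_sum by (intro sum.cong) auto
    then show ?thesis by (simp add: in_keys_iff)
  qed
  moreover have "of_bool (v \<in> B) + of_bool (v \<in> A) = lookup m v mod 2" for v
    by (cases "even v"; cases "even (lookup m v)")
      (auto simp: B_def A_def in_keys_iff odd_iff_mod_2_eq_one intro: Nat.gr0I)
  ultimately have "lookup (lead_mon (B, A, M)) v = lookup m v" for v
    unfolding lookup_lead_mon[OF s] by simp
  then show ?thesis using s by (intro bexI[of _ "(B, A, M)"] poly_mapping_eqI)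
qed

definition wts :: "basis_index \<Rightarrow> nat" where
  "wts = (\<lambda>(B, A, M). \<Sum>B + \<Sum>A + sum_mset M)"

definition lens :: "basis_index \<Rightarrow> nat" where
  "lens = (\<lambda>(B, A, M). card B + card A + 2 * size M)"

lemma lowest_basis_elt:
  assumes "s \<in> basis_indices"
  shows "lowest (wts s) (lens s) (basis_elt s) (Poly_Mapping.single (lead_mon s) 1)"
proof -
  obtain B A M where s: "s = (B, A, M)" by (metis prod_cases3)
  have "lowest (\<Sum>j\<in>B. j) (\<Sum>j\<in>B. 1) (\<Prod>j\<in>B. psum j) (\<Prod>j\<in>B. W j)"
    using assms by (intro lowest_prod)
      (auto simp: s basis_indices_def lowest_def numeral_2_eq_2 odd_pos Suc_leI intro: gr_W
        dest!: bspec intro!: psum_lead[unfolded numeral_2_eq_2] gr_W[unfolded One_nat_def])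
  moreover have "lowest (\<Sum>j\<in>A. j) (\<Sum>j\<in>A. 1) (\<Prod>j\<in>A. W j) (\<Prod>j\<in>A. W j)"
    using assms gr_W by (intro lowest_prod) (auto simp: s basis_indices_def lowest_def)
  moreover have "lowest (\<Sum>i\<in>#M. i) (\<Sum>i\<in>#M. 2) (\<Prod>i\<in>#M. dd (W i)) (\<Prod>i\<in>#M. W (i div 2) ^ 2)"
  proof (rule lowest_prod_mset)
    fix i assume "i \<in># M"
    then have "even i" "i > 0" using assms by (auto simp: s basis_indices_def)
    then obtain k where k: "i = 2 * k" "k \<ge> 1" by (elim evenE) auto
    have "W k * W k \<in> gr (k + k) (1 + 1)"
      by (intro gr_mult gr_W k)
    then show "lowest i 2 (dd (W i)) (W (i div 2) ^ 2)"
      using dd_W_lead[OF k(2)] by (simp add: k(1) lowest_def power2_eq_square numeral_3_eq_3 flip: mult_2)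
  qed
  ultimately have "lowest ((\<Sum>j\<in>B. j) + (\<Sum>j\<in>A. j) + (\<Sum>i\<in>#M. i)) ((\<Sum>j\<in>B. 1) + (\<Sum>j\<in>A. 1) + (\<Sum>i\<in>#M. 2))
      (basis_elt s) (Poly_Mapping.single (lead_mon s) 1)"
    unfolding s single_lead_mon[OF assms[unfolded s]] 
    by (auto simp: basis_elt_def sqf_mon_def intro!: lowest_mult)
  moreover have "(\<Sum>i\<in>#M. 2) = 2 * size M"
    by (induction M) auto
  ultimately show ?thesis
    by (simp add: s wts_def lens_def mult.commute)
qed

lemma wt_lead_mon: "s \<in> basis_indices \<Longrightarrow> wt (lead_mon s) = wts s"
  using lowest_basis_elt[of s] by (simp add: lowest_def gr_def)

lemma len_lead_mon: "s \<in> basis_indices \<Longrightarrow> len (lead_mon s) = lens s"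
proof -
  assume s: "s \<in> basis_indices"
  obtain B A M where BAM: "s = (B, A, M)" by (metis prod_cases3)
  have len_sum: "len (\<Sum>i\<in>X. f i) = (\<Sum>i\<in>X. len (f i))" for X :: "nat set" and f
    by (induction X rule: infinite_finite_induct) auto
  have "len (\<Sum>i\<in>#M. Poly_Mapping.single (i div 2) 2) = 2 * size M" for M :: "nat multiset"
    by (induction M) auto
  then show ?thesis
    by (simp add: BAM lead_mon_def lens_def len_sum)
qed

text \<open>Finite sets of basis elements are coefficient vectors over F_2, and symmetric difference
  is their addition.\<close>

lemma sum_sym_diff_char2:
  fixes f :: "'i \<Rightarrow> 'a::comm_ring_char2"
  assumes "finite S" "finite T"
  shows "sum f (sym_diff S T) = sum f S + sum f T"
proof -
  have "sum f S = sum f (S - T) + sum f (S \<inter> T)" "sum f T = sum f (T - S) + sum f (S \<inter> T)"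
    using assms sum.Int_Diff[of S f T] sum.Int_Diff[of T f S] by (auto simp: ac_simps Int_commute)
  moreover have "sum f (sym_diff S T) = sum f (S - T) + sum f (T - S)"
    using assms by (intro sum.union_disjoint) auto
  ultimately show ?thesis by (simp add: ac_simps)
qed

text \<open>The lowest monomial of an element of least length cannot cancel: the other lowest
  monomials differ from it, and all remaining terms are longer.\<close>

lemma basis_elt_independent:
  assumes T: "finite T" "T \<subseteq> basis_indices" and sum: "(\<Sum>s\<in>T. basis_elt s) = 0"
  shows "T = {}"
proof (rule ccontr)
  assume "T \<noteq> {}"
  then obtain t where t: "t \<in> T" "\<And>s. s \<in> T \<Longrightarrow> lens t \<le> lens s"
    using ex_is_arg_min_if_finite[OF T(1), of lens] by (auto simp: is_arg_min_linorder)
  have "lookup (basis_elt s) (lead_mon t) = (if s = t then 1 else 0)" if s: "s \<in> T" for s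
  proof -
    define r where "r = basis_elt s + Poly_Mapping.single (lead_mon s) 1"
    have "r \<in> gr (wts s) (Suc (lens s))"
      using lowest_basis_elt[of s] s T by (auto simp: r_def lowest_def)
    then have "lead_mon t \<notin> keys r"
      using t s T len_lead_mon[of t] by (fastforce simp: gr_def)
    then have "lookup r (lead_mon t) = 0"
      by (simp add: in_keys_iff)
    moreover have "basis_elt s = r + Poly_Mapping.single (lead_mon s) 1"
      by (simp add: r_def add.assoc)
    ultimately have "lookup (basis_elt s) (lead_mon t) = (if lead_mon s = lead_mon t then 1 else 0)"
      by (simp add: lookup_add lookup_single when_def)
    then show ?thesis
      using lead_mon_inj[of s t] s t T by auto
  qed
  then have "lookup (\<Sum>s\<in>T. basis_elt s) (lead_mon t) = (\<Sum>s\<in>T. if s = t then 1 else 0)"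
    unfolding lookup_sum by (intro sum.cong) auto
  then show False
    using sum t T by simp
qed

lemma basis_support_sum:
  assumes T: "finite T" "T \<subseteq> basis_indices"
  shows "basis_support (\<Sum>s\<in>T. basis_elt s) = T"
  unfolding basis_support_def
proof (rule the_equality)
  fix S assume S: "finite S \<and> S \<subseteq> basis_indices \<and> (\<Sum>s\<in>S. basis_elt s) = (\<Sum>s\<in>T. basis_elt s)"
  then have "(\<Sum>s\<in>sym_diff S T. basis_elt s) = 0"
    using T by (simp add: sum_sym_diff_char2)
  then have "sym_diff S T = {}"
    using S T by (intro basis_elt_independent) auto
  then show "S = T" by auto
qed (use T in auto)

text \<open>The bound on the weight is carried along because the later inductions need expansions
  that do not raise it.\<close>

definition basis_span :: "nat \<Rightarrow> nat mpoly2 set" where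
  "basis_span d = {\<Sum>s\<in>T. basis_elt s | T. finite T \<and> T \<subseteq> {s \<in> basis_indices. wts s \<le> d}}"

lemma basis_span_add: "f \<in> basis_span d \<Longrightarrow> g \<in> basis_span d \<Longrightarrow> f + g \<in> basis_span d"
proof -
  assume "f \<in> basis_span d" "g \<in> basis_span d"
  then obtain S T where ST: "finite S" "S \<subseteq> {s \<in> basis_indices. wts s \<le> d}" "f = sum basis_elt S"
      "finite T" "T \<subseteq> {s \<in> basis_indices. wts s \<le> d}" "g = sum basis_elt T"
    unfolding basis_span_def by blast
  then have "f + g = sum basis_elt (sym_diff S T)"
    by (simp add: sum_sym_diff_char2)
  moreover have "finite (sym_diff S T)" "sym_diff S T \<subseteq> {s \<in> basis_indices. wts s \<le> d}"
    using ST by auto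
  ultimately show ?thesis
    unfolding basis_span_def by blast
qed

lemma basis_span_0: "0 \<in> basis_span d"
  unfolding basis_span_def by (intro CollectI exI[of _ "{}"]) auto

lemma basis_span_sum: "(\<And>i. i \<in> A \<Longrightarrow> f i \<in> basis_span d) \<Longrightarrow> sum f A \<in> basis_span d"
  by (induction A rule: infinite_finite_induct) (auto intro: basis_span_0 basis_span_add)

text \<open>Subtracting the basis element with lowest monomial \<open>m\<close> leaves monomials of
  the same weight and greater length, and the length is bounded by the weight.\<close>

lemma single_in_basis_span:
  assumes "keys m \<subseteq> {1..}" "wt m \<le> d"
  shows "Poly_Mapping.single m 1 \<in> basis_span d"
  using assms
proof (induction "wt m - len m" arbitrary: m rule: less_induct)
  case less
  obtain s where s: "s \<in> basis_indices" "lead_mon s = m"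
    using lead_mon_surj less.prems by blast
  define r where "r = basis_elt s + Poly_Mapping.single m 1"
  have r: "r \<in> gr (wt m) (Suc (len m))"
    using lowest_basis_elt[OF s(1)] wt_lead_mon[OF s(1)] len_lead_mon[OF s(1)] s(2)
    by (simp add: lowest_def r_def)
  have "Poly_Mapping.single m' 1 \<in> basis_span d" if "m' \<in> keys r" for m'
  proof (rule less.hyps)
    have m': "keys m' \<subseteq> {1..}" "wt m' = wt m" "len m < len m'"
      using r that by (auto simp: gr_def)
    then show "keys m' \<subseteq> {1..}" "wt m' \<le> d" "wt m' - len m' < wt m - len m"
      using len_le_wt[OF m'(1)] less.prems by auto
  qed
  then have "r \<in> basis_span d"
    by (subst mpoly2_sum_keys) (rule basis_span_sum)
  moreover have "basis_elt s \<in> basis_span d"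
    unfolding basis_span_def using s less.prems wt_lead_mon[of s] 
    by (intro CollectI exI[of _ "{s}"]) auto
  moreover have "Poly_Mapping.single m 1 = basis_elt s + r"
    by (simp add: r_def)
  ultimately show ?case
    by (simp add: basis_span_add)
qed

section \<open>The weight filtration of R\<close>

definition wF :: "nat \<Rightarrow> wpoly set" where
  "wF d = {x. \<forall>m\<in>keys (Rep_wpoly x). wt m \<le> d}"

definition belt :: "basis_index \<Rightarrow> wpoly" where
  "belt = (\<lambda>(B, A, M). pmon B * (\<Prod>i\<in>A. w i) * (\<Prod>i\<in>#M. tr (w i)))"

lemma Rep_belt: "Rep_wpoly (belt s) = basis_elt s"
proof -
  have "Rep_wpoly (prod_mset N) = prod_mset (image_mset Rep_wpoly N)" for N
    by (induction N) auto
  then show ?thesis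
    by (cases s) (simp add: belt_def basis_elt_def pmon_def sqf_mon_def pw.rep_eq w.rep_eq Rep_tr
        image_mset.compositionality comp_def)
qed

lemma wF_basis:
  assumes "x \<in> wF d"
  shows "\<exists>T. finite T \<and> T \<subseteq> {s \<in> basis_indices. wts s \<le> d} \<and> x = (\<Sum>s\<in>T. belt s)"
proof -
  have "Poly_Mapping.single m 1 \<in> basis_span d" if "m \<in> keys (Rep_wpoly x)" for m
    using that assms Rep_wpoly[of x]
    by (intro single_in_basis_span) (auto simp: wF_def poly_ring_simps(1) simp del: One_nat_def)
  then have "Rep_wpoly x \<in> basis_span d"
    by (subst mpoly2_sum_keys) (rule basis_span_sum)
  then obtain T where "finite T" "T \<subseteq> {s \<in> basis_indices. wts s \<le> d}" "Rep_wpoly x = (\<Sum>s\<in>T. basis_elt s)"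
    unfolding basis_span_def by blast
  then show ?thesis
    by (intro exI[of _ T]) (simp add: Rep_belt flip: Rep_wpoly_inject)
qed

lemma wF_ex: "\<exists>d. x \<in> wF d"
proof -
  have "\<forall>m\<in>keys (Rep_wpoly x). wt m \<le> (\<Sum>m\<in>keys (Rep_wpoly x). wt m)"
    by (auto intro: member_le_sum)
  then show ?thesis by (auto simp: wF_def)
qed

lemma wF_mono: "d \<le> d' \<Longrightarrow> x \<in> wF d \<Longrightarrow> x \<in> wF d'"
  by (force simp: wF_def)

lemma wF_0 [simp]: "0 \<in> wF d"
  by (simp add: wF_def)

lemma wF_1 [simp]: "1 \<in> wF d"
  by (simp add: wF_def)

lemma wF_add: "x \<in> wF d \<Longrightarrow> y \<in> wF d \<Longrightarrow> x + y \<in> wF d"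
  using Poly_Mapping.keys_add[of "Rep_wpoly x" "Rep_wpoly y"] by (auto simp: wF_def)

lemma wF_mult: "x \<in> wF d \<Longrightarrow> y \<in> wF d' \<Longrightarrow> x * y \<in> wF (d + d')"
  using keys_mult[of "Rep_wpoly x" "Rep_wpoly y"] by (fastforce simp: wF_def)

lemma wF_mult_le: "x \<in> wF d \<Longrightarrow> y \<in> wF d' \<Longrightarrow> d + d' \<le> e \<Longrightarrow> x * y \<in> wF e"
  using wF_mult wF_mono by blast

lemma wF_w: "w k \<in> wF k"
  by (cases "k = 0") (auto simp: wF_def w.rep_eq W_def Var_def)

lemma wF_wbar: "wbar k \<in> wF k"
  using gr_W_bar[of k] by (cases "k = 0") (auto simp: wF_def wbar.rep_eq gr_def)

lemma wF_pw: "pw k \<in> wF k"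
  using gr_psum[of k] by (cases "k = 0") (auto simp: wF_def pw.rep_eq gr_def)

lemma wF_belt: "s \<in> basis_indices \<Longrightarrow> belt s \<in> wF (wts s)"
proof -
  assume s: "s \<in> basis_indices"
  have "basis_elt s + Poly_Mapping.single (lead_mon s) 1 + Poly_Mapping.single (lead_mon s) 1 \<in> gr (wts s) (lens s)"
    using lowest_basis_elt[OF s] gr_mono[of "lens s" "Suc (lens s)" "wts s"]
    unfolding lowest_def by (intro gr_add[of "basis_elt s + _"]) auto
  then show ?thesis
    by (auto simp: wF_def Rep_belt gr_def add.assoc)
qed

lemma wF_bar:
  assumes "x \<in> wF d"
  shows "bar x \<in> wF d"
proof -
  have pow: "(\<forall>k\<in>keys f. wt k \<le> a) \<Longrightarrow> \<forall>k\<in>keys (f ^ j). wt k \<le> a * j" for f :: "nat mpoly2" and a j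
  proof (induction j)
    case (Suc j)
    then show ?case
      using keys_mult[of f "f ^ j"] by (fastforce intro: add_mono)
  qed simp
  have prod: "\<forall>k\<in>keys (\<Prod>v\<in>A. f v). wt k \<le> (\<Sum>v\<in>A. a v)" if "\<And>v. v \<in> A \<Longrightarrow> \<forall>k\<in>keys (f v). wt k \<le> a v"
    for A :: "nat set" and f :: "nat \<Rightarrow> nat mpoly2" and a
    using that
  proof (induction A rule: infinite_finite_induct)
    case (insert v A)
    then show ?case
      using keys_mult[of "f v" "\<Prod>v\<in>A. f v"] by (fastforce intro: add_mono)
  qed auto
  have sum: "\<forall>k\<in>keys (\<Sum>i\<in>A. f i). wt k \<le> d" if "\<And>i. i \<in> A \<Longrightarrow> \<forall>k\<in>keys (f i). wt k \<le> d"
    for A :: "(nat \<Rightarrow>\<^sub>0 nat) set" and f :: "(nat \<Rightarrow>\<^sub>0 nat) \<Rightarrow> nat mpoly2"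
    using that
  proof (induction A rule: infinite_finite_induct)
    case (insert i A)
    then show ?case
      using Poly_Mapping.keys_add[of "f i" "sum f A"] by fastforce
  qed auto
  have "\<forall>k\<in>keys (W_bar v). wt k \<le> v" for v
    using wF_wbar[of v] by (simp add: wF_def wbar.rep_eq)
  then have "\<forall>k\<in>keys (\<Prod>v\<in>keys m. W_bar v ^ lookup m v). wt k \<le> d" if "m \<in> keys (Rep_wpoly x)" for m
    using assms that prod[of "keys m" "\<lambda>v. W_bar v ^ lookup m v" "\<lambda>v. v * lookup m v"] pow
    by (fastforce simp: wF_def wt_def)
  then show ?thesis
    unfolding wF_def mem_Collect_eq bar.rep_eq omega_def poly_subst_def by (rule sum)
qed

lemma wF_tr: "x \<in> wF d \<Longrightarrow> tr x \<in> wF d"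
  unfolding tr_def by (intro wF_add wF_bar)

section \<open>The operator delta modulo the relations\<close>

text \<open>The ideal in the polynomial ring on all symbols, where spans are available;
  \<open>genideal_poly_ring\<close> returns to the symbols in \<open>gens n\<close>.\<close>

definition rel_idl :: "nat \<Rightarrow> gen mpoly2 set" where
  "rel_idl n = idl (rels1 n \<union> rels2 n \<union> rels3 n)"

definition dl :: "nat \<Rightarrow> wpoly \<Rightarrow> gen mpoly2" where
  "dl n x = delta n (Rep_wpoly x)"

definition wset :: "nat set \<Rightarrow> wpoly" where
  "wset A = (\<Prod>i\<in>A. w i)"

definition eset :: "nat set \<Rightarrow> bool" where
  "eset A \<longleftrightarrow> finite A \<and> (\<forall>i\<in>A. even i \<and> i > 0)"

definition dw :: "nat \<Rightarrow> nat \<Rightarrow> gen mpoly2" where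
  "dw n i = delta_gen n {i}"

lemma basis_indices_iff:
  "(B, A, M) \<in> basis_indices \<longleftrightarrow> finite B \<and> (\<forall>j\<in>B. odd j) \<and> eset A \<and> (\<forall>i\<in>#M. even i \<and> i > 0)"
  by (auto simp: basis_indices_def eset_def)

lemma eset_subset: "eset A \<Longrightarrow> C \<subseteq> A \<Longrightarrow> eset C"
  unfolding eset_def by (meson finite_subset subsetD)

lemma eset_evens: "A \<subseteq> evens n \<Longrightarrow> eset A"
  by (auto simp: eset_def evens_def intro: finite_subset[of _ "{..n}"])

lemma eset_subset_evens_iff: "eset A \<Longrightarrow> A \<subseteq> evens n \<longleftrightarrow> (\<forall>i\<in>A. i \<le> n)"
  by (fastforce simp: eset_def evens_def elim!: evenE)

lemma wset_empty [simp]: "wset {} = 1"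
  by (simp add: wset_def)

lemma wset_singleton [simp]: "wset {i} = w i"
  by (simp add: wset_def)

lemma wset_insert: "finite A \<Longrightarrow> i \<notin> A \<Longrightarrow> wset (insert i A) = w i * wset A"
  by (simp add: wset_def)

lemma wset_remove: "finite A \<Longrightarrow> i \<in> A \<Longrightarrow> wset A = w i * wset (A - {i})"
  by (simp add: wset_def prod.remove)

lemma Rep_wset: "Rep_wpoly (wset A) = sqf_mon A"
  by (simp add: wset_def sqf_mon_def w.rep_eq)

lemma wF_wset: "wset A \<in> wF (\<Sum>A)"
  unfolding wset_def
  by (induction A rule: infinite_finite_induct) (auto intro: wF_mult wF_w)

lemma belt_wset: "eset A \<Longrightarrow> wset A = belt ({}, A, {#})"
  by (simp add: belt_def wset_def pmon_def)

lemma belt_pw: "finite B \<Longrightarrow> j \<in> B \<Longrightarrow> belt (B, A, M) = pw j * belt (B - {j}, A, M)"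
  by (simp add: belt_def pmon_def prod.remove[of B j] mult.assoc)

lemma belt_tr: "belt (B, A, add_mset i M) = tr (w i) * belt (B, A, M)"
  by (simp add: belt_def ac_simps)

lemma belt_split: "belt (B, A, M) = belt (B, {}, M) * wset A"
  by (simp add: belt_def wset_def ac_simps)

lemma bar_belt_empty: "bar (belt (B, {}, M)) = belt (B, {}, M)"
proof -
  have "bar (\<Prod>i\<in>#M. tr (w i)) = (\<Prod>i\<in>#M. tr (w i))"
    by (induction M) auto
  then show ?thesis by (simp add: belt_def)
qed

lemma tr_belt: "tr (belt (B, A, M)) = belt (B, {}, M) * tr (wset A)"
  by (subst belt_split) (simp add: tr_mult_invariant bar_belt_empty)

lemma basis_support_belt:
  assumes "finite T" "T \<subseteq> basis_indices"
  shows "basis_support (Rep_wpoly (\<Sum>s\<in>T. belt s)) = T"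
  using basis_support_sum[OF assms] by (simp add: Rep_belt)

lemma dl_sum_belt:
  assumes "finite T" "T \<subseteq> basis_indices"
  shows "dl n (\<Sum>s\<in>T. belt s) = (\<Sum>s\<in>T. delta_basis n s)"
  by (simp only: dl_def delta_def basis_support_belt[OF assms])

lemma ex_belt: "\<exists>T. finite T \<and> T \<subseteq> basis_indices \<and> x = (\<Sum>s\<in>T. belt s)"
proof -
  obtain d where "x \<in> wF d" using wF_ex by blast
  from wF_basis[OF this] obtain T
    where "finite T" "T \<subseteq> {s \<in> basis_indices. wts s \<le> d}" "x = (\<Sum>s\<in>T. belt s)"
    by blast
  then show ?thesis by (intro exI[of _ T]) auto
qed

lemma dl_add: "dl n (x + y) = dl n x + dl n y"
proof -
  obtain S where S: "finite S" "S \<subseteq> basis_indices" "x = (\<Sum>s\<in>S. belt s)"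
    using ex_belt[of x] by blast
  obtain T where T: "finite T" "T \<subseteq> basis_indices" "y = (\<Sum>s\<in>T. belt s)"
    using ex_belt[of y] by blast
  have "x + y = (\<Sum>s\<in>sym_diff S T. belt s)"
    using S T by (simp add: sum_sym_diff_char2)
  also have "dl n \<dots> = (\<Sum>s\<in>sym_diff S T. delta_basis n s)"
    using S T by (intro dl_sum_belt) auto
  also have "\<dots> = dl n x + dl n y"
    using S T by (simp add: dl_sum_belt sum_sym_diff_char2)
  finally show ?thesis .
qed

lemma dl_0 [simp]: "dl n 0 = 0"
  using dl_sum_belt[of "{}" n] by simp

lemma dl_sum: "dl n (\<Sum>i\<in>A. f i) = (\<Sum>i\<in>A. dl n (f i))"
  by (induction A rule: infinite_finite_induct) (auto simp: dl_add)

lemma dl_belt: "s \<in> basis_indices \<Longrightarrow> dl n (belt s) = delta_basis n s"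
  using dl_sum_belt[of "{s}" n] by simp

lemma dl_wset: "eset A \<Longrightarrow> dl n (wset A) = delta_gen n A"
  by (simp add: belt_wset dl_belt basis_indices_iff delta_basis_def)

lemma dl_1 [simp]: "dl n 1 = 0"
  using dl_wset[of "{}" n] by (simp add: eset_def delta_gen_def)

lemma dl_w: "even i \<Longrightarrow> i > 0 \<Longrightarrow> dl n (w i) = dw n i"
  using dl_wset[of "{i}" n] by (simp add: eset_def wset_def dw_def)

lemma dw_eq_0: "i > n \<Longrightarrow> dw n i = 0"
  by (auto simp: dw_def delta_gen_def evens_def)

lemma delta_gen_eq_0: "i \<in> A \<Longrightarrow> i > n \<Longrightarrow> delta_gen n A = 0"
  by (auto simp: delta_gen_def evens_def)

lemma wF_induct [consumes 1, case_names zero add belt]: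
  assumes x: "x \<in> wF d" and "Q 0" "\<And>x y. Q x \<Longrightarrow> Q y \<Longrightarrow> Q (x + y)"
    and "\<And>B A M. (B, A, M) \<in> basis_indices \<Longrightarrow> wts (B, A, M) \<le> d \<Longrightarrow> Q (belt (B, A, M))"
  shows "Q x"
proof -
  obtain T where "finite T" "T \<subseteq> {s \<in> basis_indices. wts s \<le> d}" "x = (\<Sum>s\<in>T. belt s)"
    using wF_basis[OF x] by blast
  moreover have "Q (\<Sum>s\<in>T. belt s)" if "finite T" "T \<subseteq> {s \<in> basis_indices. wts s \<le> d}" for T
    using that
  proof (induction T)
    case (insert s T)
    then show ?case using assms by (cases s) auto
  qed (simp add: assms)
  ultimately show ?thesis by simp
qed

text \<open>Exact, not only modulo the relations: multiplication by \<open>tr (w i)\<close> maps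
  basis elements to basis elements by enlarging the multiset.\<close>

lemma dl_tr_w:
  assumes "even i" "i > 0"
  shows "dl n (tr (w i) * x) = dw n i * dl n x"
proof -
  obtain d where "x \<in> wF d" using wF_ex by blast
  then show ?thesis
  proof (induction rule: wF_induct)
    case (belt B A M)
    then have "(B, A, add_mset i M) \<in> basis_indices"
      using assms by (auto simp: basis_indices_iff)
    then show ?case
      using belt by (simp add: dl_belt delta_basis_def dw_def ac_simps flip: belt_tr)
  qed (simp_all add: dl_add distrib_left)
qed

lemma dl_tr_w_mset:
  assumes "\<forall>i\<in>#M. even i \<and> i > 0"
  shows "dl n ((\<Prod>i\<in>#M. tr (w i)) * x) = (\<Prod>i\<in>#M. dw n i) * dl n x"
  using assms by (induction M) (auto simp: mult.assoc dl_tr_w)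

lemma dl_tr_w_prod:
  assumes "eset A"
  shows "dl n ((\<Prod>i\<in>A. tr (w i)) * x) = (\<Prod>i\<in>A. dw n i) * dl n x"
proof -
  have "finite A" using assms by (simp add: eset_def)
  then show ?thesis using assms
    by (induction A) (auto simp: eset_def mult.assoc dl_tr_w)
qed

text \<open>Exact as well, since the product is again a basis element. For j in B a square arises,
  which only relation (1) can remove.\<close>

lemma dl_pw_belt:
  assumes "(B, A, M) \<in> basis_indices" "odd j" "j \<notin> B"
  shows "dl n (pw j * belt (B, A, M)) = p_gen n j * dl n (belt (B, A, M))"
proof -
  have B: "finite B" using assms by (simp add: basis_indices_iff)
  have "(insert j B, A, M) \<in> basis_indices"
    using assms by (auto simp: basis_indices_iff)
  moreover have "pw j * belt (B, A, M) = belt (insert j B, A, M)"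
    using B assms(3) by (subst belt_pw[of "insert j B" j]) auto
  ultimately show ?thesis
    using assms B by (simp add: dl_belt delta_basis_def mult.assoc)
qed

lemma wts_simps: "wts (B, A, M) = \<Sum>B + \<Sum>A + sum_mset M"
  by (simp add: wts_def)

text \<open>Expansion of the product of the \<open>w i + tr (w i)\<close>; the term for C = A
  cancels.\<close>

lemma tr_wset:
  assumes "finite A"
  shows "tr (wset A) = (\<Sum>C\<in>Pow A - {A}. (\<Prod>i\<in>A - C. tr (w i)) * wset C)"
proof -
  have "bar (wset A) = (\<Prod>i\<in>A. w i + tr (w i))"
    by (simp add: wset_def tr_def)
  also have "\<dots> = (\<Sum>C\<in>Pow A. (\<Prod>i\<in>C. w i) * (\<Prod>i\<in>A - C. tr (w i)))"
    using assms by (rule prod_add)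
  also have "\<dots> = wset A + (\<Sum>C\<in>Pow A - {A}. (\<Prod>i\<in>C. w i) * (\<Prod>i\<in>A - C. tr (w i)))"
    using assms by (subst sum.remove[of _ A]) (auto simp: wset_def)
  finally show ?thesis
    by (simp add: tr_def wset_def mult.commute)
qed

text \<open>The sets C are proper subsets of A, so their monomials have smaller weight. This is what
  makes induction on the weight possible.\<close>

lemma dl_tr_wset:
  assumes "eset A"
  shows "dl n (x * tr (wset A)) = (\<Sum>C\<in>Pow A - {A}. (\<Prod>i\<in>A - C. dw n i) * dl n (x * wset C))"
proof -
  have "x * tr (wset A) = (\<Sum>C\<in>Pow A - {A}. (\<Prod>i\<in>A - C. tr (w i)) * (x * wset C))"
    using assms by (simp add: tr_wset eset_def sum_distrib_left mult.left_commute)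
  then show ?thesis
    using assms by (simp add: dl_sum dl_tr_w_prod eset_subset)
qed

lemma sum_psubset_less:
  assumes "eset A" "C \<in> Pow A - {A}"
  shows "\<Sum>C < \<Sum>A"
proof -
  have "finite A" using assms by (simp add: eset_def)
  moreover obtain b where "b \<in> A - C" using assms by blast
  ultimately show ?thesis
    using assms by (intro sum_strict_mono2[of A C b]) (auto simp: eset_def)
qed

section \<open>Simultaneous induction on the weight for the claims about delta\<close>

context
  fixes n :: nat
begin

definition eqv :: "gen mpoly2 \<Rightarrow> gen mpoly2 \<Rightarrow> bool" (infix "\<doteq>" 50) where
  "f \<doteq> g \<longleftrightarrow> f + g \<in> rel_idl n"

lemma eqv_refl [simp, intro]: "f \<doteq> f"
  by (simp add: eqv_def rel_idl_def)

lemma eqv_sym: "f \<doteq> g \<Longrightarrow> g \<doteq> f"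
  by (simp add: eqv_def add.commute)

lemma eqv_trans [trans]: "f \<doteq> g \<Longrightarrow> g \<doteq> h \<Longrightarrow> f \<doteq> h"
  unfolding eqv_def rel_idl_def by (rule idl_trans)

lemma eq_eqv_trans [trans]: "f = g \<Longrightarrow> g \<doteq> h \<Longrightarrow> f \<doteq> h"
  and eqv_eq_trans [trans]: "f \<doteq> g \<Longrightarrow> g = h \<Longrightarrow> f \<doteq> h"
  by simp_all

lemma eqv_add: "f \<doteq> g \<Longrightarrow> f' \<doteq> g' \<Longrightarrow> f + f' \<doteq> g + g'"
  unfolding eqv_def rel_idl_def using idl_add[of "f + g" _ "f' + g'"] by (simp add: ac_simps)

lemma eqv_mult_left: "f \<doteq> g \<Longrightarrow> h * f \<doteq> h * g"
  unfolding eqv_def rel_idl_def by (simp add: idl_mult flip: distrib_left)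

lemma eqv_mult_right: "f \<doteq> g \<Longrightarrow> f * h \<doteq> g * h"
  unfolding eqv_def rel_idl_def by (simp add: idl_mult flip: distrib_right)

lemma eqv_sum: "(\<And>i. i \<in> A \<Longrightarrow> f i \<doteq> g i) \<Longrightarrow> (\<Sum>i\<in>A. f i) \<doteq> (\<Sum>i\<in>A. g i)"
  by (induction A rule: infinite_finite_induct) (auto intro: eqv_add)

lemma eqv_sum_0: "(\<And>i. i \<in> A \<Longrightarrow> f i \<doteq> 0) \<Longrightarrow> (\<Sum>i\<in>A. f i) \<doteq> 0"
  using eqv_sum[of A f "\<lambda>_. 0"] by simp

lemma eqv_add_0: "f \<doteq> 0 \<Longrightarrow> f' \<doteq> 0 \<Longrightarrow> f + f' \<doteq> 0"
  using eqv_add[of f 0 f' 0] by simp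

lemma eqv_mult_0: "f \<doteq> 0 \<Longrightarrow> h * f \<doteq> 0"
  using eqv_mult_left[of f 0 h] by simp

text \<open>The basis elements that \<open>delta\<close> reads as zero do not span an ideal of R, since the square of a
  variable beyond the range may involve powers of small ones. So the ideal of the Grassmannian is
  annihilated only modulo the relations, and the next three statements have to be proved together,
  by induction on the weight.\<close>

definition ann_upto :: "nat \<Rightarrow> bool" where
  "ann_upto d \<longleftrightarrow> (\<forall>m r. n < m \<longrightarrow> m \<le> d \<longrightarrow> r \<in> wF (d - m) \<longrightarrow> dl n (r * w m) \<doteq> 0)"

definition pw_upto :: "nat \<Rightarrow> bool" where
  "pw_upto d \<longleftrightarrow> (\<forall>j x. odd j \<longrightarrow> j \<le> d \<longrightarrow> x \<in> wF (d - j) \<longrightarrow>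
      dl n (pw j * x) \<doteq> p_gen n j * dl n x)"

definition tr_upto :: "nat \<Rightarrow> bool" where
  "tr_upto d \<longleftrightarrow> (\<forall>A x. eset A \<longrightarrow> \<Sum>A \<le> d \<longrightarrow> x \<in> wF (d - \<Sum>A) \<longrightarrow>
      dl n (x * tr (wset A)) \<doteq> dl n x * dl n (wset A))"

lemma ann_uptoD:
  "ann_upto d \<Longrightarrow> n < m \<Longrightarrow> r \<in> wF f \<Longrightarrow> f + m \<le> d \<Longrightarrow> dl n (r * w m) \<doteq> 0"
  using wF_mono[of f "d - m" r] unfolding ann_upto_def by simp

lemma pw_uptoD:
  "pw_upto d \<Longrightarrow> odd j \<Longrightarrow> x \<in> wF f \<Longrightarrow> f + j \<le> d \<Longrightarrow> dl n (pw j * x) \<doteq> p_gen n j * dl n x"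
  using wF_mono[of f "d - j" x] unfolding pw_upto_def by simp

lemma tr_uptoD:
  "tr_upto d \<Longrightarrow> eset A \<Longrightarrow> x \<in> wF f \<Longrightarrow> f + \<Sum>A \<le> d \<Longrightarrow>
    dl n (x * tr (wset A)) \<doteq> dl n x * dl n (wset A)"
  using wF_mono[of f "d - \<Sum>A" x] unfolding tr_upto_def by simp

text \<open>Power sums come out by the induction hypothesis and the \<open>tr (w i)\<close> exactly,
  so that only a square-free monomial in even variables is left in front of
  \<open>y\<close>.\<close>

lemma dl_belt_mult:
  assumes pw: "pw_upto e" and s: "(B, A, M) \<in> basis_indices"
    and y: "y \<in> wF f" "wts (B, A, M) + f \<le> e"
  shows "dl n (belt (B, A, M) * y)
    \<doteq> (\<Prod>j\<in>B. p_gen n j) * (\<Prod>i\<in>#M. dw n i) * dl n (wset A * y)"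
proof -
  have "dl n (pmon B * z) \<doteq> (\<Prod>j\<in>B. p_gen n j) * dl n z"
    if "finite B" "\<forall>j\<in>B. odd j" "z \<in> wF g" "\<Sum>B + g \<le> e" for B z g
    using that
  proof (induction B)
    case (insert j B)
    have pB: "pmon B \<in> wF (\<Sum>B)"
      unfolding pmon_def using insert.hyps(1)
      by (induction B) (auto intro: wF_mult wF_pw)
    have "dl n (pmon (insert j B) * z) = dl n (pw j * (pmon B * z))"
      using insert.hyps by (simp add: pmon_insert mult.assoc)
    also have "\<dots> \<doteq> p_gen n j * dl n (pmon B * z)"
      using insert by (intro pw_uptoD[OF pw _ wF_mult[OF pB insert.prems(2)]]) auto
    also have "\<dots> \<doteq> p_gen n j * ((\<Prod>j\<in>B. p_gen n j) * dl n z)"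
      using insert by (intro eqv_mult_left insert.IH) auto
    finally show ?case
      using insert.hyps by (simp add: mult.assoc)
  qed (simp add: pmon_def)
  moreover have M: "(\<Prod>i\<in>#M. tr (w i)) \<in> wF (sum_mset M)"
    by (induction M) (auto intro: wF_mult wF_tr wF_w)
  have "(\<Prod>i\<in>#M. tr (w i)) * (wset A * y) \<in> wF (sum_mset M + (\<Sum>A + f))"
    by (intro wF_mult M wF_wset y)
  ultimately have "dl n (pmon B * ((\<Prod>i\<in>#M. tr (w i)) * (wset A * y)))
      \<doteq> (\<Prod>j\<in>B. p_gen n j) * dl n ((\<Prod>i\<in>#M. tr (w i)) * (wset A * y))"
    using s y by (auto simp: basis_indices_iff wts_simps)
  then show ?thesis
    using s dl_tr_w_mset[of M n "wset A * y"]
    by (simp add: belt_def wset_def basis_indices_iff ac_simps)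
qed

lemma rels2_eqv:
  assumes "A \<subseteq> evens n" "B \<subseteq> evens n" "C \<subseteq> evens n"
  shows "dl n (wset B * wset C) * dl n (wset A)
     \<doteq> dl n (wset A * wset C) * dl n (wset B) + dl n (wset A * wset B) * dl n (wset C)
       + dl n (wset A) * dl n (wset B) * dl n (wset C)"
proof -
  have "delta n (sqf_mon B * sqf_mon C) * delta n (sqf_mon A) + delta n (sqf_mon A * sqf_mon C) * delta n (sqf_mon B)
      + delta n (sqf_mon A * sqf_mon B) * delta n (sqf_mon C)
      - delta n (sqf_mon A) * delta n (sqf_mon B) * delta n (sqf_mon C) \<in> rels2 n"
    using assms unfolding rels2_def sqf_mons_def by blast
  then show ?thesis
    unfolding eqv_def rel_idl_def by (intro idl_base) (simp add: dl_def Rep_wset add.assoc)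
qed

text \<open>Expanding \<open>tr (wset A)\<close> into smaller monomials reduces \<open>x\<close> to
  a square-free monomial \<open>wset A0\<close>. If a variable beyond n occurs, both sides vanish.
  Otherwise one factor of A is split off by the twisted product rule, and relation (2) reassembles
  the result.\<close>

lemma tr_upto_step:
  assumes ann: "\<And>e. e < d \<Longrightarrow> ann_upto e" and pw: "\<And>e. e < d \<Longrightarrow> pw_upto e"
  shows "tr_upto d"
proof -
  have zero: "dl n (r * wset C) \<doteq> 0"
    if "eset C" "b \<in> C" "b > n" "r \<in> wF g" "g + \<Sum>C < d" for C b r g
  proof -
    have fin: "finite C" using that by (simp add: eset_def)
    have "\<Sum>C = b + \<Sum>(C - {b})"
      using fin that by (simp add: sum.remove)
    moreover have "r * wset (C - {b}) \<in> wF (g + \<Sum>(C - {b}))"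
      by (intro wF_mult that wF_wset)
    ultimately have "dl n (r * wset (C - {b}) * w b) \<doteq> 0"
      using that by (intro ann_uptoD[OF ann[of "g + \<Sum>C"]]) auto
    then show ?thesis
      using that fin by (simp add: wset_remove[of C b] ac_simps)
  qed
  have main: "dl n (x * tr (wset A)) \<doteq> dl n x * dl n (wset A)"
    if "eset A" "\<Sum>A \<le> d" "x \<in> wF (d - \<Sum>A)" for A x
    using that
  proof (induction "card A" arbitrary: A x rule: less_induct)
    case less
    note A = less.prems(1,2)
    have finA: "finite A" using A by (simp add: eset_def)
    show ?case
      using less.prems(3)
    proof (induction rule: wF_induct)
      case (add x y)
      from eqv_add[OF this] show ?case
        by (simp add: distrib_right dl_add)
    next
      case (belt B A0 M)
      define K where "K = (\<Prod>j\<in>B. p_gen n j) * (\<Prod>i\<in>#M. dw n i)"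
      have A0: "eset A0" using belt by (simp add: basis_indices_iff)
      then have finA0: "finite A0" by (simp add: eset_def)
      have wts: "\<Sum>A0 + \<Sum>A \<le> d" "wts (B, A0, M) + \<Sum>A \<le> d"
        using belt A by (auto simp: wts_simps)
      have dl: "dl n (belt (B, A0, M)) = K * dl n (wset A0)"
        using belt A0 by (simp add: dl_belt dl_wset delta_basis_def K_def dw_def ac_simps)
      have small: "dl n (wset A0 * tr (wset A)) \<doteq> dl n (wset A0) * dl n (wset A)"
      proof (cases "A0 \<subseteq> evens n \<and> A \<subseteq> evens n")
        case False
        then obtain b where b: "b > n" "b \<in> A0 \<or> b \<in> A"
          using A0 A by (auto simp: eset_subset_evens_iff not_le)
        have "dl n (wset A0) * dl n (wset A) = 0"
          using b A0 A delta_gen_eq_0[of b A0 n] delta_gen_eq_0[of b A n] by (auto simp: dl_wset)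
        moreover have "(\<Prod>i\<in>A - C. dw n i) * dl n (wset A0 * wset C) \<doteq> 0" if C: "C \<in> Pow A - {A}" for C
        proof -
          have eC: "eset C" using C A eset_subset by auto
          have wC: "\<Sum>C < \<Sum>A" using sum_psubset_less A C by blast
          consider "b \<in> A0" | "b \<in> C" | "b \<in> A - C" using b C by blast
          then show ?thesis
          proof cases
            case 1
            have "dl n (wset C * wset A0) \<doteq> 0"
              using zero[OF A0 1 b(1) wF_wset[of C]] wC wts by simp
            then show ?thesis by (intro eqv_mult_0) (simp add: mult.commute)
          next
            case 2
            then show ?thesis
              using zero[OF eC 2 b(1) wF_wset[of A0]] wC wts by (intro eqv_mult_0) simp
          next
            case 3
            then have "(\<Prod>i\<in>A - C. dw n i) = 0"
              using finA dw_eq_0[OF b(1)] by (intro prod_zero) auto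
            then show ?thesis by simp
          qed
        qed
        ultimately show ?thesis
          unfolding dl_tr_wset[OF A(1)] by (simp only: eqv_sum_0)
      next
        case True
        show ?thesis
        proof (cases "A = {}")
          case False
          then obtain c where c: "c \<in> A" by blast
          define A' where "A' = A - {c}"
          have eA': "eset A'" using A eset_subset by (auto simp: A'_def)
          have card: "card A' < card A" 
            using c finA by (simp add: A'_def card_Diff1_less del: card_Diff_singleton card_Diff_insert)
          have sA: "\<Sum>A = c + \<Sum>A'" using c finA by (simp add: A'_def sum.remove)
          have wA: "wset A = w c * wset A'" using c finA by (simp add: A'_def wset_remove)
          have ec: "even c" "c > 0" using A c by (auto simp: eset_def)
          let ?x = "wset A0" and ?y = "wset A'" and ?z = "w c"
          have 1: "dl n ((?x * ?z) * tr ?y) \<doteq> dl n (?x * ?z) * dl n ?y"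
            using card eA' sA wts wF_mult_le[OF wF_wset[of A0] wF_w[of c], of "d - \<Sum>A'"]
            by (intro less.hyps) auto
          have 2: "dl n (?x * tr ?y) \<doteq> dl n ?x * dl n ?y"
            using card eA' sA wts wF_mono[OF _ wF_wset[of A0], of "d - \<Sum>A'"]
            by (intro less.hyps) auto
          have "?x * tr (wset A) = tr ?z * (?x * ?y) + (?x * ?z) * tr ?y + tr ?z * (?x * tr ?y)"
            unfolding wA tr_mult by (simp add: algebra_simps)
          then have "dl n (?x * tr (wset A))
              = dw n c * dl n (?x * ?y) + dl n ((?x * ?z) * tr ?y) + dw n c * dl n (?x * tr ?y)"
            using ec by (simp add: dl_add dl_tr_w)
          also have "\<dots> \<doteq> dw n c * dl n (?x * ?y) + dl n (?x * ?z) * dl n ?y + dw n c * (dl n ?x * dl n ?y)"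
            by (intro eqv_add eqv_mult_left 1 2 eqv_refl)
          also have "\<dots> = dl n (?x * wset {c}) * dl n ?y + dl n (?x * ?y) * dl n (wset {c})
               + dl n ?x * dl n ?y * dl n (wset {c})"
            using ec by (simp add: wset_def dl_w ac_simps)
          also have "\<dots> \<doteq> dl n (?y * wset {c}) * dl n ?x"
            using True c by (intro eqv_sym[OF rels2_eqv]) (auto simp: A'_def)
          also have "\<dots> = dl n ?x * dl n (wset A)"
            by (simp add: wA mult.commute)
          finally show ?thesis .
        qed simp
      qed
      \<comment> \<open>Pulling \<open>K\<close> out of the product as it stands would need
        \<open>pw_upto\<close> at weight d itself; after the expansion every term has smaller
        weight.\<close>
      have "dl n (belt (B, A0, M) * tr (wset A)) \<doteq> (\<Sum>C\<in>Pow A - {A}. (\<Prod>i\<in>A - C. dw n i) * (K * dl n (wset A0 * wset C)))"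
        unfolding dl_tr_wset[OF A(1)]
      proof (intro eqv_sum eqv_mult_left)
        fix C assume C: "C \<in> Pow A - {A}"
        then have "\<Sum>C < \<Sum>A" using sum_psubset_less A by blast
        then show "dl n (belt (B, A0, M) * wset C) \<doteq> K * dl n (wset A0 * wset C)"
          unfolding K_def using wts belt
          by (intro dl_belt_mult[OF pw[of "wts (B, A0, M) + \<Sum>C"] _ wF_wset]) auto
      qed
      also have "\<dots> = K * dl n (wset A0 * tr (wset A))"
        by (simp add: dl_tr_wset[OF A(1)] sum_distrib_left mult.left_commute)
      also have "\<dots> \<doteq> K * (dl n (wset A0) * dl n (wset A))"
        by (intro eqv_mult_left small)
      finally show ?case
        by (simp add: dl mult.assoc)
    qed simp
  qed
  then show ?thesis
    unfolding tr_upto_def by blast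
qed

text \<open>The indices i and j - i of \<open>sum_even_w_wbar\<close> are paired, without a fixed
  point since j is odd, and \<open>x * bar y + y * bar x\<close> equals
  \<open>tr (x * y) + tr x * tr y\<close>.\<close>

lemma pw_power2_odd:
  assumes "odd j"
  shows "(pw j)\<^sup>2 = (\<Sum>i=0..(j - 1) div 2. tr (w (2 * i) * w (2 * (j - i))) + tr (w (2 * i)) * tr (w (2 * (j - i))))"
proof -
  define h where "h = (j - 1) div 2"
  have j: "j = 2 * h + 1" using assms by (auto simp: h_def elim!: oddE)
  have "(pw j)\<^sup>2 = (\<Sum>i=0..j. w (2 * i) * wbar (2 * (j - i)))"
    using j by (intro sum_even_w_wbar[symmetric]) simp
  also have "{0..j} = {0..h} \<union> {Suc h..j}" using j by auto
  also have "(\<Sum>i\<in>{0..h} \<union> {Suc h..j}. w (2 * i) * wbar (2 * (j - i)))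
    = (\<Sum>i=0..h. w (2 * i) * wbar (2 * (j - i))) + (\<Sum>i\<in>{Suc h..j}. w (2 * i) * wbar (2 * (j - i)))"
    by (rule sum.union_disjoint) auto
  also have "(\<Sum>i\<in>{Suc h..j}. w (2 * i) * wbar (2 * (j - i))) = (\<Sum>i=0..h. w (2 * (j - i)) * wbar (2 * i))"
    by (rule sum.reindex_bij_witness[of _ "\<lambda>i. j - i" "\<lambda>i. j - i"]) (auto simp: j)
  finally have "(pw j)\<^sup>2 = (\<Sum>i=0..h. w (2 * i) * wbar (2 * (j - i)) + w (2 * (j - i)) * wbar (2 * i))"
    by (simp add: sum.distrib)
  also have "\<dots> = (\<Sum>i=0..h. tr (w (2 * i) * w (2 * (j - i))) + tr (w (2 * i)) * tr (w (2 * (j - i))))"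
    by (intro sum.cong refl) (simp add: tr_def algebra_simps)
  finally show ?thesis by (simp add: h_def)
qed

definition pw_sq :: "nat \<Rightarrow> gen mpoly2" where
  "pw_sq j = (\<Sum>i=0..(j - 1) div 2. dl n (w (2 * i) * w (2 * (j - i))) + dl n (w (2 * i)) * dl n (w (2 * (j - i))))"

lemma dl_w_w:
  assumes "odd j" "0 < i" "i \<le> (j - 1) div 2"
  shows "w (2 * i) * w (2 * (j - i)) = wset {2 * i, 2 * (j - i)}" "eset {2 * i, 2 * (j - i)}"
    "\<Sum>{2 * i, 2 * (j - i)} = 2 * j"
  using assms by (auto simp: wset_def eset_def elim!: oddE)

text \<open>Relation (1) within the range. Beyond it both sides are read as zero, since
  \<open>2 * (j - i)\<close> is at least \<open>j + 1\<close>.\<close>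

lemma p_gen_power2: "odd j \<Longrightarrow> p_gen n j ^ 2 \<doteq> pw_sq j"
proof (cases "j < 2 * n")
  case True
  assume "odd j"
  then have "Var (P_sym j) ^ 2 - (\<Sum>i=0..(j - 1) div 2. delta n (W (2 * i) * W (2 * (j - i)))
          + delta n (W (2 * i)) * delta n (W (2 * (j - i)))) \<in> rels1 n"
    using True unfolding rels1_def by blast
  then show ?thesis
    unfolding eqv_def rel_idl_def using True
    by (intro idl_base) (simp add: p_gen_def pw_sq_def dl_def w.rep_eq)
next
  case False
  assume j: "odd j"
  have "dl n (w (2 * i) * w (2 * (j - i))) + dl n (w (2 * i)) * dl n (w (2 * (j - i))) = 0"
    if i: "i \<in> {0..(j - 1) div 2}" for i
  proof -
    have b: "2 * (j - i) > n" "2 * (j - i) > 0" using i False j by (auto elim!: oddE)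
    then have "dl n (w (2 * (j - i))) = 0"
      by (subst dl_w) (auto simp: dw_eq_0)
    moreover have "dl n (w (2 * i) * w (2 * (j - i))) = 0"
    proof (cases "i = 0")
      case False
      then show ?thesis
        using dl_w_w[OF j, of i] i b delta_gen_eq_0[of "2 * (j - i)" "{2 * i, 2 * (j - i)}" n] 
        by (simp add: dl_wset)
    qed (use calculation in simp)
    ultimately show ?thesis by simp
  qed
  then have "pw_sq j = 0"
    unfolding pw_sq_def by (intro sum.neutral) blast
  then show ?thesis using False by (simp add: p_gen_def)
qed

text \<open>Only a second factor \<open>pw j\<close> is at issue. Its square is a sum of traces and
  products of traces, which move through delta by \<open>tr_upto\<close> and \<open>dl_tr_w\<close>,
  and relation (1) recognises the outcome as the square of \<open>p_gen n j\<close>.\<close>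

lemma pw_upto_step:
  assumes tr: "tr_upto d"
  shows "pw_upto d"
  unfolding pw_upto_def
proof (intro allI impI)
  fix j x assume j: "odd j" "j \<le> d" and "x \<in> wF (d - j)"
  from this(3) show "dl n (pw j * x) \<doteq> p_gen n j * dl n x"
  proof (induction rule: wF_induct)
    case (add x y)
    from eqv_add[OF this] show ?case by (simp add: dl_add distrib_left)
  next
    case (belt B A M)
    show ?case
    proof (cases "j \<in> B")
      case True
      have finB: "finite B" using belt by (simp add: basis_indices_iff)
      define y where "y = belt (B - {j}, A, M)"
      have ind: "(B - {j}, A, M) \<in> basis_indices" using belt by (simp add: basis_indices_iff)
      have "wts (B, A, M) = j + wts (B - {j}, A, M)"
        using True finB by (simp add: wts_simps sum.remove)
      then have y: "y \<in> wF (d - 2 * j)" and d: "2 * j \<le> d"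
        using belt(2) j wF_mono[OF _ wF_belt[OF ind], of "d - 2 * j"] by (auto simp: y_def)
      have xy: "belt (B, A, M) = pw j * y"
        unfolding y_def using True finB by (rule belt_pw[rotated])
      have "dl n (pw j * belt (B, A, M)) = dl n ((pw j)\<^sup>2 * y)"
        by (simp add: xy power2_eq_square mult.assoc)
      also have "(pw j)\<^sup>2 * y = (\<Sum>i=0..(j - 1) div 2. y * tr (w (2 * i) * w (2 * (j - i))) + 
           tr (w (2 * i)) * (tr (w (2 * (j - i))) * y))"
        unfolding pw_power2_odd[OF j(1)] sum_distrib_right
        by (intro sum.cong refl) (simp only: distrib_left distrib_right ac_simps)
      also have "dl n \<dots> = (\<Sum>i=0..(j - 1) div 2. dl n (y * tr (w (2 * i) * w (2 * (j - i)))) + 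
           dl n (tr (w (2 * i)) * (tr (w (2 * (j - i))) * y)))"
        by (simp only: dl_sum dl_add)
      also have "\<dots> \<doteq> (\<Sum>i=0..(j - 1) div 2. dl n y * dl n (w (2 * i) * w (2 * (j - i))) +
           dl n y * (dl n (w (2 * i)) * dl n (w (2 * (j - i)))))"
      proof (intro eqv_sum)
        fix i assume i: "i \<in> {0..(j - 1) div 2}"
        then have pos: "2 * (j - i) > 0" using j(1) by (auto elim!: oddE)
        show "dl n (y * tr (w (2 * i) * w (2 * (j - i)))) + dl n (tr (w (2 * i)) * (tr (w (2 * (j - i))) * y))
          \<doteq> dl n y * dl n (w (2 * i) * w (2 * (j - i))) + dl n y * (dl n (w (2 * i)) * dl n (w (2 * (j - i))))"
        proof (cases "i = 0")
          case True
          then show ?thesis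
            using pos by (simp add: dl_tr_w dl_w mult.commute[of y] mult.commute[of _ "dl n y"])
        next
          case False
          then have ww: "w (2 * i) * w (2 * (j - i)) = wset {2 * i, 2 * (j - i)}" 
            "eset {2 * i, 2 * (j - i)}" "\<Sum>{2 * i, 2 * (j - i)} = 2 * j"
            using dl_w_w[OF j(1)] i by auto
          have "dl n (y * tr (wset {2 * i, 2 * (j - i)})) \<doteq> dl n y * dl n (wset {2 * i, 2 * (j - i)})"
            using d ww(3) by (intro tr_uptoD[OF tr ww(2) y]) simp
          moreover have "dl n (tr (w (2 * i)) * (tr (w (2 * (j - i))) * y))
              = dl n y * (dl n (w (2 * i)) * dl n (w (2 * (j - i))))"
            using False pos by (simp add: dl_tr_w dl_w)
          ultimately show ?thesis
            unfolding ww(1) using eqv_add by simp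
        qed
      qed
      also have "\<dots> = pw_sq j * dl n y"
        unfolding pw_sq_def sum_distrib_right
        by (intro sum.cong refl) (simp only: distrib_left distrib_right ac_simps)
      also have "\<dots> \<doteq> p_gen n j ^ 2 * dl n y"
        by (intro eqv_mult_right eqv_sym[OF p_gen_power2] j)
      also have "\<dots> = p_gen n j * (p_gen n j * dl n y)"
        by (simp add: power2_eq_square mult.assoc)
      also have "p_gen n j * dl n y = dl n (belt (B, A, M))"
        using dl_pw_belt[OF ind j(1), of n] by (simp add: xy y_def)
      finally show ?thesis .
    qed (simp add: dl_pw_belt belt j)
  qed simp
qed

text \<open>The trace of a basis element is \<open>tr (wset A)\<close> times a basis element without
  even variables, and delta of the latter is zero because delta of 1 is.\<close>

lemma dl_tr_upto:
  assumes tr: "tr_upto d" and x: "x \<in> wF d"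
  shows "dl n (tr x) \<doteq> 0"
  using x
proof (induction rule: wF_induct)
  case (add x y)
  then show ?case by (simp add: tr_add dl_add eqv_add_0)
next
  case (belt B A M)
  have ind: "(B, {}, M) \<in> basis_indices" and A: "eset A"
    using belt by (auto simp: basis_indices_iff eset_def)
  have "dl n (tr (belt (B, A, M))) \<doteq> dl n (belt (B, {}, M)) * dl n (wset A)"
    using belt(2) unfolding tr_belt
    by (intro tr_uptoD[OF tr A wF_belt[OF ind]]) (simp add: wts_simps)
  moreover have "dl n (belt (B, {}, M)) = 0"
    using ind by (simp add: dl_belt delta_basis_def delta_gen_def)
  ultimately show ?case by simp
qed simp

lemma dl_mult_wbar:
  assumes "even m" "n < m"
  shows "dl n (y * wbar m) = dl n (y * w m)"
proof -
  have "y * wbar m = y * w m + tr (w m) * y"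
    by (simp add: tr_def distrib_left distrib_right ac_simps)
  then show ?thesis
    using assms by (simp add: dl_add dl_tr_w dw_eq_0)
qed

text \<open>\<open>pw_odd\<close> solved for its first term. The remaining l are even and positive,
  so \<open>k - l\<close> is a smaller odd index.\<close>

lemma w_odd_expand:
  assumes "odd k"
  shows "w k = pw k + (\<Sum>l\<in>{l\<in>{1..k}. even l}. wbar l * w (k - l))"
proof -
  have "{i\<in>{0..k}. even i} = insert 0 {l\<in>{1..k}. even l}"
    by auto
  then have "pw k = (\<Sum>i\<in>insert 0 {l\<in>{1..k}. even l}. wbar i * w (k - i))"
    unfolding pw_odd[OF assms] by (rule arg_cong)
  also have "\<dots> = w k + (\<Sum>l\<in>{l\<in>{1..k}. even l}. wbar l * w (k - l))"
    by (subst sum.insert) auto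
  finally show ?thesis
    by (simp only: add.assoc add_self add_0_right)
qed

lemma wbar_odd_expand:
  assumes "odd k"
  shows "wbar k = pw k + (\<Sum>l\<in>{l\<in>{1..k}. even l}. w l * wbar (k - l))"
  using arg_cong[OF w_odd_expand[OF assms], of bar] by simp

text \<open>\<open>sum_even_w_wbar\<close> solved for its middle term, where
  \<open>wbar m = w m + tr (w m)\<close>.\<close>

lemma w_even_square:
  assumes "even m" "m > 0"
  shows "w m * w m = w m * tr (w m) + (pw m)\<^sup>2 + (\<Sum>i\<in>{0..m} - {m div 2}. w (2 * i) * wbar (2 * (m - i)))"
proof -
  obtain h where h: "m = 2 * h" using assms by (elim evenE)
  have "(pw m)\<^sup>2 = (\<Sum>i=0..m. w (2 * i) * wbar (2 * (m - i)))"
    using assms by (intro sum_even_w_wbar[symmetric]) simp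
  also have "\<dots> = w m * wbar m + (\<Sum>i\<in>{0..m} - {m div 2}. w (2 * i) * wbar (2 * (m - i)))"
    by (subst sum.remove[of _ "m div 2"]) (auto simp: h)
  finally show ?thesis
    by (simp add: tr_def distrib_left ac_simps)
qed

text \<open>Induction on i by \<open>wbar_odd_expand\<close>: the power sum comes out and leaves
  \<open>z * w k\<close>, which has smaller weight; in the other terms the odd index has
  dropped.\<close>

lemma dl_odd_odd:
  assumes pw: "pw_upto d" and ann: "\<And>e. e < d \<Longrightarrow> ann_upto e"
    and i: "odd i" and k: "n < k" and z: "z \<in> wF f" "f + k + i \<le> d"
  shows "dl n (z * w k * wbar i) \<doteq> 0"
  using i z
proof (induction i arbitrary: z f rule: less_induct)
  case (less i)
  have i: "i \<ge> 1" using less.prems by (auto elim!: oddE)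
  have "z * w k * wbar i = pw i * (z * w k) + (\<Sum>l\<in>{l\<in>{1..i}. even l}. (z * w l) * w k * wbar (i - l))"
    unfolding wbar_odd_expand[OF less.prems(1)] by (simp add: distrib_left sum_distrib_left ac_simps)
  then have "dl n (z * w k * wbar i)
      = dl n (pw i * (z * w k)) + (\<Sum>l\<in>{l\<in>{1..i}. even l}. dl n ((z * w l) * w k * wbar (i - l)))"
    by (simp only: dl_add dl_sum)
  also have "\<dots> \<doteq> 0"
  proof (intro eqv_add_0 eqv_sum_0)
    have "dl n (pw i * (z * w k)) \<doteq> p_gen n i * dl n (z * w k)"
      using less.prems by (intro pw_uptoD[OF pw _ wF_mult[OF less.prems(2) wF_w]]) auto
    also have "\<dots> \<doteq> 0"
      using less.prems k i
      by (intro eqv_mult_0 ann_uptoD[OF ann[of "f + k"] _ less.prems(2)]) auto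
    finally show "dl n (pw i * (z * w k)) \<doteq> 0" .
  next
    fix l assume "l \<in> {l\<in>{1..i}. even l}"
    then have l: "1 \<le> l" "l \<le> i" "even l" by auto
    then have "l < i" using less.prems(1) by (cases "l = i") auto
    then show "dl n ((z * w l) * w k * wbar (i - l)) \<doteq> 0"
      using less.prems l by (intro less.IH[OF _ _ wF_mult[OF less.prems(2) wF_w]]) auto
  qed
  finally show ?case .
qed

lemma dl_bar:
  assumes tr: "tr_upto d" and x: "x \<in> wF d"
  shows "dl n (bar x) \<doteq> dl n x"
proof -
  have "bar x = x + tr x"
    by (rule bar_eq_tr)
  then show ?thesis
    using eqv_add[OF eqv_refl dl_tr_upto[OF tr x], of "dl n x"] by (simp add: dl_add)
qed

lemma dl_mult_eqv_0I:
  assumes pw: "pw_upto d"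
    and A: "\<And>A. eset A \<Longrightarrow> \<Sum>A \<le> f \<Longrightarrow> dl n (wset A * y) \<doteq> 0"
    and y: "y \<in> wF g" "f + g \<le> d" and r: "r \<in> wF f"
  shows "dl n (r * y) \<doteq> 0"
  using r
proof (induction rule: wF_induct)
  case (add x y)
  then show ?case by (simp add: distrib_right dl_add eqv_add_0)
next
  case (belt B A M)
  have "dl n (belt (B, A, M) * y) \<doteq> (\<Prod>j\<in>B. p_gen n j) * (\<Prod>i\<in>#M. dw n i) * dl n (wset A * y)"
    using belt y by (intro dl_belt_mult[OF pw _ y(1)]) auto
  also have "\<dots> \<doteq> 0"
    using belt by (intro eqv_mult_0 assms(2)) (auto simp: basis_indices_iff wts_simps)
  finally show ?case .
qed simp

text \<open>A square-free monomial with an index beyond n is read as zero, so only a square of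
  \<open>w m\<close> is at issue. In \<open>w_even_square\<close> the other even terms contain an
  even index above m, possibly conjugated, so the induction runs downward on m.\<close>

lemma ann_even:
  assumes tr: "tr_upto d" and pw: "pw_upto d" and ann: "\<And>e. e < d \<Longrightarrow> ann_upto e"
    and m: "even m" "n < m" and r: "r \<in> wF f" "f + m \<le> d"
  shows "dl n (r * w m) \<doteq> 0"
  using m r
proof (induction "d - m" arbitrary: m r f rule: less_induct)
  case less
  have m0: "m > 0" using less.prems by simp
  show ?case
  proof (rule dl_mult_eqv_0I[OF pw _ wF_w less.prems(4,3)])
    fix A assume A: "eset A" "\<Sum>A \<le> f"
    then have finA: "finite A" by (simp add: eset_def)
    show "dl n (wset A * w m) \<doteq> 0"
    proof (cases "m \<in> A")
      case False
      then have "wset A * w m = wset (insert m A)"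
        using finA by (simp add: wset_insert mult.commute)
      moreover have "eset (insert m A)"
        using A less.prems m0 by (simp add: eset_def)
      ultimately show ?thesis
        using less.prems by (simp add: dl_wset delta_gen_eq_0[of m])
    next
      case True
      define z where "z = wset (A - {m})"
      define g where "g = \<Sum>(A - {m})"
      have z: "z \<in> wF g"
        unfolding z_def g_def by (rule wF_wset)
      have "\<Sum>A = m + g"
        using True finA by (simp add: g_def sum.remove)
      then have g: "g + 2 * m \<le> d"
        using A(2) less.prems(4) by simp
      have IH: "dl n (y * w k) \<doteq> 0" if "even k" "m < k" "y \<in> wF h" "h + k \<le> d" for y k h
        using that less.prems(2) by (intro less.hyps[of k y h]) auto
      have "wset A * w m = z * (w m * w m)"
        using True finA by (simp add: z_def wset_remove[of A m] ac_simps)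
      also have "\<dots> = tr (w m) * (z * w m) + z * (pw m)\<^sup>2
         + (\<Sum>i\<in>{0..m} - {m div 2}. z * (w (2 * i) * wbar (2 * (m - i))))"
        unfolding w_even_square[OF less.prems(1) m0] by (simp add: distrib_left sum_distrib_left ac_simps)
      finally have "dl n (wset A * w m) = dl n (tr (w m) * (z * w m)) + dl n (z * (pw m)\<^sup>2)
         + (\<Sum>i\<in>{0..m} - {m div 2}. dl n (z * (w (2 * i) * wbar (2 * (m - i)))))"
        by (simp only: dl_add dl_sum)
      also have "\<dots> \<doteq> 0"
      proof (intro eqv_add_0 eqv_sum_0)
        show "dl n (tr (w m) * (z * w m)) \<doteq> 0"
          using less.prems m0 by (simp add: dl_tr_w dw_eq_0)
      next
        \<comment> \<open>The expansion over odd indices is used because m is even: i and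
          \<open>2 * m - i\<close> then differ from m, and one of them exceeds it.\<close>
        have "z * (pw m)\<^sup>2 = (\<Sum>i\<in>{i\<in>{0..2*m}. odd i}. z * (w i * wbar (2 * m - i)))"
          using m0 by (simp add: pw_power2 sum_distrib_left)
        then have *: "dl n (z * (pw m)\<^sup>2) = (\<Sum>i\<in>{i\<in>{0..2*m}. odd i}. dl n (z * (w i * wbar (2 * m - i))))"
          by (simp only: dl_sum)
        show "dl n (z * (pw m)\<^sup>2) \<doteq> 0"
          unfolding *
        proof (rule eqv_sum_0)
          fix i assume i: "i \<in> {i\<in>{0..2*m}. odd i}"
          show "dl n (z * (w i * wbar (2 * m - i))) \<doteq> 0"
          proof (cases "i > m")
            case True
            have o: "odd (2 * m - i)" and k: "n < i" and le: "g + i + (2 * m - i) \<le> d"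
              using i True less.prems(2) g by simp_all
            have "dl n (z * w i * wbar (2 * m - i)) \<doteq> 0"
              by (rule dl_odd_odd[OF pw ann o k z le])
            then show ?thesis by (simp add: mult.assoc)
          next
            case False
            have "i \<noteq> m"
              using i less.prems(1) by auto
            then have "2 * m - i > m"
              using False by simp
            then have k: "n < 2 * m - i" and o: "odd i" and le: "g + (2 * m - i) + i \<le> d"
              using i less.prems(2) g by simp_all
            \<comment> \<open>The large index now sits on the conjugate factor. Applying
              \<open>bar\<close> exchanges the roles, and by \<open>dl_bar\<close> it does not
              change delta modulo the relations.\<close>
            have 0: "dl n (bar z * w (2 * m - i) * wbar i) \<doteq> 0"
              by (rule dl_odd_odd[OF pw ann o k wF_bar[OF z] le])
            have eq: "bar (z * (w i * wbar (2 * m - i))) = bar z * w (2 * m - i) * wbar i"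
              by (simp add: ac_simps)
            have mem: "z * (w i * wbar (2 * m - i)) \<in> wF d"
              using i g by (intro wF_mult_le[OF z wF_mult[OF wF_w wF_wbar]]) auto
            show ?thesis
              using eqv_trans[OF eqv_sym[OF dl_bar[OF tr mem, unfolded eq]] 0] .
          qed
        qed
      next
        fix i assume i: "i \<in> {0..m} - {m div 2}"
        show "dl n (z * (w (2 * i) * wbar (2 * (m - i)))) \<doteq> 0"
        proof (cases "2 * i > m")
          case True
          have "dl n (z * wbar (2 * (m - i)) * w (2 * i)) \<doteq> 0"
            using i g True by (intro IH[OF _ _ wF_mult[OF z wF_wbar]]) auto
          then show ?thesis by (simp add: ac_simps)
        next
          case False
          then have b: "2 * (m - i) > m"
            using i less.prems(1) by (auto elim!: evenE)
          have "dl n (z * w (2 * i) * w (2 * (m - i))) \<doteq> 0"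
            using i g b by (intro IH[OF _ _ wF_mult[OF z wF_w]]) auto
          moreover have "dl n (z * w (2 * i) * wbar (2 * (m - i))) = dl n (z * w (2 * i) * w (2 * (m - i)))"
            using b less.prems(2) by (intro dl_mult_wbar) auto
          ultimately show ?thesis by (simp add: mult.assoc)
        qed
      qed
      finally show ?thesis .
    qed
  qed
qed

text \<open>Even variables beyond n fall under \<open>ann_even\<close>, and k < 2n is relation (3).
  For larger k, \<open>w_odd_expand\<close> leaves \<open>pw k\<close>, which is read as zero, and
  products in which the even l exceeds n or the smaller odd index \<open>k - l\<close> does.\<close>

lemma ann_odd:
  assumes tr: "tr_upto d" and pw: "pw_upto d" and ann: "\<And>e. e < d \<Longrightarrow> ann_upto e"
    and k: "odd k" "n < k" and r: "r \<in> wF f" "f + k \<le> d"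
  shows "dl n (r * w k) \<doteq> 0"
  using k r
proof (induction k arbitrary: r f rule: less_induct)
  case (less k)
  note even = ann_even[OF tr pw ann]
  show ?case
  proof (rule dl_mult_eqv_0I[OF pw _ wF_w less.prems(4,3)])
    fix A assume A: "eset A" "\<Sum>A \<le> f"
    then have finA: "finite A" by (simp add: eset_def)
    show "dl n (wset A * w k) \<doteq> 0"
    proof (cases "A \<subseteq> evens n")
      case False
      then obtain b where b: "b \<in> A" "b > n" "even b"
        using A by (auto simp: eset_subset_evens_iff not_le eset_def)
      have sA: "\<Sum>A = b + \<Sum>(A - {b})"
        using b finA by (simp add: sum.remove)
      have "dl n (wset (A - {b}) * w k * w b) \<doteq> 0"
        using b sA A less.prems(4) by (intro even[OF _ _ _ wF_mult[OF wF_wset wF_w]]) auto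
      then show ?thesis
        using b finA by (simp add: wset_remove[of A b] ac_simps)
    next
      case True
      show ?thesis
      proof (cases "k < 2 * n")
        case k: True
        have "delta n (sqf_mon A * W k) \<in> rels3 n"
          using True less.prems k unfolding rels3_def sqf_mons_def by blast
        then show ?thesis
          unfolding eqv_def rel_idl_def by (intro idl_base) (simp add: dl_def Rep_wset w.rep_eq)
      next
        case False
        then have k2: "k > 2 * n" using less.prems(1) by (cases "k = 2 * n") auto
        have "wset A * w k = pw k * wset A + (\<Sum>l\<in>{l\<in>{1..k}. even l}. wset A * (wbar l * w (k - l)))"
          unfolding w_odd_expand[OF less.prems(1)] by (simp add: distrib_left sum_distrib_left ac_simps)
        then have "dl n (wset A * w k)
            = dl n (pw k * wset A) + (\<Sum>l\<in>{l\<in>{1..k}. even l}. dl n (wset A * (wbar l * w (k - l))))"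
          by (simp only: dl_add dl_sum)
        also have "\<dots> \<doteq> 0"
        proof (intro eqv_add_0 eqv_sum_0)
          have "dl n (pw k * wset A) \<doteq> p_gen n k * dl n (wset A)"
            using A less.prems by (intro pw_uptoD[OF pw _ wF_wset]) auto
          then show "dl n (pw k * wset A) \<doteq> 0"
            using k2 by (simp add: p_gen_def)
        next
          fix l assume "l \<in> {l\<in>{1..k}. even l}"
          then have l: "1 \<le> l" "l \<le> k" "even l" by auto
          show "dl n (wset A * (wbar l * w (k - l))) \<doteq> 0"
          proof (cases "l > n")
            case True
            have "dl n (wset A * w (k - l) * w l) \<doteq> 0"
              using l True A less.prems(4) by (intro even[OF _ _ _ wF_mult[OF wF_wset wF_w]]) auto
            moreover have "dl n (wset A * w (k - l) * wbar l) = dl n (wset A * w (k - l) * w l)"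
              using l True by (intro dl_mult_wbar) auto
            ultimately show ?thesis by (simp add: ac_simps)
          next
            case False
            have "dl n (wset A * wbar l * w (k - l)) \<doteq> 0"
              using l False A less.prems k2
              by (intro less.IH[OF _ _ _ wF_mult[OF wF_wset wF_wbar]]) auto
            then show ?thesis by (simp add: ac_simps)
          qed
        qed
        finally show ?thesis .
      qed
    qed
  qed
qed

text \<open>The trace rule at weight d uses only smaller weights, the rule for power sums uses the
  trace rule at d, and the annihilation of the ideal uses both at d.\<close>

lemma upto_all: "tr_upto d \<and> pw_upto d \<and> ann_upto d"
proof (induction d rule: less_induct)
  case (less d)
  then have ann: "\<And>e. e < d \<Longrightarrow> ann_upto e" and pw_lt: "\<And>e. e < d \<Longrightarrow> pw_upto e"
    by auto
  have tr: "tr_upto d"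
    by (rule tr_upto_step[OF ann pw_lt])
  then have pw: "pw_upto d"
    by (rule pw_upto_step)
  have "ann_upto d"
    unfolding ann_upto_def
  proof (intro allI impI)
    fix m r assume m: "n < m" "m \<le> d" and r: "r \<in> wF (d - m)"
    then show "dl n (r * w m) \<doteq> 0"
      by (cases "even m") (auto intro: ann_even[OF tr pw ann _ _ r] ann_odd[OF tr pw ann _ _ r])
  qed
  with tr pw show ?case by blast
qed

lemma dl_pw_mult: "odd j \<Longrightarrow> dl n (pw j * x) \<doteq> p_gen n j * dl n x"
proof -
  assume j: "odd j"
  obtain f where "x \<in> wF f" using wF_ex by blast
  then show ?thesis
    using pw_uptoD[of "f + j" j x f] upto_all j by auto
qed

lemma dl_tr: "dl n (tr x) \<doteq> 0"
  using dl_tr_upto upto_all wF_ex by blast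

lemma dl_In: "x \<in> In n \<Longrightarrow> dl n x \<doteq> 0"
  unfolding Gr_idl_def
proof (induction rule: ring_module.span_induct_alt)
  case (step c x y)
  have w0: "dl n (r * w m) \<doteq> 0" if "n < m" for r m
  proof -
    obtain f where "r \<in> wF f" using wF_ex by blast
    then show ?thesis
      using ann_uptoD[of "f + m" m r f] upto_all that by auto
  qed
  have "dl n (c * x) \<doteq> 0"
  proof (cases "x \<in> w ` {n<..}")
    case True
    then show ?thesis using w0 by auto
  next
    case False
    then obtain m where m: "m > n" "x = wbar m" using step by auto
    \<comment> \<open>A multiple of \<open>wbar m\<close> is the conjugate of a multiple of
      \<open>w m\<close> and so differs from it by a trace.\<close>
    have "c * x = bar c * w m + tr (bar c * w m)"
      by (simp add: m tr_def add.commute)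
    then have "dl n (c * x) = dl n (bar c * w m) + dl n (tr (bar c * w m))"
      by (simp only: dl_add)
    then show ?thesis
      using w0[OF m(1), of "bar c"] dl_tr eqv_add_0 by simp
  qed
  then show ?case
    using step by (simp add: dl_add eqv_add_0)
qed simp

lemma dl_mult_tr: "dl n (x * tr y) \<doteq> dl n x * dl n y"
proof -
  obtain f where "y \<in> wF f" using wF_ex by blast
  then show ?thesis
  proof (induction rule: wF_induct)
    case (add y z)
    from eqv_add[OF this] show ?case by (simp add: tr_add distrib_left dl_add)
  next
    case (belt B A M)
    define K where "K = (\<Prod>j\<in>B. p_gen n j) * (\<Prod>i\<in>#M. dw n i)"
    have A: "eset A" and ind: "(B, {}, M) \<in> basis_indices"
      using belt by (auto simp: basis_indices_iff eset_def)
    have *: "dl n (belt (B, {}, M) * z) \<doteq> K * dl n z" for z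
    proof -
      obtain g where g: "z \<in> wF g" using wF_ex by blast
      show ?thesis
        using dl_belt_mult[OF _ ind g order_refl] upto_all by (simp add: K_def)
    qed
    have "x * tr (belt (B, A, M)) = belt (B, {}, M) * (x * tr (wset A))"
      by (simp add: tr_belt ac_simps)
    then have "dl n (x * tr (belt (B, A, M))) \<doteq> K * dl n (x * tr (wset A))"
      using * by simp
    also have "\<dots> \<doteq> K * (dl n x * dl n (wset A))"
    proof (rule eqv_mult_left)
      obtain g where g: "x \<in> wF g" using wF_ex by blast
      show "dl n (x * tr (wset A)) \<doteq> dl n x * dl n (wset A)"
        using tr_uptoD[OF _ A g order_refl] upto_all by simp
    qed
    also have "\<dots> = dl n x * dl n (belt (B, A, M))"
      using belt A by (simp add: K_def dl_belt dl_wset delta_basis_def dw_def ac_simps)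
    finally show ?case .
  qed simp
qed

end

section \<open>Ideals of polynomial rings\<close>

lemma poly_ring_idealI:
  assumes "I \<subseteq> carrier (poly_ring V)" "0 \<in> I"
    and add: "\<And>x y. x \<in> I \<Longrightarrow> y \<in> I \<Longrightarrow> x + y \<in> I"
    and mult: "\<And>x y. x \<in> I \<Longrightarrow> y \<in> carrier (poly_ring V) \<Longrightarrow> y * x \<in> I"
  shows "ideal I (poly_ring V)"
proof -
  interpret cring "poly_ring V" by (rule cring_poly_ring)
  have inv: "\<ominus>\<^bsub>poly_ring V\<^esub> x = x" if "x \<in> carrier (poly_ring V)" for x
    using that by (intro minus_equality) simp_all
  show ?thesis
  proof (rule idealI)
    show "subgroup I (add_monoid (poly_ring V))"
      using assms by (intro add.subgroupI) (auto simp: inv subset_iff)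
  qed (use mult in \<open>auto simp: mult.commute intro: local.ring_axioms\<close>)
qed

text \<open>Substituting zero for the variables outside V is a retraction onto
  \<open>poly_ring V\<close> that fixes G, so it moves the coefficients of a combination into that
  ring.\<close>

lemma genideal_poly_ring:
  assumes "G \<subseteq> carrier (poly_ring V)"
  shows "Idl\<^bsub>poly_ring V\<^esub> G = {f \<in> carrier (poly_ring V). f \<in> idl G}"
proof
  interpret cring "poly_ring V" by (rule cring_poly_ring)
  have "ideal {f \<in> carrier (poly_ring V). f \<in> idl G} (poly_ring V)"
    by (rule poly_ring_idealI) (auto intro: idl_add idl_mult)
  then show "Idl\<^bsub>poly_ring V\<^esub> G \<subseteq> {f \<in> carrier (poly_ring V). f \<in> idl G}"
    using assms by (intro genideal_minimal) (auto intro: idl_base)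
  interpret I: ideal "Idl\<^bsub>poly_ring V\<^esub> G" "poly_ring V"
    using assms by (rule genideal_ideal)
  define \<rho> where "\<rho> = poly_subst (\<lambda>v. if v \<in> V then Var v else 0)"
  have closed: "\<rho> f \<in> carrier (poly_ring V)" for f
    unfolding \<rho>_def by (intro poly_subst_closed) auto
  have id: "\<rho> f = f" if "f \<in> carrier (poly_ring V)" for f
    using poly_subst_cong[OF that, of "\<lambda>v. if v \<in> V then Var v else 0" Var]
    by (simp add: \<rho>_def poly_subst_Var_id)
  have "\<rho> f \<in> Idl\<^bsub>poly_ring V\<^esub> G" if "f \<in> idl G" for f
    using that
  proof (induction rule: ring_module.span_induct_alt)
    case base
    then show ?case using I.zero_closed by (simp add: \<rho>_def)
  next
    case (step c x y)
    have "x \<in> Idl\<^bsub>poly_ring V\<^esub> G"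
      using genideal_self[OF assms] step by blast
    then have "\<rho> c * x \<in> Idl\<^bsub>poly_ring V\<^esub> G"
      using I.I_l_closed[of x "\<rho> c"] closed by simp
    then have "\<rho> c * x + \<rho> y \<in> Idl\<^bsub>poly_ring V\<^esub> G"
      using I.a_closed[of "\<rho> c * x" "\<rho> y"] step by simp
    moreover have "\<rho> (c * x + y) = \<rho> c * x + \<rho> y"
      using id[of x] assms step by (auto simp: \<rho>_def)
    ultimately show ?case by simp
  qed
  then show "{f \<in> carrier (poly_ring V). f \<in> idl G} \<subseteq> Idl\<^bsub>poly_ring V\<^esub> G"
    using id by force
qed

lemma carrier_w_ring: "carrier w_ring = range Rep_wpoly"
  using type_definition.Rep_range[OF type_definition_wpoly] by simp

lemma Gr_ideal_eq: "Gr_ideal n = Rep_wpoly ` In n"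
proof
  interpret cring w_ring by (rule cring_poly_ring)
  let ?G = "W ` {n<..} \<union> W_bar ` {n<..}"
  have G: "?G \<subseteq> carrier w_ring"
    using W_closed W_bar_closed by auto
  interpret I: ideal "Gr_ideal n" w_ring
    unfolding Gr_ideal_def using G by (rule genideal_ideal)
  have "ideal (Rep_wpoly ` In n) w_ring"
  proof (rule poly_ring_idealI)
    fix x y assume "x \<in> Rep_wpoly ` In n" "y \<in> Rep_wpoly ` In n"
    then obtain a b where "a \<in> In n" "b \<in> In n" "x = Rep_wpoly a" "y = Rep_wpoly b"
      by blast
    then show "x + y \<in> Rep_wpoly ` In n"
      by (intro image_eqI[of _ _ "a + b"]) (simp_all add: Gr_idl_add)
  next
    fix x y assume "x \<in> Rep_wpoly ` In n" "y \<in> carrier w_ring"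
    then obtain a b where "a \<in> In n" "x = Rep_wpoly a" "y = Rep_wpoly b"
      unfolding carrier_w_ring by blast
    then show "y * x \<in> Rep_wpoly ` In n"
      by (intro image_eqI[of _ _ "b * a"]) (simp_all add: Gr_idl_mult)
  qed (use Rep_wpoly in \<open>auto intro: image_eqI[of _ _ 0]\<close>)
  moreover have "?G \<subseteq> Rep_wpoly ` In n"
    using w_in_Gr_idl wbar_in_Gr_idl by (force simp flip: w.rep_eq wbar.rep_eq)
  ultimately show "Gr_ideal n \<subseteq> Rep_wpoly ` In n"
    unfolding Gr_ideal_def by (rule genideal_minimal)
  have "Rep_wpoly x \<in> Gr_ideal n" if "x \<in> In n" for x
    using that unfolding Gr_idl_def
  proof (induction rule: ring_module.span_induct_alt)
    case base
    then show ?case using I.zero_closed by simp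
  next
    case (step c x y)
    have "Rep_wpoly x \<in> ?G"
      using step(1) by (auto simp: w.rep_eq wbar.rep_eq)
    then have "Rep_wpoly x \<in> Gr_ideal n"
      unfolding Gr_ideal_def using genideal_self[OF G] by blast
    then have "Rep_wpoly c * Rep_wpoly x \<in> Gr_ideal n"
      using I.I_l_closed[of "Rep_wpoly x" "Rep_wpoly c"] Rep_wpoly[of c] by simp
    then show ?case
      using I.a_closed[of "Rep_wpoly c * Rep_wpoly x" "Rep_wpoly y"] step by simp
  qed
  then show "Rep_wpoly ` In n \<subseteq> Gr_ideal n" by blast
qed

lemma ideal_Gr_ideal: "ideal (Gr_ideal n) w_ring"
proof -
  interpret cring w_ring by (rule cring_poly_ring)
  show ?thesis
    unfolding Gr_ideal_def using W_closed W_bar_closed by (intro genideal_ideal) auto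
qed

section \<open>Cosets and the induced involution\<close>

lemma class_Gr_eq: "class_Gr n (Rep_wpoly x) = Rep_wpoly ` {y. x + y \<in> In n}"
proof -
  have "class_Gr n (Rep_wpoly x) = (\<lambda>i. Rep_wpoly (i + x)) ` In n"
    by (auto simp: class_Gr_def a_r_coset_def' Gr_ideal_eq)
  also have "\<dots> = Rep_wpoly ` {y. x + y \<in> In n}"
  proof (intro equalityI subsetI)
    fix z assume "z \<in> Rep_wpoly ` {y. x + y \<in> In n}"
    then obtain y where "z = Rep_wpoly ((x + y) + x)" "x + y \<in> In n"
      by (auto simp: ac_simps)
    then show "z \<in> (\<lambda>i. Rep_wpoly (i + x)) ` In n" by blast
  next
    fix z assume "z \<in> (\<lambda>i. Rep_wpoly (i + x)) ` In n"
    then obtain i where "i \<in> In n" "z = Rep_wpoly (i + x)" by blast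
    moreover from this have "x + (i + x) \<in> In n" by (simp add: ac_simps)
    ultimately show "z \<in> Rep_wpoly ` {y. x + y \<in> In n}" by blast
  qed
  finally show ?thesis .
qed

lemma class_Gr_eq_iff: "class_Gr n (Rep_wpoly x) = class_Gr n (Rep_wpoly y) \<longleftrightarrow> x + y \<in> In n"
proof
  assume "class_Gr n (Rep_wpoly x) = class_Gr n (Rep_wpoly y)"
  then have "{z. x + z \<in> In n} = {z. y + z \<in> In n}"
    unfolding class_Gr_eq by (simp add: inj_image_eq_iff Rep_wpoly_inject inj_on_def)
  then show "x + y \<in> In n"
    by (metis (mono_tags, lifting) Gr_idl_0 add_self mem_Collect_eq)
next
  assume xy: "x + y \<in> In n"
  have "x + z \<in> In n \<longleftrightarrow> y + z \<in> In n" for z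
  proof -
    have "(x + z) + (y + z) = x + y" by (simp add: ac_simps)
    then show ?thesis using Gr_idl_cancel xy by metis
  qed
  then show "class_Gr n (Rep_wpoly x) = class_Gr n (Rep_wpoly y)"
    unfolding class_Gr_eq by simp
qed

lemma omega_class_Gr: "omega ` class_Gr n (Rep_wpoly x) = class_Gr n (Rep_wpoly (bar x))"
proof -
  have "omega ` class_Gr n (Rep_wpoly x) = Rep_wpoly ` bar ` {y. x + y \<in> In n}"
    unfolding class_Gr_eq by (auto simp: bar.rep_eq image_iff)
  also have "bar ` {y. x + y \<in> In n} = {y. bar x + y \<in> In n}"
  proof (intro equalityI subsetI)
    fix y assume "y \<in> bar ` {y. x + y \<in> In n}"
    then show "y \<in> {y. bar x + y \<in> In n}"
      using bar_in_In by (auto simp flip: bar_add)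
  next
    fix y assume "y \<in> {y. bar x + y \<in> In n}"
    then have "x + bar y \<in> In n"
      using bar_in_In[of "bar x + y" n] by simp
    then show "y \<in> bar ` {y. x + y \<in> In n}"
      by (intro image_eqI[of _ _ "bar y"]) auto
  qed
  finally show ?thesis by (simp only: class_Gr_eq)
qed

lemma carrier_S_Gr: "carrier (S_Gr n) = {class_Gr n (Rep_wpoly x) | x. tr x \<in> In n}"
proof -
  have R: "carrier (R_Gr n) = {class_Gr n (Rep_wpoly x) | x. True}"
    unfolding R_Gr_def FactRing_def A_RCOSETS_def' class_Gr_def using carrier_w_ring by auto
  have inv: "omega ` class_Gr n (Rep_wpoly x) = class_Gr n (Rep_wpoly x) \<longleftrightarrow> tr x \<in> In n" for x
    by (simp add: omega_class_Gr class_Gr_eq_iff tr_def add.commute)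
  have "carrier (S_Gr n) = {C \<in> carrier (R_Gr n). omega ` C = C}"
    by (simp add: S_Gr_def)
  also have "\<dots> = {class_Gr n (Rep_wpoly x) | x. tr x \<in> In n}"
  proof (intro equalityI subsetI)
    fix C assume "C \<in> {C \<in> carrier (R_Gr n). omega ` C = C}"
    then obtain x where x: "C = class_Gr n (Rep_wpoly x)" "omega ` C = C"
      unfolding R by blast
    then have "tr x \<in> In n"
      using inv by simp
    with x(1) show "C \<in> {class_Gr n (Rep_wpoly x) | x. tr x \<in> In n}" by blast
  next
    fix C assume "C \<in> {class_Gr n (Rep_wpoly x) | x. tr x \<in> In n}"
    then obtain x where x: "C = class_Gr n (Rep_wpoly x)" "tr x \<in> In n" by blast
    then have "omega ` C = C"
      using inv by simp
    with x(1) show "C \<in> {C \<in> carrier (R_Gr n). omega ` C = C}"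
      unfolding R by blast
  qed
  finally show ?thesis .
qed

section \<open>The presentation\<close>

definition gen_val :: "gen \<Rightarrow> wpoly" where
  "gen_val g = (case g of P_sym j \<Rightarrow> pw j | D_sym A \<Rightarrow> tr (wset A))"

lift_definition ev :: "gen mpoly2 \<Rightarrow> wpoly" is "poly_subst (\<lambda>g. Rep_wpoly (gen_val g))"
  by (intro poly_subst_closed Rep_wpoly)

lemma ev_simps [simp]:
  "ev 0 = 0" "ev 1 = 1" "ev (f + g) = ev f + ev g" "ev (f * g) = ev f * ev g"
  by (transfer; simp)+

lemma ev_Var [simp]: "ev (Var v) = gen_val v"
  by (simp add: ev.rep_eq flip: Rep_wpoly_inject)

lemma ev_sum: "ev (\<Sum>i\<in>A. f i) = (\<Sum>i\<in>A. ev (f i))"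
  by (induction A rule: infinite_finite_induct) auto

lemma ev_prod: "ev (\<Prod>i\<in>A. f i) = (\<Prod>i\<in>A. ev (f i))"
  by (induction A rule: infinite_finite_induct) auto

lemma In_mult_cong: "x + x' \<in> In n \<Longrightarrow> y + y' \<in> In n \<Longrightarrow> x * y + x' * y' \<in> In n"
proof -
  assume "x + x' \<in> In n" "y + y' \<in> In n"
  then have "(x + x') * y + x' * (y + y') \<in> In n"
    by (intro Gr_idl_add[OF Gr_idl_mult(2) Gr_idl_mult(1)])
  then show ?thesis by (simp add: algebra_simps)
qed

lemma In_add_cong: "x + x' \<in> In n \<Longrightarrow> y + y' \<in> In n \<Longrightarrow> (x + y) + (x' + y') \<in> In n"
  using Gr_idl_add[of "x + x'" n n "y + y'"] by (simp add: ac_simps)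

lemma ev_p_gen: "odd j \<Longrightarrow> ev (p_gen n j) + pw j \<in> In n"
proof (cases "j < 2 * n")
  case False
  assume "odd j"
  with False have "j > 2 * n" by (cases "j = 2 * n") auto
  then show ?thesis using pw_in_In \<open>odd j\<close> by (simp add: p_gen_def)
qed (simp add: p_gen_def gen_val_def)

text \<open>Reading a symbol out of range as zero agrees with the ring, where monomials with a
  variable beyond n vanish.\<close>

lemma ev_delta_gen: "eset A \<Longrightarrow> ev (delta_gen n A) + tr (wset A) \<in> In n"
proof -
  assume A: "eset A"
  show ?thesis
  proof (cases "A \<subseteq> evens n")
    case True
    then show ?thesis by (cases "A = {}") (auto simp: delta_gen_def gen_val_def)
  next
    case False
    then obtain b where b: "b \<in> A" "b > n"
      using A by (auto simp: eset_subset_evens_iff not_le)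
    have "finite A" using A by (simp add: eset_def)
    then have "wset A \<in> In n"
      using b by (simp add: wset_remove[of A b] Gr_idl_mult(2) w_in_Gr_idl)
    then show ?thesis
      using False by (simp add: delta_gen_def tr_in_In)
  qed
qed

lemma ev_dl: "ev (dl n x) + tr x \<in> In n"
proof -
  obtain d where "x \<in> wF d" using wF_ex by blast
  then show ?thesis
  proof (induction rule: wF_induct)
    case (add x y)
    from In_add_cong[OF this] show ?case by (simp add: dl_add tr_add)
  next
    case (belt B A M)
    have A: "eset A" and B: "finite B" "\<forall>j\<in>B. odd j" and M: "\<forall>i\<in>#M. even i \<and> i > 0"
      using belt by (auto simp: basis_indices_iff)
    have "ev (\<Prod>j\<in>B. p_gen n j) + pmon B \<in> In n"
      using B unfolding pmon_def by (induction B) (auto intro: In_mult_cong ev_p_gen)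
    moreover have "ev (delta_gen n {i}) + tr (w i) \<in> In n" if "even i" "i > 0" for i
      using ev_delta_gen[of "{i}" n] that by (simp add: eset_def)
    then have "ev (\<Prod>i\<in>#M. delta_gen n {i}) + (\<Prod>i\<in>#M. tr (w i)) \<in> In n"
      using M by (induction M) (auto intro: In_mult_cong)
    ultimately have "ev (delta_basis n (B, A, M)) + pmon B * tr (wset A) * (\<Prod>i\<in>#M. tr (w i)) \<in> In n"
      using ev_delta_gen[OF A, of n] unfolding delta_basis_def prod.case ev_simps
      by (intro In_mult_cong)
    moreover have "tr (belt (B, A, M)) = pmon B * tr (wset A) * (\<Prod>i\<in>#M. tr (w i))"
      unfolding tr_belt by (simp add: belt_def ac_simps)
    ultimately show ?case
      using belt by (simp add: dl_belt)
  qed simp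
qed

lemma delta_sqf: 
  assumes "x \<in> sqf_mons n"
  shows "\<exists>A\<subseteq>evens n. x = Rep_wpoly (wset A)"
  using assms by (auto simp: sqf_mons_def Rep_wset)

text \<open>By \<open>ev_dl\<close> evaluation turns \<open>dl\<close> into \<open>tr\<close>, so
  relations (1) and (2) become identities between traces, and (3) holds because \<open>w k\<close>
  vanishes.\<close>

lemma ev_rel_idl:
  assumes "f \<in> rel_idl n"
  shows "ev f \<in> In n"
proof -
  have 1: "ev f \<in> In n" if mem: "f \<in> rels1 n" for f
  proof -
    obtain k where k: "odd k" "k < 2 * n"
      and f: "f = Var (P_sym k) ^ 2 - (\<Sum>i=0..(k - 1) div 2. delta n (W (2 * i) * W (2 * (k - i)))
          + delta n (W (2 * i)) * delta n (W (2 * (k - i))))"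
      using mem unfolding rels1_def by blast
    have f': "f = Var (P_sym k) * Var (P_sym k) + pw_sq n k"
      by (simp add: f pw_sq_def dl_def w.rep_eq power2_eq_square)
    have "(\<Sum>i=0..(k - 1) div 2. (ev (dl n (w (2 * i) * w (2 * (k - i)))) + ev (dl n (w (2 * i))) * ev (dl n (w (2 * (k - i)))))
        + (tr (w (2 * i) * w (2 * (k - i))) + tr (w (2 * i)) * tr (w (2 * (k - i))))) \<in> In n"
      by (intro Gr_idl_sum In_add_cong In_mult_cong ev_dl)
    then have "ev (pw_sq n k) + (pw k)\<^sup>2 \<in> In n"
      by (simp add: pw_sq_def pw_power2_odd[OF k(1)] ev_sum sum.distrib ac_simps)
    then show ?thesis
      by (simp add: f' gen_val_def power2_eq_square add.commute)
  qed
  have 2: "ev f \<in> In n" if mem: "f \<in> rels2 n" for f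
  proof -
    obtain x y z where "x \<in> sqf_mons n" "y \<in> sqf_mons n" "z \<in> sqf_mons n"
      and f: "f = delta n (y * z) * delta n x + delta n (x * z) * delta n y + delta n (x * y) * delta n z
       - delta n x * delta n y * delta n z"
      using mem unfolding rels2_def by blast
    then obtain a b c where abc: "x = Rep_wpoly a" "y = Rep_wpoly b" "z = Rep_wpoly c"
      using delta_sqf by metis
    have f': "f = dl n (b * c) * dl n a + dl n (a * c) * dl n b + dl n (a * b) * dl n c + dl n a * dl n b * dl n c"
      by (simp add: f abc dl_def)
    have "ev f + (tr (b * c) * tr a + tr (a * c) * tr b + tr (a * b) * tr c + tr a * tr b * tr c) \<in> In n"
      unfolding f' ev_simps by (intro In_add_cong In_mult_cong ev_dl)
    moreover have "tr (b * c) * tr a + tr (a * c) * tr b + tr (a * b) * tr c + tr a * tr b * tr c = 0"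
      by (simp add: tr_mult algebra_simps)
    ultimately show ?thesis by simp
  qed
  have 3: "ev f \<in> In n" if mem: "f \<in> rels3 n" for f
  proof -
    obtain x k where x: "x \<in> sqf_mons n" and k: "n < k" and f: "f = delta n (x * W k)"
      using mem unfolding rels3_def by blast
    obtain A where "x = Rep_wpoly (wset A)"
      using delta_sqf[OF x] by blast
    then have "f = dl n (wset A * w k)"
      by (simp add: f dl_def w.rep_eq)
    moreover have "tr (wset A * w k) \<in> In n"
      by (intro tr_in_In Gr_idl_mult(1) w_in_Gr_idl k)
    ultimately show ?thesis
      using ev_dl[of n "wset A * w k"] Gr_idl_cancel by blast
  qed
  show ?thesis
    using assms unfolding rel_idl_def
  proof (induction rule: ring_module.span_induct_alt)
    case (step c x y)
    then have "ev x \<in> In n" using 1 2 3 by blast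
    then show ?case
      using step by (auto intro: Gr_idl_add Gr_idl_mult)
  qed simp
qed

lemma ev_eqv: "eqv n f g \<Longrightarrow> ev f + ev g \<in> In n"
  using ev_rel_idl[of "f + g" n] by (simp add: eqv_def)

section \<open>Normal forms in the presented algebra\<close>

definition pgen_mon :: "nat set \<Rightarrow> gen mpoly2" where
  "pgen_mon B = (\<Prod>j\<in>B. Var (P_sym j))"

definition normal_forms :: "nat \<Rightarrow> gen mpoly2 set" where
  "normal_forms n = {f. \<exists>\<B>\<subseteq>Pow (odds n). \<exists>x. eqv n f ((\<Sum>B\<in>\<B>. pgen_mon B) + dl n x)}"

lemma ev_pgen_mon [simp]: "ev (pgen_mon B) = pmon B"
  by (simp add: pgen_mon_def pmon_def ev_prod gen_val_def)

lemma normal_formsI: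
  "\<B> \<subseteq> Pow (odds n) \<Longrightarrow> eqv n f ((\<Sum>B\<in>\<B>. pgen_mon B) + dl n x) \<Longrightarrow> f \<in> normal_forms n"
  unfolding normal_forms_def by (intro CollectI exI conjI)

lemma normal_formsE:
  assumes "f \<in> normal_forms n"
  obtains \<B> x where "\<B> \<subseteq> Pow (odds n)" "eqv n f ((\<Sum>B\<in>\<B>. pgen_mon B) + dl n x)"
  using assms unfolding normal_forms_def mem_Collect_eq by (elim exE conjE)

lemma normal_eqv: "eqv n f g \<Longrightarrow> g \<in> normal_forms n \<Longrightarrow> f \<in> normal_forms n"
proof -
  assume fg: "eqv n f g" and "g \<in> normal_forms n"
  then obtain \<B> x where "\<B> \<subseteq> Pow (odds n)" "eqv n g ((\<Sum>B\<in>\<B>. pgen_mon B) + dl n x)"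
    by (elim normal_formsE)
  then show ?thesis
    by (intro normal_formsI[OF _ eqv_trans[OF fg]])
qed

lemma normal_dl: "dl n x \<in> normal_forms n"
  by (rule normal_formsI[of "{}" _ _ x]) auto

lemma normal_pgen_mon: "B \<subseteq> odds n \<Longrightarrow> pgen_mon B \<in> normal_forms n"
  by (rule normal_formsI[of "{B}" _ _ 0]) auto

lemma normal_add:
  assumes "f \<in> normal_forms n" "g \<in> normal_forms n"
  shows "f + g \<in> normal_forms n"
proof -
  obtain \<B> x where \<B>: "\<B> \<subseteq> Pow (odds n)" and f: "eqv n f ((\<Sum>B\<in>\<B>. pgen_mon B) + dl n x)"
    using assms(1) by (rule normal_formsE)
  obtain \<C> y where \<C>: "\<C> \<subseteq> Pow (odds n)" and g: "eqv n g ((\<Sum>B\<in>\<C>. pgen_mon B) + dl n y)"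
    using assms(2) by (rule normal_formsE)
  have "finite \<B>" "finite \<C>"
    using \<B> \<C> finite_subset by (meson finite_Pow_iff finite_odds)+
  then have "((\<Sum>B\<in>\<B>. pgen_mon B) + dl n x) + ((\<Sum>B\<in>\<C>. pgen_mon B) + dl n y)
      = (\<Sum>B\<in>sym_diff \<B> \<C>. pgen_mon B) + dl n (x + y)"
    by (simp add: sum_sym_diff_char2 dl_add ac_simps)
  then have "eqv n (f + g) ((\<Sum>B\<in>sym_diff \<B> \<C>. pgen_mon B) + dl n (x + y))"
    using eqv_add[OF f g] by simp
  moreover have "sym_diff \<B> \<C> \<subseteq> Pow (odds n)"
    using \<B> \<C> by blast
  ultimately show ?thesis
    by (intro normal_formsI)
qed

lemma normal_0: "0 \<in> normal_forms n"
  using normal_dl[of n 0] by simp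

lemma normal_sum: "(\<And>i. i \<in> A \<Longrightarrow> f i \<in> normal_forms n) \<Longrightarrow> (\<Sum>i\<in>A. f i) \<in> normal_forms n"
  by (induction A rule: infinite_finite_induct) (auto intro: normal_add normal_0)

lemma normalE:
  assumes "f \<in> normal_forms n" 
    and "\<And>B. B \<subseteq> odds n \<Longrightarrow> h * pgen_mon B \<in> normal_forms n" "\<And>x. h * dl n x \<in> normal_forms n"
  shows "h * f \<in> normal_forms n"
proof -
  obtain \<B> x where \<B>: "\<B> \<subseteq> Pow (odds n)" and f: "eqv n f ((\<Sum>B\<in>\<B>. pgen_mon B) + dl n x)"
    using assms(1) by (rule normal_formsE)
  have "(\<Sum>B\<in>\<B>. h * pgen_mon B) + h * dl n x \<in> normal_forms n"
    using \<B> by (intro normal_add normal_sum assms) auto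
  then have "h * ((\<Sum>B\<in>\<B>. pgen_mon B) + dl n x) \<in> normal_forms n"
    by (simp add: distrib_left sum_distrib_left)
  then show ?thesis
    using normal_eqv[OF eqv_mult_left[OF f]] by blast
qed

lemma p_gen_odds: "j \<in> odds n \<Longrightarrow> p_gen n j = Var (P_sym j)"
  by (simp add: odds_def p_gen_def)

lemma pgen_mon_dl:
  assumes "B \<subseteq> odds n"
  shows "eqv n (pgen_mon B * dl n x) (dl n (pmon B * x))"
proof -
  have "finite B" using assms finite_subset finite_odds by blast
  then show ?thesis
    using assms
  proof (induction B)
    case (insert j B)
    have j: "j \<in> odds n" "odd j" using insert by (auto simp: odds_def)
    have "eqv n (p_gen n j * (pgen_mon B * dl n x)) (p_gen n j * dl n (pmon B * x))"
      using insert by (intro eqv_mult_left) auto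
    also have "eqv n \<dots> (dl n (pw j * (pmon B * x)))"
      by (intro eqv_sym[OF dl_pw_mult] j)
    finally show ?case
      using insert.hyps j by (simp add: pgen_mon_def pmon_insert p_gen_odds mult.assoc)
  qed (simp add: pgen_mon_def pmon_def)
qed

text \<open>The products in relation (1) are absorbed by \<open>dl_mult_tr\<close>, so the square of
  a power sum becomes a single value of delta and the normal form is kept.\<close>

lemma pw_sq_eqv: "\<exists>y. eqv n (pw_sq n j) (dl n y)"
proof
  have "eqv n (\<Sum>i=0..(j - 1) div 2. dl n (w (2 * i) * w (2 * (j - i))) + dl n (w (2 * i)) * dl n (w (2 * (j - i))))
     (\<Sum>i=0..(j - 1) div 2. dl n (w (2 * i) * w (2 * (j - i))) + dl n (w (2 * i) * tr (w (2 * (j - i)))))"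
    by (intro eqv_sum eqv_add eqv_refl eqv_sym[OF dl_mult_tr])
  then show "eqv n (pw_sq n j) (dl n (\<Sum>i=0..(j - 1) div 2. w (2 * i) * w (2 * (j - i)) + w (2 * i) * tr (w (2 * (j - i)))))"
    by (simp add: pw_sq_def dl_sum dl_add)
qed

lemma normal_P_sym:
  assumes j: "j \<in> odds n" and f: "f \<in> normal_forms n"
  shows "Var (P_sym j) * f \<in> normal_forms n"
proof (rule normalE[OF f])
  have odd: "odd j" using j by (simp add: odds_def)
  fix x
  have "eqv n (Var (P_sym j) * dl n x) (dl n (pw j * x))"
    using eqv_sym[OF dl_pw_mult[OF odd, of n x]] by (simp only: p_gen_odds[OF j])
  then show "Var (P_sym j) * dl n x \<in> normal_forms n"
    by (rule normal_eqv[OF _ normal_dl])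
next
  fix B assume B: "B \<subseteq> odds n"
  then have finB: "finite B" using finite_subset finite_odds by blast
  show "Var (P_sym j) * pgen_mon B \<in> normal_forms n"
  proof (cases "j \<in> B")
    case False
    then have "Var (P_sym j) * pgen_mon B = pgen_mon (insert j B)"
      using finB by (simp add: pgen_mon_def)
    then show ?thesis
      using B j by (simp add: normal_pgen_mon)
  next
    case True
    have B': "B - {j} \<subseteq> odds n" using B by blast
    have odd: "odd j" using j by (simp add: odds_def)
    obtain y where y: "eqv n (pw_sq n j) (dl n y)"
      using pw_sq_eqv by blast
    have "Var (P_sym j) * pgen_mon B = pgen_mon (B - {j}) * p_gen n j ^ 2"
      using True finB p_gen_odds[OF j]
      by (simp add: pgen_mon_def prod.remove[of B j] power2_eq_square ac_simps)
    moreover have "eqv n (pgen_mon (B - {j}) * p_gen n j ^ 2) (pgen_mon (B - {j}) * dl n y)"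
      by (intro eqv_mult_left eqv_trans[OF p_gen_power2[OF odd] y])
    then have "eqv n (pgen_mon (B - {j}) * p_gen n j ^ 2) (dl n (pmon (B - {j}) * y))"
      using pgen_mon_dl[OF B'] eqv_trans by blast
    ultimately show ?thesis
      using normal_eqv[OF _ normal_dl] by simp
  qed
qed

lemma normal_D_sym:
  assumes A: "A \<subseteq> evens n" "A \<noteq> {}" and f: "f \<in> normal_forms n"
  shows "Var (D_sym A) * f \<in> normal_forms n"
proof -
  have D: "Var (D_sym A) = dl n (wset A)"
    using A by (simp add: dl_wset eset_evens delta_gen_def)
  show ?thesis
    unfolding D
  proof (rule normalE[OF f])
    fix x
    show "dl n (wset A) * dl n x \<in> normal_forms n"
      by (rule normal_eqv[OF eqv_sym[OF dl_mult_tr] normal_dl])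
  next
    fix B assume "B \<subseteq> odds n"
    then show "dl n (wset A) * pgen_mon B \<in> normal_forms n"
      using normal_eqv[OF pgen_mon_dl normal_dl] by (simp add: mult.commute)
  qed
qed

lemma free_alg_normal:
  assumes "f \<in> carrier (free_alg n)"
  shows "f \<in> normal_forms n"
  using assms
proof (induction rule: poly_ring_induct)
  case one
  then show ?case
    using normal_pgen_mon[of "{}" n] by (simp add: pgen_mon_def)
next
  case (mult v f)
  then show ?case
    by (auto simp: gens_def odds_def intro!: normal_D_sym normal_P_sym)
qed (auto intro: normal_0 normal_add)

lemma dl_sum_pmon:
  assumes "\<B> \<subseteq> Pow (odds n)"
  shows "dl n (\<Sum>B\<in>\<B>. pmon B) = 0"
proof -
  have "dl n (pmon B) = 0" if "B \<in> \<B>" for B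
  proof -
    have "B \<subseteq> odds n" using assms that by blast
    then have "(B, {}, {#}) \<in> basis_indices"
      using finite_subset[OF _ finite_odds] by (auto simp: basis_indices_iff eset_def odds_def)
    then show ?thesis
      using dl_belt[of "(B, {}, {#})" n] by (simp add: belt_def delta_basis_def delta_gen_def)
  qed
  then show ?thesis by (simp add: dl_sum)
qed

lemma dl_eqv_0:
  assumes "tr x \<in> In n"
  shows "eqv n (dl n x) 0"
proof -
  obtain \<B> r where \<B>: "\<B> \<subseteq> Pow (odds n)" and x: "x + ((\<Sum>B\<in>\<B>. pmon B) + tr r) \<in> In n"
    using invariants_mod_traces[OF assms] by blast
  have "dl n (x + ((\<Sum>B\<in>\<B>. pmon B) + tr r)) = dl n x + dl n (tr r)"
    using dl_sum_pmon[OF \<B>] by (simp add: dl_add)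
  then have "eqv n (dl n x + dl n (tr r)) 0"
    using dl_In[OF x] by simp
  from eqv_add_0[OF this dl_tr[of n r]] show ?thesis
    by (simp add: add.assoc)
qed

lemma ev_kernel:
  assumes f: "f \<in> carrier (free_alg n)" and ev: "ev f \<in> In n"
  shows "f \<in> rel_idl n"
proof -
  obtain \<B> x where \<B>: "\<B> \<subseteq> Pow (odds n)" and fx: "eqv n f ((\<Sum>B\<in>\<B>. pgen_mon B) + dl n x)"
    using free_alg_normal[OF f] by (rule normal_formsE)
  have "ev f + ((\<Sum>B\<in>\<B>. pmon B) + ev (dl n x)) \<in> In n"
    using ev_eqv[OF fx] by (simp add: ev_sum)
  then have "(\<Sum>B\<in>\<B>. pmon B) + ev (dl n x) \<in> In n"
    using ev Gr_idl_cancel by blast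
  then have s: "(\<Sum>B\<in>\<B>. pmon B) + tr x \<in> In n"
    using Gr_idl_add[OF _ ev_dl[of n x]] by (metis (no_types, lifting) add.assoc add_self_left)
  then have B: "\<B> = {}"
    by (rule pmon_independent_mod_traces[OF \<B>])
  then have "eqv n (dl n x) 0"
    using s by (intro dl_eqv_0) simp
  with fx B have "eqv n f 0"
    using eqv_trans by (metis add_0_left sum.empty)
  then show ?thesis by (simp add: eqv_def)
qed

lemma delta_gen_closed: "delta_gen n A \<in> carrier (free_alg n)"
  by (auto simp: delta_gen_def gens_def)

lemma p_gen_closed: "odd j \<Longrightarrow> p_gen n j \<in> carrier (free_alg n)"
  by (auto simp: p_gen_def gens_def)

lemma dl_closed: "dl n x \<in> carrier (free_alg n)"
proof -
  obtain d where "x \<in> wF d" using wF_ex by blast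
  then show ?thesis
  proof (induction rule: wF_induct)
    case (belt B A M)
    have "(\<Prod>i\<in>#M. delta_gen n {i}) \<in> carrier (free_alg n)" for M
      by (induction M) (auto intro: delta_gen_closed)
    moreover have "(\<Prod>j\<in>B. p_gen n j) \<in> carrier (free_alg n)"
      using belt by (intro poly_carrier_prod p_gen_closed) (auto simp: basis_indices_iff)
    ultimately show ?case
      using belt by (auto simp: dl_belt delta_basis_def intro!: delta_gen_closed)
  qed (auto simp: dl_add)
qed

lemma rels_closed: "rels1 n \<union> rels2 n \<union> rels3 n \<subseteq> carrier (free_alg n)"
proof -
  have d: "delta n (Rep_wpoly x) \<in> carrier (free_alg n)" for x
    using dl_closed[of n x] by (simp add: dl_def)
  have W: "delta n (W i) \<in> carrier (free_alg n)" "delta n (W i * W j) \<in> carrier (free_alg n)" for i j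
    using d[of "w i"] d[of "w i * w j"] by (simp_all add: w.rep_eq)
  have "f \<in> carrier (free_alg n)" if mem: "f \<in> rels1 n" for f
  proof -
    obtain k where k: "odd k" "k < 2 * n"
      and f: "f = Var (P_sym k) ^ 2 - (\<Sum>i=0..(k - 1) div 2. delta n (W (2 * i) * W (2 * (k - i)))
          + delta n (W (2 * i)) * delta n (W (2 * (k - i))))"
      using mem unfolding rels1_def by blast
    have "P_sym k \<in> gens n"
      using k by (simp add: gens_def)
    then show ?thesis
      unfolding f diff_char2
      by (intro poly_carrier_closed(3,4,5) poly_carrier_sum poly_carrier_power W)
  qed
  moreover have "f \<in> carrier (free_alg n)" if mem: "f \<in> rels2 n" for f
  proof -
    obtain x y z where "x \<in> sqf_mons n" "y \<in> sqf_mons n" "z \<in> sqf_mons n"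
      and f: "f = delta n (y * z) * delta n x + delta n (x * z) * delta n y + delta n (x * y) * delta n z
       - delta n x * delta n y * delta n z"
      using mem unfolding rels2_def by blast
    then obtain a b c where abc: "x = Rep_wpoly a" "y = Rep_wpoly b" "z = Rep_wpoly c"
      using delta_sqf by metis
    show ?thesis
      unfolding f abc diff_char2 Rep_wpoly_simps(4)[symmetric]
      by (intro poly_carrier_closed(3,4) d)
  qed
  moreover have "f \<in> carrier (free_alg n)" if mem: "f \<in> rels3 n" for f
  proof -
    obtain x k where x: "x \<in> sqf_mons n" and f: "f = delta n (x * W k)"
      using mem unfolding rels3_def by blast
    obtain A where "x = Rep_wpoly (wset A)"
      using delta_sqf[OF x] by blast
    then show ?thesis
      using d[of "wset A * w k"] by (simp add: f w.rep_eq)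
  qed
  ultimately show ?thesis by blast
qed

lemma rel_ideal_eq: "rel_ideal n = {f \<in> carrier (free_alg n). f \<in> rel_idl n}"
  unfolding rel_ideal_def rel_idl_def by (rule genideal_poly_ring[OF rels_closed])

lemma ev_surj:
  assumes "tr y \<in> In n"
  shows "\<exists>f\<in>carrier (free_alg n). ev f + y \<in> In n"
proof -
  obtain \<B> r where \<B>: "\<B> \<subseteq> Pow (odds n)" and y: "y + ((\<Sum>B\<in>\<B>. pmon B) + tr r) \<in> In n"
    using invariants_mod_traces[OF assms] by blast
  define f where "f = (\<Sum>B\<in>\<B>. pgen_mon B) + dl n r"
  have "f \<in> carrier (free_alg n)"
    unfolding f_def pgen_mon_def using \<B>
    by (intro poly_carrier_closed(3) dl_closed poly_carrier_sum poly_carrier_prod poly_carrier_closed(5))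
      (auto simp: gens_def odds_def)
  moreover have "ev f + y \<in> In n"
    using Gr_idl_add[OF y ev_dl[of n r]] by (simp add: f_def ev_sum ac_simps)
  ultimately show ?thesis by blast
qed

lemma ev_invariant:
  assumes "f \<in> carrier (free_alg n)"
  shows "bar (ev f) = ev f"
  using assms
  by (induction rule: poly_ring_induct) (auto simp: gens_def gen_val_def)

theorem theorem7p4:
  fixes n :: nat
  assumes "n \<ge> 1"
  shows "\<exists>\<phi> \<in> ring_iso (presented_alg n) (S_Gr n).
    (\<forall>j. odd j \<and> j < 2 * n \<longrightarrow>
       \<phi> (class_pres n (Var (P_sym j))) = class_Gr n (psum j)) \<and>
    (\<forall>A. A \<subseteq> evens n \<and> A \<noteq> {} \<longrightarrow>
       \<phi> (class_pres n (Var (D_sym A))) = class_Gr n (dd (sqf_mon A)))"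
proof -
  define h where "h f = class_Gr n (Rep_wpoly (ev f))" for f
  interpret F: cring "free_alg n" by (rule cring_poly_ring)
  interpret w_ring: cring w_ring by (rule cring_poly_ring)
  interpret I: ideal "Gr_ideal n" w_ring by (rule ideal_Gr_ideal)
  have "h \<in> ring_hom (free_alg n) (R_Gr n)"
  proof (rule ring_hom_memI)
    have hom: "class_Gr n \<in> ring_hom w_ring (R_Gr n)"
      using I.rcos_ring_hom unfolding R_Gr_def class_Gr_def[abs_def] by simp
    have Rep: "Rep_wpoly x \<in> carrier w_ring" for x
      by (rule Rep_wpoly)
    show "h f \<in> carrier (R_Gr n)" for f
      unfolding h_def by (rule ring_hom_memE(1)[OF hom Rep])
    show "h (f \<otimes>\<^bsub>free_alg n\<^esub> g) = h f \<otimes>\<^bsub>R_Gr n\<^esub> h g" for f g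
      using ring_hom_memE(2)[OF hom Rep Rep, of "ev f" "ev g"] by (simp add: h_def)
    show "h (f \<oplus>\<^bsub>free_alg n\<^esub> g) = h f \<oplus>\<^bsub>R_Gr n\<^esub> h g" for f g
      using ring_hom_memE(3)[OF hom Rep Rep, of "ev f" "ev g"] by (simp add: h_def)
    show "h \<one>\<^bsub>free_alg n\<^esub> = \<one>\<^bsub>R_Gr n\<^esub>"
      using ring_hom_memE(4)[OF hom] by (simp add: h_def)
  qed
  moreover have "ring (R_Gr n)"
    unfolding R_Gr_def by (rule I.quotient_is_ring)
  ultimately interpret h: ring_hom_ring "free_alg n" "R_Gr n" h
    by (intro ring_hom_ringI2 F.ring_axioms)
  have ker: "a_kernel (free_alg n) (R_Gr n) h = rel_ideal n"
  proof -
    have "class_Gr n (Rep_wpoly 0) = Gr_ideal n"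
      unfolding class_Gr_eq Gr_ideal_eq by simp
    then have "\<zero>\<^bsub>R_Gr n\<^esub> = class_Gr n (Rep_wpoly 0)"
      by (simp add: R_Gr_def FactRing_def)
    then have "h f = \<zero>\<^bsub>R_Gr n\<^esub> \<longleftrightarrow> ev f \<in> In n" for f
      unfolding h_def by (simp only: class_Gr_eq_iff add_0_right)
    then show ?thesis
      unfolding a_kernel_def' rel_ideal_eq using ev_kernel ev_rel_idl by auto
  qed
  have img: "h ` carrier (free_alg n) = carrier (S_Gr n)"
  proof
    have "tr (ev f) = 0" if "f \<in> carrier (free_alg n)" for f
      using ev_invariant[OF that] by (simp add: tr_def)
    then show "h ` carrier (free_alg n) \<subseteq> carrier (S_Gr n)"
      unfolding carrier_S_Gr h_def by force
    show "carrier (S_Gr n) \<subseteq> h ` carrier (free_alg n)"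
    proof
      fix C assume "C \<in> carrier (S_Gr n)"
      then obtain y where y: "C = class_Gr n (Rep_wpoly y)" "tr y \<in> In n"
        unfolding carrier_S_Gr by blast
      obtain f where "f \<in> carrier (free_alg n)" "ev f + y \<in> In n"
        using ev_surj[OF y(2)] by blast
      then show "C \<in> h ` carrier (free_alg n)"
        unfolding y(1) h_def by (metis class_Gr_eq_iff imageI)
    qed
  qed
  define \<phi> where "\<phi> = (\<lambda>X. the_elem (h ` X))"
  \<comment> \<open>The isomorphism theorem gives the target ring with its carrier cut down to the
    image, and this is how the ring of invariants is defined.\<close>
  have "(R_Gr n)\<lparr>carrier := h ` carrier (free_alg n)\<rparr> = S_Gr n"
    unfolding img by (simp add: S_Gr_def)
  then have "\<phi> \<in> ring_iso (presented_alg n) (S_Gr n)"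
    using h.FactRing_iso_set_aux by (simp add: ker presented_alg_def \<phi>_def)
  moreover have val: "\<phi> (class_pres n f) = h f" if "f \<in> carrier (free_alg n)" for f
    using h.the_elem_simp[OF that] by (simp add: ker class_pres_def \<phi>_def)
  moreover have "\<phi> (class_pres n (Var (P_sym j))) = class_Gr n (psum j)" if "odd j" "j < 2 * n" for j
    using that by (subst val) (auto simp: gens_def h_def gen_val_def pw.rep_eq)
  moreover have "\<phi> (class_pres n (Var (D_sym A))) = class_Gr n (dd (sqf_mon A))"
    if "A \<subseteq> evens n" "A \<noteq> {}" for A
    using that by (subst val) (auto simp: gens_def h_def gen_val_def Rep_tr Rep_wset)
  ultimately show ?thesis by (intro bexI[of _ \<phi>] conjI allI impI) simp_all
qed

end
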